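(* Let $s\in\mathbb N$, let $\varphi$ be a probability density function on $\mathbb R$ and $\psi,\omega:\mathbb R\to(0,\infty)$ weight functions such that $(\varphi,\psi,\omega)$ satisfies Assumption A (see context) with constants $C>0$ and $\beta\in(0,1]$, and let $C_1:=\max(C,\frac12)$. Let $F\in L_2(\mathbb R^s,\varphi)$. For $\mathfrak v\subseteq\mathfrak u\subseteq[s]$ with $\mathfrak u\ne\emptyset$ let $(\boldsymbol k_{\mathfrak v}+\boldsymbol\ell_{\mathfrak v},\boldsymbol k_{\mathfrak u\setminus\mathfrak v},\boldsymbol0)=(y_1,\dots,y_s)\in\mathbb N_0^s$, where - for $j\in\mathfrak v$: $y_j=k_j+\ell_j$ with $k_j=2^{a_{j,1}}+2^{a_{j,2}}$, $a_{j,1}>a_{j,2}\ge0$, and $\ell_j\in\{0,1,\dots,2^{a_{j,2}}-1\}$; - for $j\in\mathfrak u\setminus\mathfrak v$: $y_j=k_j=2^{a_{j,1}}$, $a_{j,1}\ge0$; - for $j\in[s]\setminus\mathfrak u$: $y_j=0$. Then $$\big|\widetilde F^{(\varphi)}((\boldsymbol k_{\mathfrak v}+\boldsymbol\ell_{\mathfrak v},\boldsymbol k_{\mathfrak u\setminus\mathfrak v},\boldsymbol0))\big|\le C_1^{|\mathfrak u|}\,\|F\|_{\mathfrak u,\mathfrak v}\prod_{j\in\mathfrak v}\frac1{2^{a_{j,1}+\beta a_{j,2}}}\prod_{j\in\mathfrak u\setminus\mathfrak v}\frac1{2^{a_{j,1}}}.$$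
   Context: Notation: $\mathbb N=\{1,2,\dots\}$, $\mathbb N_0=\mathbb N\cup\{0\}$, $[s]=\{1,\dots,s\}$. $\varphi:\mathbb R\to(0,\infty)$ is a differentiable probability density with CDF $\Phi(x)=\int_{-\infty}^x\varphi(t)\,dt$ having a well-defined inverse $\Phi^{-1}:(0,1)\to\mathbb R$; $\varphi(\boldsymbol x)=\prod_{j=1}^s\varphi(x_j)$. Walsh functions: for $k=\sum_{i\ge0}\kappa_i2^i\in\mathbb N_0$ and $x=\sum_{i\ge1}\xi_i2^{-i}\in[0,1)$ (binary digits, infinitely many $\xi_i\ne1$), $\mathrm{wal}_k(x)=(-1)^{\sum_{i\ge0}\kappa_i\xi_{i+1}}$. Walsh coefficients: for $\boldsymbol k\in\mathbb N_0^s$, $$\widetilde F^{(\varphi)}(\boldsymbol k)=\int_{\mathbb R^s}F(\boldsymbol x)\prod_{j=1}^s\mathrm{wal}_{k_j}(\Phi(x_j))\,\varphi(\boldsymbol x)\,d\boldsymbol x.$$ For integers $a_1>a_2\ge0$, $k=2^{a_1}+2^{a_2}$, $m\in\{0,\dots,2^{a_2}-1\}$: $w_{k,m,2}(x)=2^{a_2/2}\mathbf 1_{[m/2^{a_2},(m+1)/2^{a_2})}(x)\,\mathrm{wal}_k(x)$ on $[0,1)$, $W_{k,m,2}(x)=\int_0^xw_{k,m,2}(y)\,dy$, $\widetilde W_{k,m,2}(x)=\int_0^xW_{k,m,2}(y)\,dy$, $\widetilde W^{(\varphi)}_{k,m,2}(x)=\widetilde W_{k,m,2}(\Phi(x))$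 for $x\in\mathbb R$. Assumption A (with constants $C>0$, $\beta\in(0,1]$): for every such $k=2^{a_1}+2^{a_2}$ and $m$, $$\sup_{x\in\mathbb R}\frac{|\widetilde W^{(\varphi)}_{k,m,2}(x)|}{\varphi(x)\psi(x)}\le C\frac{2^{a_2/2}}{2^{a_1+\beta a_2}}\quad\text{and}\quad\sup_{x\in\mathbb R}\frac{|\widetilde W^{(\varphi)}_{k,m,2}(x)\varphi'(x)|}{\varphi^2(x)\omega(x)}\le C\frac{2^{a_2/2}}{2^{a_1+\beta a_2}}.$$ $F:\mathbb R^s\to\mathbb R$ is assumed sufficiently smooth, meaning the partial derivatives $\frac{\partial^{|\mathfrak u|+|\mathfrak w|}F}{\partial\boldsymbol x_{\mathfrak w}\partial\boldsymbol x_{\mathfrak u}}$, $\mathfrak w\subseteq\mathfrak u\subseteq[s]$ (twice in $x_j$ for $j\in\mathfrak w$, once for $j\in\mathfrak u\setminus\mathfrak w$), exist and are continuous, and $$\|F\|_{\mathfrak u,\mathfrak v}=\sum_{\mathfrak w\subseteq\mathfrak v}\int_{\mathbb R^{|\mathfrak u|}}\Big|\int_{\mathbb R^{s-|\mathfrak u|}}\frac{\partial^{|\mathfrak u|+|\mathfrak w|}F}{\partial\boldsymbol x_{\mathfrak w}\partial\boldsymbol x_{\mathfrak u}}(\boldsymbol x)\prod_{j\in[s]\setminus\mathfrak u}\varphi(x_j)\,d\boldsymbol x_{[s]\setminus\mathfrak u}\Big|\prod_{j\in\mathfrak w}\psi(x_j)\prod_{j\in\mathfrak v\setminus\mathfrak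 w}\omega(x_j)\,d\boldsymbol x_{\mathfrak u}.$$
   Formalization: Added assumption: for every w ⊆ v, the integrand of the inner integral in the norm of F is Lebesgue integrable over K × R^{s-|u|} for every compact K in R^{|u|}; without it the bound fails for some smooth F in L_2 with norm 0. *)

theory Defs
  imports "HOL-Analysis.Analysis" "HOL-Library.Multiset"
begin

text \<open>The dimension \<open>s\<close> is the cardinality of a finite index type \<open>'s\<close>, so that
  \<open>\<real>\<^sup>s\<close> is \<^typ>\<open>real ^ 's\<close> and \<open>[s]\<close> is \<^term>\<open>UNIV :: 's set\<close>.\<close>

subsection \<open>Densities\<close>

definition Phi :: "(real \<Rightarrow> real) \<Rightarrow> real \<Rightarrow> real" where
  "Phi \<phi> x = (LBINT t:{..x}. \<phi> t)"

definition prob_density :: "(real \<Rightarrow> real) \<Rightarrow> bool" where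
  "prob_density \<phi> \<longleftrightarrow>
     (\<forall>x. \<phi> x > 0) \<and> (\<forall>x. \<phi> differentiable (at x)) \<and>
     integrable lborel \<phi> \<and> (LBINT x. \<phi> x) = 1 \<and>
     bij_betw (Phi \<phi>) UNIV {0<..<1}"

definition weight_function :: "(real \<Rightarrow> real) \<Rightarrow> bool" where
  "weight_function \<psi> \<longleftrightarrow> \<psi> \<in> borel_measurable borel \<and> (\<forall>x. \<psi> x > 0)"

definition in_L2 :: "(real \<Rightarrow> real) \<Rightarrow> (real ^ 's::finite \<Rightarrow> real) \<Rightarrow> bool" where
  "in_L2 \<phi> F \<longleftrightarrow> F \<in> borel_measurable borel \<and>
     integrable lborel (\<lambda>x. (F x)\<^sup>2 * (\<Prod>j\<in>UNIV. \<phi> (x $ j)))"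

subsection \<open>Walsh functions and Walsh coefficients\<close>

text \<open>For \<open>x \<in> [0,1)\<close> this is the digit \<open>\<xi>\<^sub>i\<close> (\<open>i \<ge> 1\<close>) of the binary expansion of \<open>x\<close>
  which has infinitely many digits different from 1.\<close>

definition bin_digit :: "real \<Rightarrow> nat \<Rightarrow> nat" where
  "bin_digit x i = nat \<lfloor>2 ^ i * x\<rfloor> mod 2"

definition wal :: "nat \<Rightarrow> real \<Rightarrow> real" where
  "wal k x = (-1) ^ (\<Sum>i | bit k i. bin_digit x (Suc i))"

definition walsh_coeff ::
  "(real \<Rightarrow> real) \<Rightarrow> (real ^ 's::finite \<Rightarrow> real) \<Rightarrow> ('s \<Rightarrow> nat) \<Rightarrow> real" where
  "walsh_coeff \<phi> F k =
     (LBINT x. F x * (\<Prod>j\<in>UNIV. wal (k j) (Phi \<phi> (x $ j))) * (\<Prod>j\<in>UNIV. \<phi> (x $ j)))"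

text \<open>The functions \<open>w\<^bsub>k,m,2\<^esub>\<close>, \<open>W\<^bsub>k,m,2\<^esub>\<close> and their descendants, for
  \<open>k = 2\<^bsup>a1\<^esup> + 2\<^bsup>a2\<^esup>\<close>; they are only meaningful at arguments in \<open>[0,1)\<close>, except
  the last one, which lives on \<open>\<real>\<close>.\<close>

definition w2 :: "nat \<Rightarrow> nat \<Rightarrow> nat \<Rightarrow> real \<Rightarrow> real" where
  "w2 a1 a2 m x = 2 powr (real a2 / 2)
     * indicator {real m / 2 ^ a2 ..< (real m + 1) / 2 ^ a2} x * wal (2 ^ a1 + 2 ^ a2) x"

definition W2 :: "nat \<Rightarrow> nat \<Rightarrow> nat \<Rightarrow> real \<Rightarrow> real" where
  "W2 a1 a2 m x = (LBINT y:{0..x}. w2 a1 a2 m y)"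

definition W2_tilde :: "nat \<Rightarrow> nat \<Rightarrow> nat \<Rightarrow> real \<Rightarrow> real" where
  "W2_tilde a1 a2 m x = (LBINT y:{0..x}. W2 a1 a2 m y)"

definition W2_phi :: "(real \<Rightarrow> real) \<Rightarrow> nat \<Rightarrow> nat \<Rightarrow> nat \<Rightarrow> real \<Rightarrow> real" where
  "W2_phi \<phi> a1 a2 m x = W2_tilde a1 a2 m (Phi \<phi> x)"

text \<open>The suprema are taken in the extended reals, so that \<open>SUP \<le> bound\<close> includes
  boundedness.\<close>

definition assumption_A ::
  "(real \<Rightarrow> real) \<Rightarrow> (real \<Rightarrow> real) \<Rightarrow> (real \<Rightarrow> real) \<Rightarrow> real \<Rightarrow> real \<Rightarrow> bool" where
  "assumption_A \<phi> \<psi> \<omega> C \<beta> \<longleftrightarrow>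
     (\<forall>a1 a2 m. a2 < a1 \<longrightarrow> m < 2 ^ a2 \<longrightarrow>
       (SUP x. ereal (\<bar>W2_phi \<phi> a1 a2 m x\<bar> / (\<phi> x * \<psi> x)))
         \<le> ereal (C * (2 powr (real a2 / 2) / 2 powr (real a1 + \<beta> * real a2))) \<and>
       (SUP x. ereal (\<bar>W2_phi \<phi> a1 a2 m x * deriv \<phi> x\<bar> / ((\<phi> x)\<^sup>2 * \<omega> x)))
         \<le> ereal (C * (2 powr (real a2 / 2) / 2 powr (real a1 + \<beta> * real a2))))"

subsection \<open>Mixed partial derivatives\<close>

definition partial :: "'s::finite \<Rightarrow> (real ^ 's \<Rightarrow> real) \<Rightarrow> real ^ 's \<Rightarrow> real" where
  "partial j F x = deriv (\<lambda>t. F (x + t *\<^sub>R axis j 1)) 0"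

definition partial_exists :: "'s::finite \<Rightarrow> (real ^ 's \<Rightarrow> real) \<Rightarrow> bool" where
  "partial_exists j F \<longleftrightarrow> (\<forall>x. (\<lambda>t. F (x + t *\<^sub>R axis j 1)) differentiable (at 0))"

text \<open>The last element of the list is differentiated first.\<close>

fun partials :: "'s::finite list \<Rightarrow> (real ^ 's \<Rightarrow> real) \<Rightarrow> real ^ 's \<Rightarrow> real" where
  "partials [] F = F"
| "partials (j # js) F = partial j (partials js F)"

fun partials_exist :: "'s::finite list \<Rightarrow> (real ^ 's \<Rightarrow> real) \<Rightarrow> bool" where
  "partials_exist [] F \<longleftrightarrow> True"
| "partials_exist (j # js) F \<longleftrightarrow> partials_exist js F \<and> partial_exists j (partials js F)"

text \<open>The orders in which the differentiations of
  \<open>\<partial>\<^bsup>|u|+|w|\<^esup>F / \<partial>x\<^sub>w\<partial>x\<^sub>u\<close> (\<open>w \<subseteq> u\<close>) can be carried out: the coordinates in \<open>w\<close>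
  occur twice, those in \<open>u - w\<close> once.\<close>

definition diff_orders :: "'s::finite set \<Rightarrow> 's set \<Rightarrow> 's list set" where
  "diff_orders u w = {js. mset js = mset_set u + mset_set w}"

definition sufficiently_smooth :: "(real ^ 's::finite \<Rightarrow> real) \<Rightarrow> bool" where
  "sufficiently_smooth F \<longleftrightarrow>
     (\<forall>u w. w \<subseteq> u \<longrightarrow> (\<forall>js \<in> diff_orders u w.
        partials_exist js F \<and> continuous_on UNIV (partials js F)))"

text \<open>For sufficiently smooth \<open>F\<close> the choice of the order is immaterial, by Schwarz's
  theorem.\<close>

definition mixed_partial ::
  "(real ^ 's::finite \<Rightarrow> real) \<Rightarrow> 's set \<Rightarrow> 's set \<Rightarrow> real ^ 's \<Rightarrow> real" where
  "mixed_partial F u w = partials (SOME js. js \<in> diff_orders u w) F"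

subsection \<open>The norm\<close>

definition glue :: "'s::finite set \<Rightarrow> ('s \<Rightarrow> real) \<Rightarrow> ('s \<Rightarrow> real) \<Rightarrow> real ^ 's" where
  "glue u x y = (\<chi> j. if j \<in> u then x j else y j)"

definition inner_integral ::
  "(real \<Rightarrow> real) \<Rightarrow> (real ^ 's::finite \<Rightarrow> real) \<Rightarrow> 's set \<Rightarrow> 's set \<Rightarrow> ('s \<Rightarrow> real) \<Rightarrow> real" where
  "inner_integral \<phi> F u w x =
     (LINT y|PiM (- u) (\<lambda>_. lborel). mixed_partial F u w (glue u x y) * (\<Prod>j\<in>- u. \<phi> (y j)))"

text \<open>The norm \<open>\<parallel>F\<parallel>\<^bsub>u,v\<^esub>\<close> may be infinite.\<close>

definition norm_uv ::
  "(real \<Rightarrow> real) \<Rightarrow> (real \<Rightarrow> real) \<Rightarrow> (real \<Rightarrow> real) \<Rightarrow> (real ^ 's::finite \<Rightarrow> real)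
     \<Rightarrow> 's set \<Rightarrow> 's set \<Rightarrow> ennreal" where
  "norm_uv \<phi> \<psi> \<omega> F u v =
     (\<Sum>w\<in>Pow v. \<integral>\<^sup>+ x. ennreal (\<bar>inner_integral \<phi> F u w x\<bar>
         * (\<Prod>j\<in>w. \<psi> (x j)) * (\<Prod>j\<in>v - w. \<omega> (x j))) \<partial>PiM u (\<lambda>_. lborel))"

text \<open>The inner integrals of \<open>\<parallel>F\<parallel>\<^bsub>u,v\<^esub>\<close> converge absolutely, locally
  integrably in \<open>x\<^sub>u\<close>: their integrands are Lebesgue integrable over
  \<open>K \<times> \<real>\<^bsup>s-|u|\<^esup>\<close> for every compact \<open>K \<subseteq> \<real>\<^bsup>|u|\<^esup>\<close>. In particular the inner
  integrals exist for almost every \<open>x\<^sub>u\<close>. Mere existence of the inner integrals (even for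
  every \<open>x\<^sub>u\<close>) would not allow differentiation under the integral sign: the mass of
  \<open>F(x\<^sub>u, \<cdot>)\<close> may escape to infinity as \<open>x\<^sub>u\<close> approaches some point. For
  \<open>u = [s]\<close> and \<open>F\<close> sufficiently smooth the condition is void.\<close>

definition inner_integrals_converge ::
  "(real \<Rightarrow> real) \<Rightarrow> (real ^ 's::finite \<Rightarrow> real) \<Rightarrow> 's set \<Rightarrow> 's set \<Rightarrow> bool" where
  "inner_integrals_converge \<phi> F u v \<longleftrightarrow>
     (\<forall>w\<subseteq>v. \<forall>r. set_integrable lborel {x. \<forall>j\<in>u. \<bar>x $ j\<bar> \<le> r}
        (\<lambda>x. mixed_partial F u w x * (\<Prod>j\<in>- u. \<phi> (x $ j))))"

end

theory Submission
  imports Defs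
begin

text \<open>The integrals against Walsh functions are small because Walsh functions have small iterated
antiderivatives. In a coordinate \<open>j \<in> u - v\<close> the function \<open>wal (2 ^ a1) (Phi \<phi> t) * \<phi> t\<close> is the derivative of
\<open>T (Phi \<phi> t)\<close>, where \<open>T\<close> (\<open>grid_dist\<close> below) is the triangular wave of height \<open>2\<^sup>-\<^sup>a\<^sup>1 / 2\<close>. So one integration by
parts moves a derivative to \<open>F\<close> and gains this height. In a coordinate \<open>j \<in> v\<close> the Walsh function of
index \<open>2 ^ a1 + 2 ^ a2 + l\<close> has the second antiderivative \<open>wal l * Q\<close> with a function \<open>Q \<ge> 0\<close> (\<open>hat\<close> below)
that vanishes on the dyadic grid of width \<open>2\<^sup>-\<^sup>a\<^sup>2\<close>; on the \<open>m\<close>-th interval of this grid \<open>Q\<close> is, up to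
the factor \<open>2 powr (a2 / 2)\<close>, the function \<open>W2_tilde a1 a2 m\<close> (\<open>W2_tilde_eq\<close>). These intervals are disjoint, so
Assumption A for the single \<open>m\<close> bounds \<open>Q (Phi \<phi> t)\<close> for every \<open>t\<close>. Two integrations by parts, the second
one against \<open>(wal l * Q) (Phi \<phi> t) / \<phi> t\<close>, produce one term with the second derivative of \<open>F\<close>, which is
measured by \<open>\<psi>\<close>, and one with the first derivative of \<open>F\<close> and with \<open>\<phi>' / \<phi>\<^sup>2\<close>, which is measured by \<open>\<omega>\<close>. Their
sum over all coordinates of \<open>v\<close> is the sum over \<open>w \<subseteq> v\<close> in the norm.

Three points need care.

The function \<open>F\<close> is only square integrable, so boundary terms at infinity cannot be discarded directly.
Instead \<open>Q\<close> is replaced by \<open>\<theta> (n Q) / n\<close> with a smooth cutoff \<open>\<theta>\<close> that vanishes on \<open>[0, 1]\<close>. The new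
antiderivatives have compact support in \<open>\<real>\<close>, they do not exceed \<open>Q\<close>, so that Assumption A still applies
to them, and their second derivatives are bounded uniformly in \<open>n\<close> because \<open>T\<^sup>2 \<le> 2 Q\<close>. In the coordinates
of \<open>u - v\<close> the function \<open>T\<close> is truncated in the same way. As
\<open>n \<rightarrow> \<infinity>\<close> the derivatives converge to the Walsh functions off a finite grid, and dominated
convergence gives the theorem from the estimate \<open>kernel_bound\<close> for compactly supported kernels.

The density \<open>\<phi>\<close> is differentiable, but \<open>\<phi>'\<close> need not be locally Lebesgue integrable. The second
integration by parts therefore uses the Henstock--Kurzweil integral: a derivative can be
integrated by parts against any absolutely continuous function (\<open>antiderivative_parts\<close>).

Only the derivatives of top order in the norm are known to be integrable over the coordinates
outside \<open>u\<close>. Hence the first integration by parts is carried out in all coordinates of \<open>u\<close> while the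
other coordinates are confined to a box (\<open>partials_by_parts\<close>). Only then is the integral over the
coordinates outside \<open>u\<close> taken, and the coordinates of \<open>u\<close> are integrated out one after another, each step
being the one-dimensional estimate for almost every value of the remaining coordinates (\<open>iterated_bound\<close>).\<close>

section \<open>Mixed partial derivatives\<close>

text \<open>The orders that \<open>sufficiently_smooth\<close> controls, described so that the property passes to tails and to
rearrangements of a list.\<close>

definition smooth_order :: "'s list \<Rightarrow> bool" where
  "smooth_order js \<longleftrightarrow> (\<forall>j. count (mset js) j \<le> 2)"

lemma add_axis_line: "(x :: real ^ 's::finite) + (s + t) *\<^sub>R axis j 1 = (x + s *\<^sub>R axis j 1) + t *\<^sub>R axis j 1"
  by (simp add: algebra_simps)

lemma partial_has_derivative:
  assumes "partial_exists j F"
  shows "((\<lambda>t. F (x + t *\<^sub>R axis j 1)) has_real_derivative partial j F (x + t *\<^sub>R axis j 1)) (at t)"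
proof -
  let ?y = "x + t *\<^sub>R axis j 1"
  have "((\<lambda>h. F (?y + h *\<^sub>R axis j 1)) has_real_derivative partial j F ?y) (at 0)"
    using assms unfolding partial_exists_def partial_def
    by (metis DERIV_deriv_iff_real_differentiable)
  then have "((\<lambda>h. F (x + (t + h) *\<^sub>R axis j 1)) has_real_derivative partial j F ?y) (at 0)"
    by (simp add: add_axis_line)
  then show ?thesis
    using DERIV_shift[of "\<lambda>t. F (x + t *\<^sub>R axis j 1)" _ 0 t] by (simp add: add.commute)
qed

text \<open>The mean value theorem, applied first in direction \<open>i\<close> and then in direction \<open>j\<close>.\<close>

lemma mixed_difference_mean_value:
  fixes H :: "real ^ 's::finite \<Rightarrow> real"
  assumes "partial_exists i H" "partial_exists j (partial i H)" "0 < h"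
  shows "\<exists>\<sigma> \<tau>. 0 < \<sigma> \<and> \<sigma> < h \<and> 0 < \<tau> \<and> \<tau> < h \<and>
    H (x + h *\<^sub>R axis i 1 + h *\<^sub>R axis j 1) - H (x + h *\<^sub>R axis i 1) - H (x + h *\<^sub>R axis j 1) + H x
      = h * h * partial j (partial i H) (x + \<sigma> *\<^sub>R axis i 1 + \<tau> *\<^sub>R axis j 1)"
proof -
  let ?d = "\<lambda>s. H ((x + h *\<^sub>R axis j 1) + s *\<^sub>R axis i 1) - H (x + s *\<^sub>R axis i 1)"
  have "\<exists>\<sigma>>0. \<sigma> < h \<and> ?d h - ?d 0 = (h - 0) *
      (partial i H ((x + h *\<^sub>R axis j 1) + \<sigma> *\<^sub>R axis i 1) - partial i H (x + \<sigma> *\<^sub>R axis i 1))"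
    using assms(3) by (intro MVT2 DERIV_diff partial_has_derivative assms)
  then obtain \<sigma> where \<sigma>: "0 < \<sigma>" "\<sigma> < h" "?d h - ?d 0 = h *
      (partial i H ((x + \<sigma> *\<^sub>R axis i 1) + h *\<^sub>R axis j 1) - partial i H ((x + \<sigma> *\<^sub>R axis i 1) + 0 *\<^sub>R axis j 1))"
    by (auto simp: algebra_simps)
  have "\<exists>\<tau>>0. \<tau> < h \<and> partial i H ((x + \<sigma> *\<^sub>R axis i 1) + h *\<^sub>R axis j 1) - partial i H ((x + \<sigma> *\<^sub>R axis i 1) + 0 *\<^sub>R axis j 1)
     = (h - 0) * partial j (partial i H) ((x + \<sigma> *\<^sub>R axis i 1) + \<tau> *\<^sub>R axis j 1)"
    using assms(3) by (intro MVT2 partial_has_derivative assms)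
  then obtain \<tau> where \<tau>: "0 < \<tau>" "\<tau> < h" "partial i H ((x + \<sigma> *\<^sub>R axis i 1) + h *\<^sub>R axis j 1) - partial i H ((x + \<sigma> *\<^sub>R axis i 1) + 0 *\<^sub>R axis j 1)
     = h * partial j (partial i H) ((x + \<sigma> *\<^sub>R axis i 1) + \<tau> *\<^sub>R axis j 1)"
    by auto
  have "?d h - ?d 0 = h * h * partial j (partial i H) (x + \<sigma> *\<^sub>R axis i 1 + \<tau> *\<^sub>R axis j 1)"
    unfolding \<sigma>(3) \<tau>(3) by simp
  with \<sigma>(1,2) \<tau>(1,2) show ?thesis
    by (intro exI[of _ \<sigma>] exI[of _ \<tau>]) (simp add: algebra_simps)
qed

lemma continuous_along_axes:
  fixes H :: "real ^ 's::finite \<Rightarrow> real"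
  assumes "continuous_on UNIV H" and "e > 0"
  shows "\<exists>d>0. \<forall>\<sigma> \<tau>. \<bar>\<sigma>\<bar> < d \<longrightarrow> \<bar>\<tau>\<bar> < d \<longrightarrow> \<bar>H (x + \<sigma> *\<^sub>R axis i 1 + \<tau> *\<^sub>R axis j 1) - H x\<bar> < e"
proof -
  obtain d where d: "d > 0" "\<And>y. dist y x < d \<Longrightarrow> dist (H y) (H x) < e"
    using assms unfolding continuous_on_iff by (metis UNIV_I)
  have "dist (x + \<sigma> *\<^sub>R axis i 1 + \<tau> *\<^sub>R axis j 1) x < d" if "\<bar>\<sigma>\<bar> < d/2" "\<bar>\<tau>\<bar> < d/2" for \<sigma> \<tau>
  proof -
    have "dist (x + \<sigma> *\<^sub>R axis i 1 + \<tau> *\<^sub>R axis j 1) x = norm (\<sigma> *\<^sub>R axis i 1 + \<tau> *\<^sub>R axis j (1::real) :: real ^ 's)"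
      by (simp add: dist_norm)
    also have "\<dots> \<le> \<bar>\<sigma>\<bar> + \<bar>\<tau>\<bar>"
      using norm_triangle_ineq[of "\<sigma> *\<^sub>R axis i (1::real) :: real ^ 's" "\<tau> *\<^sub>R axis j 1"] by simp
    finally show ?thesis using that by simp
  qed
  with d show ?thesis
    by (intro exI[of _ "d/2"]) (auto simp: dist_real_def)
qed

text \<open>Schwarz's theorem: the second difference is symmetric in \<open>i\<close> and \<open>j\<close>, so both mixed derivatives are
limits of the same quotients.\<close>

lemma partial_commute:
  fixes H :: "real ^ 's::finite \<Rightarrow> real"
  assumes "partial_exists i H" "partial_exists j (partial i H)" "continuous_on UNIV (partial j (partial i H))"
    and "partial_exists j H" "partial_exists i (partial j H)" "continuous_on UNIV (partial i (partial j H))"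
  shows "partial j (partial i H) = partial i (partial j H)"
proof
  fix x
  let ?A = "partial j (partial i H)" and ?B = "partial i (partial j H)"
  show "?A x = ?B x"
  proof (rule ccontr)
    assume ne: "?A x \<noteq> ?B x"
    define e where "e = \<bar>?A x - ?B x\<bar> / 2"
    have "e > 0" using ne by (simp add: e_def)
    obtain d1 where d1: "d1 > 0" "\<And>\<sigma> \<tau>. \<bar>\<sigma>\<bar> < d1 \<Longrightarrow> \<bar>\<tau>\<bar> < d1 \<Longrightarrow> \<bar>?A (x + \<sigma> *\<^sub>R axis i 1 + \<tau> *\<^sub>R axis j 1) - ?A x\<bar> < e"
      using continuous_along_axes[OF assms(3) \<open>e > 0\<close>, of x i j] by blast
    obtain d2 where d2: "d2 > 0" "\<And>\<sigma> \<tau>. \<bar>\<sigma>\<bar> < d2 \<Longrightarrow> \<bar>\<tau>\<bar> < d2 \<Longrightarrow> \<bar>?B (x + \<sigma> *\<^sub>R axis j 1 + \<tau> *\<^sub>R axis i 1) - ?B x\<bar> < e"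
      using continuous_along_axes[OF assms(6) \<open>e > 0\<close>, of x j i] by blast
    define h where "h = min d1 d2 / 2"
    have h: "0 < h" "h < d1" "h < d2" using d1(1) d2(1) by (auto simp: h_def)
    obtain \<sigma> \<tau> where 1: "0 < \<sigma>" "\<sigma> < h" "0 < \<tau>" "\<tau> < h"
      "H (x + h *\<^sub>R axis i 1 + h *\<^sub>R axis j 1) - H (x + h *\<^sub>R axis i 1) - H (x + h *\<^sub>R axis j 1) + H x
      = h * h * ?A (x + \<sigma> *\<^sub>R axis i 1 + \<tau> *\<^sub>R axis j 1)"
      using mixed_difference_mean_value[OF assms(1,2) h(1)] by blast
    obtain \<sigma>' \<tau>' where 2: "0 < \<sigma>'" "\<sigma>' < h" "0 < \<tau>'" "\<tau>' < h"
      "H (x + h *\<^sub>R axis j 1 + h *\<^sub>R axis i 1) - H (x + h *\<^sub>R axis j 1) - H (x + h *\<^sub>R axis i 1) + H x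
      = h * h * ?B (x + \<sigma>' *\<^sub>R axis j 1 + \<tau>' *\<^sub>R axis i 1)"
      using mixed_difference_mean_value[OF assms(4,5) h(1)] by blast
    have sw: "x + h *\<^sub>R axis j 1 + h *\<^sub>R axis i 1 = x + h *\<^sub>R axis i 1 + h *\<^sub>R axis j 1" by (simp add: algebra_simps)
    have "h * h * ?A (x + \<sigma> *\<^sub>R axis i 1 + \<tau> *\<^sub>R axis j 1) = h * h * ?B (x + \<sigma>' *\<^sub>R axis j 1 + \<tau>' *\<^sub>R axis i 1)"
      using 1(5) 2(5) unfolding sw by linarith
    then have "?A (x + \<sigma> *\<^sub>R axis i 1 + \<tau> *\<^sub>R axis j 1) = ?B (x + \<sigma>' *\<^sub>R axis j 1 + \<tau>' *\<^sub>R axis i 1)"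
      using h(1) by simp
    moreover have "\<bar>?A (x + \<sigma> *\<^sub>R axis i 1 + \<tau> *\<^sub>R axis j 1) - ?A x\<bar> < e"
      using 1 h by (intro d1(2)) auto
    moreover have "\<bar>?B (x + \<sigma>' *\<^sub>R axis j 1 + \<tau>' *\<^sub>R axis i 1) - ?B x\<bar> < e"
      using 2 h by (intro d2(2)) auto
    ultimately have "\<bar>?A x - ?B x\<bar> < 2 * e" by linarith
    then show False by (simp add: e_def)
  qed
qed

lemma sufficiently_smoothD:
  assumes "sufficiently_smooth F" "smooth_order js"
  shows "partials_exist js F" "continuous_on UNIV (partials js F)"
proof -
  let ?w = "{j. count (mset js) j = 2}"
  have "mset js = mset_set (set js) + mset_set ?w"
  proof (rule multiset_eqI)
    fix j
    have "count (mset js) j \<le> 2" using assms(2) by (simp add: smooth_order_def)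
    moreover have "count (mset js) j = 0 \<longleftrightarrow> j \<notin> set js" by (simp add: count_mset_0_iff)
    ultimately consider "count (mset js) j = 0" "j \<notin> set js" | "count (mset js) j = 1" "j \<in> set js"
      | "count (mset js) j = 2" "j \<in> set js" by linarith
    then show "count (mset js) j = count (mset_set (set js) + mset_set ?w) j"
      by cases (auto simp: count_mset_set' count_mset_0_iff[THEN iffD2])
  qed
  moreover have "?w \<subseteq> set js"
  proof
    fix j assume "j \<in> ?w"
    then show "j \<in> set js" using count_mset_0_iff[of js j] by (cases "j \<in> set js") auto
  qed
  ultimately have "?w \<subseteq> set js" "js \<in> diff_orders (set js) ?w"
    unfolding diff_orders_def mem_Collect_eq by - assumption+
  then have *: "partials_exist js F \<and> continuous_on UNIV (partials js F)"
    by (rule assms(1)[unfolded sufficiently_smooth_def, THEN spec, THEN spec, THEN mp, THEN bspec])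
  show "partials_exist js F" by (rule conjunct1[OF *])
  show "continuous_on UNIV (partials js F)" by (rule conjunct2[OF *])
qed

lemma smooth_order_Cons: "smooth_order (j # js) \<Longrightarrow> smooth_order js"
  unfolding smooth_order_def
proof
  fix i
  assume *: "\<forall>i. count (mset (j # js)) i \<le> 2"
  have "count (mset js) i \<le> count (mset (j # js)) i" by simp
  also have "\<dots> \<le> 2" using * by blast
  finally show "count (mset js) i \<le> 2" .
qed

lemma smooth_order_cong: "mset js = mset is \<Longrightarrow> smooth_order js = smooth_order is"
  by (simp add: smooth_order_def)

text \<open>If two orders begin differently, each of them can be rearranged, by induction, so that it starts with
the two leading coordinates, and these can be exchanged.\<close>

lemma partials_perm:
  assumes F: "sufficiently_smooth F"
  shows "mset js = mset is \<Longrightarrow> smooth_order js \<Longrightarrow> partials js F = partials is F"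
proof (induction "length js" arbitrary: js "is" rule: less_induct)
  case less
  show ?case
  proof (cases js)
    case Nil then show ?thesis using less by simp
  next
    case js: (Cons i js')
    then obtain j is' where "is": "is = j # is'" using less.prems by (cases "is") auto
    have so: "smooth_order js'" "smooth_order is'"
      using less.prems js "is" smooth_order_Cons smooth_order_cong by metis+
    show ?thesis
    proof (cases "i = j")
      case True
      then have "mset js' = mset is'" using less.prems js "is" by simp
      then have "partials js' F = partials is' F" using less.hyps so js by simp
      then show ?thesis using js "is" True by simp
    next
      case False
      have "j \<in># mset js'" "i \<in># mset is'"
        using less.prems(1) js "is" False by (metis insert_noteq_member mset.simps(2))+
      define zs where "zs = remove1 j js'"
      have m1: "mset js' = mset (j # zs)" using \<open>j \<in># mset js'\<close> by (simp add: zs_def)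
      have m2: "mset is' = mset (i # zs)"
        using less.prems(1) js "is" m1 by (simp add: add_mset_commute)
      have l: "length js' < length js" "length is' < length js"
        using mset_eq_length[OF less.prems(1)] unfolding js "is" by simp_all
      have e1: "partials js' F = partials (j # zs) F" by (rule less.hyps[OF l(1) m1 so(1)])
      have e2: "partials is' F = partials (i # zs) F" by (rule less.hyps[OF l(2) m2 so(2)])
      have s1: "smooth_order (i # j # zs)" "smooth_order (j # i # zs)"
        using smooth_order_cong[THEN iffD1, OF _ less.prems(2)] js m1 by (auto simp: add_mset_commute)
      note p = sufficiently_smoothD[OF F s1(1)] sufficiently_smoothD[OF F s1(2)]
      have "partial i (partial j (partials zs F)) = partial j (partial i (partials zs F))"
        using p by (intro partial_commute) auto
      then show ?thesis using e1 e2 js "is" by simp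
    qed
  qed
qed

text \<open>Unfolds the choice of an order in \<open>mixed_partial\<close>.\<close>

lemma mixed_partial_order:
  fixes w u :: "'s::finite set"
  assumes "w \<subseteq> u"
  obtains js where "mset js = mset_set u + mset_set w" "smooth_order js"
    and "\<And>F. mixed_partial F u w = partials js F"
proof -
  define js where "js = (SOME js. js \<in> diff_orders u w)"
  obtain xs where "mset xs = mset_set u + mset_set w" using ex_mset[of "mset_set u + mset_set w"] ..
  then have "xs \<in> diff_orders u w" by (simp add: diff_orders_def)
  then have "js \<in> diff_orders u w"
    unfolding js_def by (rule someI[where P = "\<lambda>js. js \<in> diff_orders u w"])
  then have m: "mset js = mset_set u + mset_set w" by (simp add: diff_orders_def)
  moreover have "smooth_order js"
    unfolding smooth_order_def m by (simp add: count_mset_set')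
  ultimately show ?thesis by (rule that) (simp add: mixed_partial_def js_def)
qed

lemma mixed_partial_continuous:
  assumes "sufficiently_smooth F" "w \<subseteq> u"
  shows "continuous_on UNIV (mixed_partial F u w)"
  using mixed_partial_order[OF assms(2)] sufficiently_smoothD[OF assms(1)] by metis

text \<open>The derivatives that occur for different \<open>w\<close> in the norm are derivatives of each other, although each
of them was taken in an order of its own.\<close>

lemma mixed_partial_step:
  assumes F: "sufficiently_smooth F" and "w \<subseteq> u" "j \<in> u" "j \<notin> w"
  shows "((\<lambda>t. mixed_partial F u w (x + t *\<^sub>R axis j 1))
    has_real_derivative mixed_partial F u (insert j w) (x + t *\<^sub>R axis j 1)) (at t)"
proof -
  obtain js where js: "mset js = mset_set u + mset_set w" "smooth_order js" "mixed_partial F u w = partials js F"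
    using mixed_partial_order[OF assms(2)] by metis
  have "insert j w \<subseteq> u" using assms by auto
  then obtain ks where ks: "mset ks = mset_set u + mset_set (insert j w)" "smooth_order ks"
    "mixed_partial F u (insert j w) = partials ks F"
    using mixed_partial_order by metis
  have m: "mset ks = mset (j # js)" using js ks assms by simp
  then have so: "smooth_order (j # js)" using ks(2) smooth_order_cong by metis
  have "partials ks F = partial j (partials js F)"
    using partials_perm[OF F m ks(2)] by simp
  moreover have "partial_exists j (partials js F)"
    using sufficiently_smoothD(1)[OF F so] by simp
  ultimately show ?thesis using js ks partial_has_derivative by metis
qed

section \<open>Integration by parts in one variable\<close>

text \<open>For increasing \<open>g\<close> the second mean value theorem expresses \<open>\<integral> g G'\<close> by values of \<open>g\<close> and \<open>G\<close>. On a short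
interval the formula therefore holds up to the oscillation of \<open>G\<close> times the increase of \<open>g\<close>, and these
errors add up to an arbitrarily small amount. The derivative \<open>G'\<close> is integrated in the sense of
Henstock and Kurzweil only.\<close>

lemma mono_antiderivative_parts:
  fixes g g1 G G' :: "real \<Rightarrow> real"
  assumes ab: "a \<le> b"
    and G: "\<And>x. x \<in> {a..b} \<Longrightarrow> (G has_real_derivative G' x) (at x within {a..b})"
    and g1: "g1 integrable_on {a..b}" and nn: "\<And>x. 0 \<le> g1 x"
    and g: "\<And>x y. a \<le> x \<Longrightarrow> x \<le> y \<Longrightarrow> y \<le> b \<Longrightarrow> g y - g x = integral {x..y} g1"
  shows "((\<lambda>x. g x * G' x) has_integral
           (g b * G b - g a * G a - integral {a..b} (\<lambda>x. g1 x * G x))) {a..b}"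
proof -
  have int1: "g1 integrable_on {x..y}" if "a \<le> x" "y \<le> b" for x y
    using integrable_on_subinterval[OF g1] that by auto
  have mono: "g x \<le> g y" if "a \<le> x" "x \<le> y" "y \<le> b" for x y
    using g[OF that] integral_nonneg[OF int1[OF that(1,3)]] nn by force
  have contG: "continuous_on {a..b} G"
    using G DERIV_continuous_on by blast
  have intG': "(G' has_integral (G y - G x)) {x..y}" if "a \<le> x" "x \<le> y" "y \<le> b" for x y
  proof (rule fundamental_theorem_of_calculus[OF that(2)])
    fix z assume "z \<in> {x..y}"
    then have "(G has_real_derivative G' z) (at z within {x..y})"
      using G[of z] that by (auto intro: DERIV_subset)
    then show "(G has_vector_derivative G' z) (at z within {x..y})"
      by (simp add: has_real_derivative_iff_has_vector_derivative)
  qed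
  have absg1: "g1 absolutely_integrable_on {a..b}"
    using g1 nn by (intro nonnegative_absolutely_integrable_1) auto
  have "(\<lambda>x. G x * g1 x) absolutely_integrable_on {a..b}"
    using contG compact_continuous_image[OF contG] absg1
    by (intro absolutely_integrable_bounded_measurable_product_real)
       (auto intro!: continuous_imp_measurable_on_sets_lebesgue compact_imp_bounded)
  then have intgG: "(\<lambda>x. g1 x * G x) integrable_on {a..b}"
    by (simp add: absolutely_integrable_on_def mult.commute)
  have intgG': "(\<lambda>x. g1 x * G x) integrable_on {x..y}" if "a \<le> x" "y \<le> b" for x y
    using integrable_on_subinterval[OF intgG] that by auto
  have smvt: "\<exists>c\<in>{x..y}. ((\<lambda>t. g t * G' t) has_integral (g x * (G c - G x) + g y * (G y - G c))) {x..y}"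
    if xy: "a \<le> x" "x \<le> y" "y \<le> b" for x y
  proof -
    have "G' integrable_on {x..y}" using intG'[OF xy] by blast
    then obtain c where c: "c \<in> {x..y}"
      "((\<lambda>t. g t * G' t) has_integral (g x * integral {x..c} G' + g y * integral {c..y} G')) {x..y}"
      by (rule second_mean_value_theorem_full[of G' x y g]) (use xy mono in auto)
    then have "integral {x..c} G' = G c - G x" "integral {c..y} G' = G y - G c"
      using intG'[of x c] intG'[of c y] xy by (auto intro!: integral_unique)
    with c show ?thesis by auto
  qed
  have int2: "(\<lambda>t. g t * G' t) integrable_on {x..y}" if "a \<le> x" "x \<le> y" "y \<le> b" for x y
    using smvt[OF that] by blast
  \<comment> \<open>the defect of the formula on \<open>[a, x]\<close>\<close>
  define \<Xi> where "\<Xi> x = integral {a..x} (\<lambda>t. g t * G' t) - g x * G x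
      + integral {a..x} (\<lambda>t. g1 t * G t)" for x
  have step: "\<bar>\<Xi> y - \<Xi> x\<bar> \<le> e * (g y - g x)"
    if xy: "a \<le> x" "x \<le> y" "y \<le> b" and osc: "\<And>s t. s \<in> {x..y} \<Longrightarrow> t \<in> {x..y} \<Longrightarrow> \<bar>G s - G t\<bar> \<le> e"
    for x y e
  proof -
    obtain c where c: "c \<in> {x..y}"
      and I: "integral {x..y} (\<lambda>t. g t * G' t) = g x * (G c - G x) + g y * (G y - G c)"
      using smvt[OF xy] by (auto dest: integral_unique)
    have "integral {a..y} (\<lambda>t. g t * G' t) = integral {a..x} (\<lambda>t. g t * G' t) + integral {x..y} (\<lambda>t. g t * G' t)"
      using xy by (intro Henstock_Kurzweil_Integration.integral_combine[symmetric] int2) auto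
    moreover have "integral {a..y} (\<lambda>t. g1 t * G t) = integral {a..x} (\<lambda>t. g1 t * G t) + integral {x..y} (\<lambda>t. g1 t * G t)"
      using xy by (intro Henstock_Kurzweil_Integration.integral_combine[symmetric] intgG') auto
    ultimately have "\<Xi> y - \<Xi> x = integral {x..y} (\<lambda>t. g1 t * G t) - (g y - g x) * G c"
      unfolding \<Xi>_def I by (simp add: algebra_simps)
    also have "\<dots> = integral {x..y} (\<lambda>t. g1 t * G t - g1 t * G c)"
      unfolding g[OF xy] using xy
      by (subst Henstock_Kurzweil_Integration.integral_diff) (auto intro!: intgG' integrable_on_mult_left int1)
    finally have eq: "\<Xi> y - \<Xi> x = integral {x..y} (\<lambda>t. g1 t * G t - g1 t * G c)" .
    have "norm (integral {x..y} (\<lambda>t. g1 t * G t - g1 t * G c)) \<le> integral {x..y} (\<lambda>t. e * g1 t)"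
    proof (rule integral_norm_bound_integral)
      show "(\<lambda>t. g1 t * G t - g1 t * G c) integrable_on {x..y}"
        using xy by (auto intro!: integrable_diff intgG' integrable_on_mult_left int1)
      show "(\<lambda>t. e * g1 t) integrable_on {x..y}"
        using xy by (auto intro!: integrable_on_mult_right int1)
      fix t assume "t \<in> {x..y}"
      then have "g1 t * \<bar>G t - G c\<bar> \<le> g1 t * e"
        using osc[of t c] c nn by (intro mult_left_mono) auto
      then show "norm (g1 t * G t - g1 t * G c) \<le> e * g1 t"
        using nn[of t] by (simp add: abs_mult flip: right_diff_distrib) (simp add: mult.commute)
    qed
    also have "\<dots> = e * (g y - g x)" unfolding g[OF xy] by simp
    finally show ?thesis unfolding eq by simp
  qed
  have small: "\<bar>\<Xi> b - \<Xi> a\<bar> \<le> e * (g b - g a)" if "e > 0" for e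
  proof -
    have "uniformly_continuous_on {a..b} G"
      using contG compact_uniformly_continuous by blast
    then obtain d where d: "d > 0" "\<And>s t. s \<in> {a..b} \<Longrightarrow> t \<in> {a..b} \<Longrightarrow> dist s t < d \<Longrightarrow> dist (G s) (G t) < e"
      unfolding uniformly_continuous_on_def using \<open>e > 0\<close> by metis
    obtain n :: nat where n: "(b - a) / d < real n" using reals_Archimedean2 by blast
    then have n0: "n > 0" using ab d(1) by (cases n) (auto simp: field_simps)
    define h where "h = (b - a) / real n"
    have h: "0 \<le> h" "h < d" using ab n n0 d(1) by (auto simp: h_def field_simps)
    have hn: "real n * h = b - a" using n0 by (simp add: h_def)
    have "\<bar>\<Xi> (a + real i * h) - \<Xi> a\<bar> \<le> e * (g (a + real i * h) - g a)" if "i \<le> n" for i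
      using that
    proof (induction i)
      case 0 then show ?case by simp
    next
      case (Suc i)
      have "real (Suc i) * h \<le> real n * h" using Suc.prems h by (intro mult_right_mono) auto
      then have le: "a + real (Suc i) * h \<le> b" using hn by simp
      have "\<bar>\<Xi> (a + real (Suc i) * h) - \<Xi> (a + real i * h)\<bar>
          \<le> e * (g (a + real (Suc i) * h) - g (a + real i * h))"
      proof (rule step)
        fix s t assume st: "s \<in> {a + real i * h..a + real (Suc i) * h}" "t \<in> {a + real i * h..a + real (Suc i) * h}"
        then have "dist s t < d" using h by (auto simp: dist_real_def algebra_simps)
        moreover have "0 \<le> real i * h" using h by simp
        ultimately show "\<bar>G s - G t\<bar> \<le> e"
          using d(2)[of s t] st le by (auto simp: dist_real_def)
      qed (use h le in \<open>auto simp: algebra_simps\<close>)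
      with Suc show ?case by (auto simp: algebra_simps)
    qed
    from this[of n] show ?thesis using hn by simp
  qed
  have "\<Xi> b = \<Xi> a"
  proof (rule ccontr)
    assume ne: "\<Xi> b \<noteq> \<Xi> a"
    define e where "e = \<bar>\<Xi> b - \<Xi> a\<bar> / (2 * (g b - g a + 1))"
    have "g b - g a \<ge> 0" using mono[of a b] ab by simp
    then have "e > 0" using ne by (simp add: e_def)
    then have "\<bar>\<Xi> b - \<Xi> a\<bar> \<le> e * (g b - g a)" by (rule small)
    also have "\<dots> \<le> e * (g b - g a + 1)" using \<open>e > 0\<close> by simp
    also have "\<dots> = \<bar>\<Xi> b - \<Xi> a\<bar> / 2"
      using \<open>g b - g a \<ge> 0\<close> unfolding e_def by (simp add: divide_simps)
    finally show False using ne by simp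
  qed
  then have "integral {a..b} (\<lambda>t. g t * G' t) = g b * G b - g a * G a - integral {a..b} (\<lambda>x. g1 x * G x)"
    by (simp add: \<Xi>_def)
  with int2[of a b] ab show ?thesis
    by (metis integrable_integral order_refl)
qed

text \<open>An absolutely continuous function is the difference of two increasing ones.\<close>

lemma antiderivative_parts:
  fixes g g1 G G' :: "real \<Rightarrow> real"
  assumes ab: "a \<le> b"
    and G: "\<And>x. x \<in> {a..b} \<Longrightarrow> (G has_real_derivative G' x) (at x within {a..b})"
    and g1: "g1 absolutely_integrable_on {a..b}"
    and g: "\<And>x y. a \<le> x \<Longrightarrow> x \<le> y \<Longrightarrow> y \<le> b \<Longrightarrow> g y - g x = integral {x..y} g1"
  shows "((\<lambda>x. g x * G' x) has_integral
           (g b * G b - g a * G a - integral {a..b} (\<lambda>x. g1 x * G x))) {a..b}"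
proof -
  define p where "p x = max 0 (g1 x)" for x
  define m where "m x = max 0 (- g1 x)" for x
  have abs: "p absolutely_integrable_on {a..b}" "m absolutely_integrable_on {a..b}"
    unfolding p_def[abs_def] m_def[abs_def] using g1
    by (auto intro!: absolutely_integrable_max_1 absolutely_integrable_on_const
        set_integrable_mult_right[of "-1" lebesgue _ g1, simplified])
  then have int: "p integrable_on {a..b}" "m integrable_on {a..b}"
    by (auto simp: absolutely_integrable_on_def)
  have sub: "p integrable_on {x..y}" "m integrable_on {x..y}" if "a \<le> x" "y \<le> b" for x y
    using int[THEN integrable_on_subinterval, of x y] that by auto
  define P where "P x = integral {a..x} p" for x
  define M where "M x = integral {a..x} m" for x
  have PM: "P y - P x = integral {x..y} p" "M y - M x = integral {x..y} m"
    if "a \<le> x" "x \<le> y" "y \<le> b" for x y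
    unfolding P_def M_def
    using Henstock_Kurzweil_Integration.integral_combine[of a x y p] 
      Henstock_Kurzweil_Integration.integral_combine[of a x y m] that sub[of a y] by auto
  have g1eq: "g1 x = p x - m x" for x by (auto simp: p_def m_def)
  have geq: "g x = g a + P x - M x" if "x \<in> {a..b}" for x
  proof -
    have "g x - g a = integral {a..x} (\<lambda>x. p x - m x)"
      using g[of a x] that unfolding g1eq[abs_def] by auto
    also have "\<dots> = P x - M x"
      unfolding P_def M_def using that by (intro Henstock_Kurzweil_Integration.integral_diff sub) auto
    finally show ?thesis by simp
  qed
  have contG: "continuous_on {a..b} G"
    using G DERIV_continuous_on by blast
  have iG: "(\<lambda>x. f x * G x) integrable_on {a..b}" if "f absolutely_integrable_on {a..b}" for f
  proof -
    have "(\<lambda>x. G x * f x) absolutely_integrable_on {a..b}"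
      using contG compact_continuous_image[OF contG] that
      by (intro absolutely_integrable_bounded_measurable_product_real)
         (auto intro!: continuous_imp_measurable_on_sets_lebesgue compact_imp_bounded)
    then show ?thesis by (simp add: absolutely_integrable_on_def mult.commute)
  qed
  have A: "((\<lambda>x. P x * G' x) has_integral (P b * G b - P a * G a - integral {a..b} (\<lambda>x. p x * G x))) {a..b}"
    by (rule mono_antiderivative_parts[OF ab G int(1)]) (auto simp: p_def PM)
  have B: "((\<lambda>x. M x * G' x) has_integral (M b * G b - M a * G a - integral {a..b} (\<lambda>x. m x * G x))) {a..b}"
    by (rule mono_antiderivative_parts[OF ab G int(2)]) (auto simp: m_def PM)
  have D: "(G' has_integral (G b - G a)) {a..b}"
    using G by (intro fundamental_theorem_of_calculus ab) (simp add: has_real_derivative_iff_has_vector_derivative)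
  have "integral {a..b} (\<lambda>x. g1 x * G x) = integral {a..b} (\<lambda>x. p x * G x) - integral {a..b} (\<lambda>x. m x * G x)"
    unfolding g1eq left_diff_distrib by (intro Henstock_Kurzweil_Integration.integral_diff iG abs)
  moreover have "P a = 0" "M a = 0" by (auto simp: P_def M_def)
  moreover have gb: "g b = g a + P b - M b" using ab by (intro geq) auto
  ultimately have eq: "g b * G b - g a * G a - integral {a..b} (\<lambda>x. g1 x * G x)
     = g a * (G b - G a) + (P b * G b - P a * G a - integral {a..b} (\<lambda>x. p x * G x))
       - (M b * G b - M a * G a - integral {a..b} (\<lambda>x. m x * G x))"
    unfolding gb by (simp add: algebra_simps)
  have "((\<lambda>x. g a * G' x + P x * G' x - M x * G' x) has_integral
     (g b * G b - g a * G a - integral {a..b} (\<lambda>x. g1 x * G x))) {a..b}"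
    unfolding eq by (intro has_integral_diff has_integral_add has_integral_mult_right A B D)
  then show ?thesis
  proof (rule has_integral_eq[rotated])
    fix x assume "x \<in> {a..b}"
    from geq[OF this] show "g a * G' x + P x * G' x - M x * G' x = g x * G' x"
      by (simp only: left_diff_distrib distrib_right)
  qed
qed

text \<open>The one-dimensional estimate. Here \<open>\<kappa> = G' + R\<close>, where \<open>G'\<close> need not be integrable; it is the
finiteness of the right-hand side that makes \<open>g R\<close>, and with it \<open>g G'\<close>, absolutely integrable. If the
right-hand side is infinite there is nothing to show.\<close>

lemma weighted_derivative_bound:
  fixes g g1 G R \<kappa> \<psi> \<omega> :: "real \<Rightarrow> real"
  assumes G: "\<And>x. (G has_real_derivative (\<kappa> x - R x)) (at x)"
    and supp: "\<And>x. r \<le> \<bar>x\<bar> \<Longrightarrow> G x = 0" "\<And>x. r \<le> \<bar>x\<bar> \<Longrightarrow> \<kappa> x = 0" "\<And>x. r \<le> \<bar>x\<bar> \<Longrightarrow> R x = 0"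
    and \<kappa>: "continuous_on UNIV \<kappa>" and R[measurable]: "R \<in> borel_measurable borel"
    and w[measurable]: "\<psi> \<in> borel_measurable borel" "\<omega> \<in> borel_measurable borel"
    and pos: "\<And>x. 0 \<le> \<psi> x" "\<And>x. 0 \<le> \<omega> x" "0 < c"
    and bds: "\<And>x. \<bar>G x\<bar> \<le> c * \<psi> x" "\<And>x. \<bar>R x\<bar> \<le> c * \<omega> x"
    and g1: "\<And>r. set_integrable lborel {-r..r} g1" and m[measurable]: "g1 \<in> borel_measurable borel"
    and g: "\<And>x y. x \<le> y \<Longrightarrow> g y - g x = integral {x..y} g1"
  shows "ennreal \<bar>LBINT x. g x * \<kappa> x\<bar> \<le> ennreal c * (\<integral>\<^sup>+x. ennreal (\<bar>g x\<bar> * \<omega> x + \<bar>g1 x\<bar> * \<psi> x) \<partial>lborel)"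
proof (cases "(\<integral>\<^sup>+x. ennreal (\<bar>g x\<bar> * \<omega> x + \<bar>g1 x\<bar> * \<psi> x) \<partial>lborel) = \<infinity>")
  case True
  then show ?thesis using pos(3) by (simp add: ennreal_mult_top)
next
  case False
  define s where "s = max r 0"
  have s: "0 \<le> s" "r \<le> s" by (auto simp: s_def)
  have g1L: "g1 absolutely_integrable_on {-s..s}" 
    using g1[of s] unfolding set_integrable_def by (rule integrable_completion[THEN iffD2, rotated]) simp
  have g1L': "g1 integrable_on {x..y}" for x y
    using set_borel_integral_eq_integral(1)[OF g1[of "max \<bar>x\<bar> \<bar>y\<bar>"]]
    by (rule integrable_on_subinterval) auto
  have contg: "continuous_on UNIV g"
  proof -
    have "isCont g x" for x
    proof -
      have "continuous_on {x-1..x+1} (\<lambda>y. g (x - 1) + integral {x-1..y} g1)"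
        by (intro continuous_intros indefinite_integral_continuous_1 g1L')
      moreover have "g (x - 1) + integral {x-1..y} g1 = g y" if "y \<in> {x-1..x+1}" for y
        using g[of "x - 1" y] that by auto
      ultimately have "continuous_on {x-1..x+1} g"
        using continuous_on_cong[OF refl, of "{x-1..x+1}" g "\<lambda>y. g (x - 1) + integral {x-1..y} g1"] by metis
      then show ?thesis by (rule continuous_on_interior) auto
    qed
    then show ?thesis by (simp add: continuous_at_imp_continuous_on)
  qed
  then have [measurable]: "g \<in> borel_measurable borel" by (rule borel_measurable_continuous_onI)
  have contG: "continuous_on UNIV G" using G DERIV_isCont continuous_at_imp_continuous_on by blast
  have [measurable]: "G \<in> borel_measurable borel" "\<kappa> \<in> borel_measurable borel"
    using contG \<kappa> borel_measurable_continuous_onI by auto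
  have H: "integrable lborel (\<lambda>x. \<bar>g x\<bar> * \<omega> x + \<bar>g1 x\<bar> * \<psi> x)"
    using False pos by (intro integrableI_nonneg) (auto simp: top.not_eq_extremum)
  have igR: "integrable lborel (\<lambda>x. g x * R x)"
  proof (rule Bochner_Integration.integrable_bound[OF integrable_mult_right[OF H, of c]])
    show "AE x in lborel. norm (g x * R x) \<le> norm (c * (\<bar>g x\<bar> * \<omega> x + \<bar>g1 x\<bar> * \<psi> x))"
    proof (rule AE_I2)
      fix x
      have "\<bar>g x\<bar> * \<bar>R x\<bar> \<le> \<bar>g x\<bar> * (c * \<omega> x) + \<bar>g1 x\<bar> * (c * \<psi> x)"
        by (intro add_increasing2 mult_left_mono mult_nonneg_nonneg bds less_imp_le[OF pos(3)] pos(1,2) abs_ge_zero)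
      also have "\<dots> = c * (\<bar>g x\<bar> * \<omega> x + \<bar>g1 x\<bar> * \<psi> x)" by (simp add: algebra_simps)
      finally have "\<bar>g x * R x\<bar> \<le> c * (\<bar>g x\<bar> * \<omega> x + \<bar>g1 x\<bar> * \<psi> x)"
        unfolding abs_mult[of "g x"] .
      then show "norm (g x * R x) \<le> norm (c * (\<bar>g x\<bar> * \<omega> x + \<bar>g1 x\<bar> * \<psi> x))"
        unfolding real_norm_def by (rule order_trans[OF _ abs_ge_self])
    qed
  qed simp
  have igG: "integrable lborel (\<lambda>x. g1 x * G x)"
  proof (rule Bochner_Integration.integrable_bound[OF integrable_mult_right[OF H, of c]])
    show "AE x in lborel. norm (g1 x * G x) \<le> norm (c * (\<bar>g x\<bar> * \<omega> x + \<bar>g1 x\<bar> * \<psi> x))"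
    proof (rule AE_I2)
      fix x
      have "\<bar>g1 x\<bar> * \<bar>G x\<bar> \<le> \<bar>g x\<bar> * (c * \<omega> x) + \<bar>g1 x\<bar> * (c * \<psi> x)"
        by (intro add_increasing mult_left_mono mult_nonneg_nonneg bds less_imp_le[OF pos(3)] pos(1,2) abs_ge_zero)
      also have "\<dots> = c * (\<bar>g x\<bar> * \<omega> x + \<bar>g1 x\<bar> * \<psi> x)" by (simp add: algebra_simps)
      finally have "\<bar>g1 x * G x\<bar> \<le> c * (\<bar>g x\<bar> * \<omega> x + \<bar>g1 x\<bar> * \<psi> x)"
        unfolding abs_mult[of "g1 x"] .
      then show "norm (g1 x * G x) \<le> norm (c * (\<bar>g x\<bar> * \<omega> x + \<bar>g1 x\<bar> * \<psi> x))"
        unfolding real_norm_def by (rule order_trans[OF _ abs_ge_self])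
    qed
  qed simp
  have \<kappa>0: "\<kappa> x = 0 \<and> R x = 0 \<and> G x = 0" if "x \<notin> {-s<..<s}" for x
    using that s supp[of x] by auto
  have \<kappa>0': "\<kappa> x = 0" "R x = 0" "G x = 0" if "x \<notin> {-s..s}" for x
    using that \<kappa>0[of x] by auto
  have z: "G s = 0" "G (-s) = 0" using supp s by auto
  have "((\<lambda>x. g x * (\<kappa> x - R x)) has_integral
           (g s * G s - g (-s) * G (-s) - integral {-s..s} (\<lambda>x. g1 x * G x))) {-s..s}"
    using s G by (intro antiderivative_parts g1L g) (auto intro: has_field_derivative_at_within)
  then have "((\<lambda>x. g x * (\<kappa> x - R x)) has_integral (- integral {-s..s} (\<lambda>x. g1 x * G x))) {-s..s}"
    by (simp only: z mult_zero_right diff_0_right diff_0)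
  then have "((\<lambda>x. g x * (\<kappa> x - R x)) has_integral (- integral {-s..s} (\<lambda>x. g1 x * G x))) UNIV"
  proof (rule has_integral_on_superset[OF _ _ subset_UNIV])
    fix x assume "x \<notin> {-s..s}"
    from \<kappa>0'(1,2)[OF this] show "g x * (\<kappa> x - R x) = 0" by simp
  qed
  moreover have "(\<lambda>x. if x \<in> {-s..s} then g1 x * G x else 0) = (\<lambda>x. g1 x * G x)"
    using \<kappa>0' by auto
  then have "integral {-s..s} (\<lambda>x. g1 x * G x) = integral UNIV (\<lambda>x. g1 x * G x)"
    using integral_restrict_UNIV[of "{-s..s}" "\<lambda>x. g1 x * G x"] by simp
  then have "integral {-s..s} (\<lambda>x. g1 x * G x) = (LBINT x. g1 x * G x)"
    using has_integral_integral_lborel[OF igG] by (simp add: integral_unique)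
  ultimately have "((\<lambda>x. g x * (\<kappa> x - R x)) has_integral (- (LBINT x. g1 x * G x))) UNIV" by simp
  from has_integral_add[OF this has_integral_integral_lborel[OF igR]]
  have 1: "((\<lambda>x. g x * \<kappa> x) has_integral ((LBINT x. g x * R x) - (LBINT x. g1 x * G x))) UNIV"
    by (simp add: algebra_simps)
  have ig\<kappa>: "integrable lborel (\<lambda>x. g x * \<kappa> x)"
  proof -
    have "set_integrable lborel {-s..s} (\<lambda>x. g x * \<kappa> x)"
      using contg \<kappa> by (intro borel_integrable_atLeastAtMost' continuous_intros) (auto intro: continuous_on_subset)
    moreover have "(\<lambda>x. indicator {-s..s} x *\<^sub>R (g x * \<kappa> x)) = (\<lambda>x. g x * \<kappa> x)"
      using \<kappa>0' by (auto simp: indicator_def fun_eq_iff)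
    ultimately show ?thesis unfolding set_integrable_def by metis
  qed
  have "(LBINT x. g x * \<kappa> x) = (LBINT x. g x * R x) - (LBINT x. g1 x * G x)"
    using has_integral_unique[OF has_integral_integral_lborel[OF ig\<kappa>] 1] .
  also have "\<dots> = (LBINT x. g x * R x - g1 x * G x)"
    using igR igG by simp
  finally have "\<bar>LBINT x. g x * \<kappa> x\<bar> \<le> (LBINT x. \<bar>g x * R x - g1 x * G x\<bar>)" by simp
  also have "\<dots> \<le> (LBINT x. c * (\<bar>g x\<bar> * \<omega> x + \<bar>g1 x\<bar> * \<psi> x))"
  proof (rule integral_mono)
    fix x
    have "\<bar>g x * R x - g1 x * G x\<bar> \<le> \<bar>g x\<bar> * \<bar>R x\<bar> + \<bar>g1 x\<bar> * \<bar>G x\<bar>"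
      unfolding abs_mult[symmetric] by linarith
    also have "\<dots> \<le> \<bar>g x\<bar> * (c * \<omega> x) + \<bar>g1 x\<bar> * (c * \<psi> x)"
      by (intro add_mono mult_left_mono bds abs_ge_zero)
    finally show "\<bar>g x * R x - g1 x * G x\<bar> \<le> c * (\<bar>g x\<bar> * \<omega> x + \<bar>g1 x\<bar> * \<psi> x)"
      by (simp add: algebra_simps)
  qed (use igR igG H in auto)
  also have "\<dots> = c * (LBINT x. \<bar>g x\<bar> * \<omega> x + \<bar>g1 x\<bar> * \<psi> x)" by simp
  finally have "ennreal \<bar>LBINT x. g x * \<kappa> x\<bar> \<le> ennreal (c * (LBINT x. \<bar>g x\<bar> * \<omega> x + \<bar>g1 x\<bar> * \<psi> x))"
    by (rule ennreal_leI)
  also have "\<dots> = ennreal c * (\<integral>\<^sup>+x. ennreal (\<bar>g x\<bar> * \<omega> x + \<bar>g1 x\<bar> * \<psi> x) \<partial>lborel)"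
    using H pos by (subst nn_integral_eq_integral) (auto simp: ennreal_mult integral_nonneg_AE)
  finally show ?thesis .
qed

lemma compact_support_bounded:
  fixes k :: "real \<Rightarrow> real"
  assumes "continuous_on UNIV k" "\<And>x. r \<le> \<bar>x\<bar> \<Longrightarrow> k x = 0"
  obtains B where "\<And>x. \<bar>k x\<bar> \<le> B"
proof -
  have "bounded (k ` {-\<bar>r\<bar>..\<bar>r\<bar>})"
    using assms(1) by (intro compact_imp_bounded compact_continuous_image) (auto intro: continuous_on_subset)
  then obtain B where "\<forall>y\<in>k ` {-\<bar>r\<bar>..\<bar>r\<bar>}. norm y \<le> B" unfolding bounded_iff by blast
  then have B: "\<bar>k x\<bar> \<le> B" if "x \<in> {-\<bar>r\<bar>..\<bar>r\<bar>}" for x using that by simp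
  have "\<bar>k x\<bar> \<le> max B 0" for x
  proof (cases "\<bar>x\<bar> \<le> \<bar>r\<bar>")
    case True then show ?thesis using B[of x] by (simp add: abs_le_iff)
  next
    case False then show ?thesis using assms(2)[of x] by simp
  qed
  then show ?thesis by (rule that)
qed

text \<open>The same estimate for \<open>g t = \<integral> P t z dz\<close>. Since \<open>P\<close> is differentiable in \<open>t\<close> for each \<open>z\<close>, Fubini's theorem shows
that \<open>g\<close> is an antiderivative of \<open>\<integral> P1 t z dz\<close>; integrability of \<open>P t\<close> for a single \<open>t\<close> gives it for all \<open>t\<close>.\<close>

lemma parametrized_weighted_derivative_bound:
  fixes P P1 :: "real \<Rightarrow> 'b \<Rightarrow> real" and G R \<kappa> \<psi> \<omega> :: "real \<Rightarrow> real"
  assumes M: "sigma_finite_measure M"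
    and P: "\<And>n::nat. integrable (lborel \<Otimes>\<^sub>M M) (\<lambda>(t,z). indicator {-real n..real n} t * P t z)"
    and P1: "\<And>n::nat. integrable (lborel \<Otimes>\<^sub>M M) (\<lambda>(t,z). indicator {-real n..real n} t * P1 t z)"
    and mP[measurable]: "case_prod P \<in> borel_measurable (lborel \<Otimes>\<^sub>M M)"
    and mP1[measurable]: "case_prod P1 \<in> borel_measurable (lborel \<Otimes>\<^sub>M M)"
    and D: "\<And>t z. z \<in> space M \<Longrightarrow> ((\<lambda>t. P t z) has_real_derivative P1 t z) (at t)"
    and D1: "\<And>z. z \<in> space M \<Longrightarrow> continuous_on UNIV (\<lambda>t. P1 t z)"
    and G: "\<And>x. (G has_real_derivative (\<kappa> x - R x)) (at x)"
    and supp: "\<And>x. r \<le> \<bar>x\<bar> \<Longrightarrow> G x = 0" "\<And>x. r \<le> \<bar>x\<bar> \<Longrightarrow> \<kappa> x = 0" "\<And>x. r \<le> \<bar>x\<bar> \<Longrightarrow> R x = 0"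
    and \<kappa>: "continuous_on UNIV \<kappa>" and R[measurable]: "R \<in> borel_measurable borel"
    and w[measurable]: "\<psi> \<in> borel_measurable borel" "\<omega> \<in> borel_measurable borel"
    and pos: "\<And>x. 0 \<le> \<psi> x" "\<And>x. 0 \<le> \<omega> x" "0 < c"
    and bds: "\<And>x. \<bar>G x\<bar> \<le> c * \<psi> x" "\<And>x. \<bar>R x\<bar> \<le> c * \<omega> x"
  shows "ennreal \<bar>\<integral>z. (LBINT t. P t z * \<kappa> t) \<partial>M\<bar>
    \<le> ennreal c * (\<integral>\<^sup>+t. ennreal (\<bar>\<integral>z. P t z \<partial>M\<bar> * \<omega> t + \<bar>\<integral>z. P1 t z \<partial>M\<bar> * \<psi> t) \<partial>lborel)"
proof -
  interpret M: sigma_finite_measure M by fact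
  interpret pair_sigma_finite lborel M by standard
  define g where "g t = (\<integral>z. P t z \<partial>M)" for t
  define g1 where "g1 t = (\<integral>z. P1 t z \<partial>M)" for t
  have [measurable]: "\<kappa> \<in> borel_measurable borel" using \<kappa> borel_measurable_continuous_onI by blast
  have mg1[measurable]: "g1 \<in> borel_measurable borel"
    unfolding g1_def[abs_def] using M.borel_measurable_lebesgue_integral[OF mP1] by simp
  have indg: "indicator {-real n..real n} t * (\<integral>z. f t z \<partial>M) = (\<integral>z. indicator {-real n..real n} t * f t z \<partial>M)"
    for n :: nat and t and f :: "real \<Rightarrow> 'b \<Rightarrow> real" by simp
  have g1n: "set_integrable lborel {-real n..real n} g1" for n :: nat
    using integrable_fst[OF P1[of n]] unfolding set_integrable_def g1_def real_scaleR_def indg .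
  have g1: "set_integrable lborel {x..y} g1" for x y
  proof -
    obtain n :: nat where "max \<bar>x\<bar> \<bar>y\<bar> \<le> real n" using real_arch_simple by blast
    then show ?thesis by (intro set_integrable_subset[OF g1n[of n]]) auto
  qed
  have P1xy: "integrable (lborel \<Otimes>\<^sub>M M) (\<lambda>(t,z). indicator {x..y} t * P1 t z)" for x y
  proof -
    obtain n :: nat where n: "max \<bar>x\<bar> \<bar>y\<bar> \<le> real n" using real_arch_simple by blast
    show ?thesis
    proof (rule Bochner_Integration.integrable_bound[OF P1[of n]])
      have "\<bar>indicator {x..y} t * P1 t z\<bar> \<le> \<bar>indicator {- real n..real n} t * P1 t z\<bar>" for t z
      proof (cases "t \<in> {x..y}")
        case True
        then have "t \<in> {- real n..real n}" using n by auto
        with True show ?thesis by simp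
      qed simp
      then show "AE p in lborel \<Otimes>\<^sub>M M. norm (case p of (t, z) \<Rightarrow> indicator {x..y} t * P1 t z)
          \<le> norm (case p of (t, z) \<Rightarrow> indicator {- real n..real n} t * P1 t z)"
        by (intro AE_I2) (auto split: prod.splits)
    qed measurable
  qed
  have incr: "(LBINT t. indicator {x..y} t * P1 t z) = P y z - P x z" if "x \<le> y" "z \<in> space M" for x y z
  proof -
    have "(LBINT t. P1 t z * indicator {x..y} t) = P y z - P x z"
      using that D1[OF that(2)] D[OF that(2)]
      by (intro integral_FTC_Icc_real) (auto simp: continuous_on_eq_continuous_at)
    then show ?thesis by (simp add: mult.commute)
  qed
  have incr_int: "integrable M (\<lambda>z. P y z - P x z)"
     and incr_eq: "(\<integral>z. P y z - P x z \<partial>M) = integral {x..y} g1" if "x \<le> y" for x y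
  proof -
    have "integrable M (\<lambda>z. LBINT t. indicator {x..y} t * P1 t z)"
      using integrable_snd[OF P1xy] by simp
    then show "integrable M (\<lambda>z. P y z - P x z)"
      by (rule Bochner_Integration.integrable_cong[THEN iffD1, rotated 2]) (auto simp: incr that)
    have "(\<integral>z. P y z - P x z \<partial>M) = (\<integral>z. (LBINT t. indicator {x..y} t * P1 t z) \<partial>M)"
      by (rule Bochner_Integration.integral_cong) (auto simp: incr that)
    also have "\<dots> = (LBINT t. (\<integral>z. indicator {x..y} t * P1 t z \<partial>M))"
      using Fubini_integral[OF P1xy] by simp
    also have "\<dots> = (LBINT t:{x..y}. g1 t)" by (simp add: set_lebesgue_integral_def g1_def)
    also have "\<dots> = integral {x..y} g1" by (rule set_borel_integral_eq_integral(2)[OF g1])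
    finally show "(\<integral>z. P y z - P x z \<partial>M) = integral {x..y} g1" .
  qed
  \<comment> \<open>almost every \<open>t \<in> [-1, 1]\<close> gives an integrable \<open>P t\<close>, and one of them suffices\<close>
  have "AE t in lborel. integrable M (\<lambda>z. indicator {-real 1..real 1} t * P t z)"
    using AE_integrable_fst'[OF P[of 1]] by simp
  moreover have "\<not> (AE t in lborel. t \<notin> {-1..1::real})"
  proof
    assume "AE t in lborel. t \<notin> {-1..1::real}"
    then have "emeasure lborel {-1..1::real} = 0"
      using AE_iff_measurable[of "{-1..1::real}" lborel "\<lambda>t. t \<notin> {-1..1}"] by (auto simp: atLeastAtMost_def atLeast_def atMost_def)
    then show False by simp
  qed
  ultimately have "\<exists>t. integrable M (\<lambda>z. indicator {-real 1..real 1} t * P t z) \<and> t \<in> {-1..1::real}"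
    by (smt (verit) eventually_mono)
  then obtain s where s: "integrable M (P s)" by (auto simp: indicator_def)
  have Pint: "integrable M (P t)" for t
  proof (cases "s \<le> t")
    case True
    from Bochner_Integration.integrable_add[OF s incr_int[OF this]] show ?thesis by simp
  next
    case False
    then have "t \<le> s" by simp
    from Bochner_Integration.integrable_diff[OF s incr_int[OF this]] show ?thesis by simp
  qed
  have g: "g y - g x = integral {x..y} g1" if "x \<le> y" for x y
    using incr_eq[OF that] Pint by (simp add: g_def)
  have main: "ennreal \<bar>LBINT x. g x * \<kappa> x\<bar> \<le> ennreal c * (\<integral>\<^sup>+x. ennreal (\<bar>g x\<bar> * \<omega> x + \<bar>g1 x\<bar> * \<psi> x) \<partial>lborel)"
    by (rule weighted_derivative_bound[OF G supp \<kappa> R w pos bds g1 mg1 g])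
  obtain B where B: "\<And>x. \<bar>\<kappa> x\<bar> \<le> B"
    using compact_support_bounded[OF \<kappa> supp(2)] by metis
  obtain n :: nat where n: "\<bar>r\<bar> \<le> real n" using real_arch_simple by blast
  have "integrable (lborel \<Otimes>\<^sub>M M) (\<lambda>(t,z). P t z * \<kappa> t)"
  proof (rule Bochner_Integration.integrable_bound[OF integrable_mult_right[OF P[of n], of B]])
    have "\<bar>P t z\<bar> * \<bar>\<kappa> t\<bar> \<le> \<bar>B * (indicator {- real n..real n} t * P t z)\<bar>" for t z
    proof (cases "\<bar>t\<bar> \<le> real n")
      case True
      have "\<bar>\<kappa> t\<bar> \<le> \<bar>B\<bar>" using B[of t] by linarith
      then show ?thesis using True mult_left_mono[of "\<bar>\<kappa> t\<bar>" "\<bar>B\<bar>" "\<bar>P t z\<bar>"]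
        by (auto simp: abs_mult indicator_def mult.commute)
    next
      case False then show ?thesis using supp(2)[of t] n by simp
    qed
    then show "AE x in lborel \<Otimes>\<^sub>M M. norm (case x of (t, z) \<Rightarrow> P t z * \<kappa> t)
            \<le> norm (B * (case x of (t, z) \<Rightarrow> indicator {- real n..real n} t * P t z))"
      by (intro AE_I2) (auto simp: abs_mult split: prod.splits)
  qed measurable
  from Fubini_integral[OF this]
  have "(\<integral>z. (LBINT t. P t z * \<kappa> t) \<partial>M) = (LBINT t. (\<integral>z. P t z * \<kappa> t \<partial>M))" by simp
  also have "\<dots> = (LBINT t. g t * \<kappa> t)" by (simp add: g_def)
  finally show ?thesis using main by (simp add: g_def g1_def)
qed

section \<open>Integrating out the coordinates one at a time\<close>

abbreviation leb :: "'i set \<Rightarrow> ('i \<Rightarrow> real) measure" where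
  "leb I \<equiv> PiM I (\<lambda>_. lborel)"

interpretation lebesgue_product: product_sigma_finite "\<lambda>_::'i. lborel :: real measure"
  by standard

lemma (in product_sigma_finite) distr_fun_upd:
  assumes "finite J" "j \<notin> J"
  shows "distr (M j \<Otimes>\<^sub>M PiM J M) (PiM (insert j J) M) (\<lambda>(t, z). z(j := t)) = PiM (insert j J) M"
proof (rule PiM_eqI)
  interpret J: finite_product_sigma_finite M J by standard fact
  have [measurable]: "(\<lambda>(t, z). z(j := t)) \<in> measurable (M j \<Otimes>\<^sub>M PiM J M) (PiM (insert j J) M)"
    using assms by (auto intro!: measurable_fun_upd[where J=J] simp: split_beta')
  fix A assume A: "\<And>i. i \<in> insert j J \<Longrightarrow> A i \<in> sets (M i)"
  have eq: "(\<lambda>(t, z). z(j := t)) -` Pi\<^sub>E (insert j J) A \<inter> space (M j \<Otimes>\<^sub>M PiM J M) = A j \<times> Pi\<^sub>E J A"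
    using A[THEN sets.sets_into_space] assms(2)
    by (auto simp: space_pair_measure space_PiM PiE_iff extensional_def split: if_splits)
  have "emeasure (distr (M j \<Otimes>\<^sub>M PiM J M) (PiM (insert j J) M) (\<lambda>(t, z). z(j := t))) (Pi\<^sub>E (insert j J) A)
      = emeasure (M j \<Otimes>\<^sub>M PiM J M) (A j \<times> Pi\<^sub>E J A)"
    unfolding eq[symmetric] using A assms(1)
    by (intro emeasure_distr sets_PiM_I_finite) simp_all
  also have "\<dots> = emeasure (M j) (A j) * (\<Prod>i\<in>J. emeasure (M i) (A i))"
    using A assms(1)
    by (subst J.emeasure_pair_measure_Times) (auto simp: emeasure_PiM intro!: sets_PiM_I_finite)
  also have "\<dots> = (\<Prod>i\<in>insert j J. emeasure (M i) (A i))"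
    using assms by simp
  finally show "emeasure (distr (M j \<Otimes>\<^sub>M PiM J M) (PiM (insert j J) M) (\<lambda>(t, z). z(j := t))) (Pi\<^sub>E (insert j J) A)
      = (\<Prod>i\<in>insert j J. emeasure (M i) (A i))" .
qed (use assms(1) in simp_all)

lemma (in product_sigma_finite) integrable_fun_upd:
  fixes f :: "_ \<Rightarrow> real"
  assumes "finite J" "j \<notin> J" "integrable (PiM (insert j J) M) f"
  shows "integrable (M j \<Otimes>\<^sub>M PiM J M) (\<lambda>(t, z). f (z(j := t)))"
proof -
  have [measurable]: "(\<lambda>(t, z). z(j := t)) \<in> measurable (M j \<Otimes>\<^sub>M PiM J M) (PiM (insert j J) M)"
    using assms by (auto intro!: measurable_fun_upd[where J=J] simp: split_beta')
  have "integrable (distr (M j \<Otimes>\<^sub>M PiM J M) (PiM (insert j J) M) (\<lambda>(t, z). z(j := t))) f"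
    unfolding distr_fun_upd[OF assms(1,2)] by (rule assms(3))
  then have "integrable (M j \<Otimes>\<^sub>M PiM J M) (\<lambda>p. f (case p of (t, z) \<Rightarrow> z(j := t)))"
    by (rule integrable_distr[rotated]) measurable
  then show ?thesis by (simp add: split_beta')
qed

lemma (in product_sigma_finite) AE_integrable_merge:
  fixes f :: "_ \<Rightarrow> real"
  assumes "finite I" "finite J" "I \<inter> J = {}" "integrable (PiM (I \<union> J) M) f"
  shows "AE x in PiM I M. integrable (PiM J M) (\<lambda>z. f (merge I J (x, z)))"
proof -
  interpret I: finite_product_sigma_finite M I by standard fact
  interpret J: finite_product_sigma_finite M J by standard fact
  interpret pair_sigma_finite "PiM I M" "PiM J M" by standard
  have D: "integrable (distr (PiM I M \<Otimes>\<^sub>M PiM J M) (PiM (I \<union> J) M) (merge I J)) f"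
    unfolding distr_merge[OF assms(3,1,2)] by (rule assms(4))
  have "integrable (PiM I M \<Otimes>\<^sub>M PiM J M) (\<lambda>p. f (merge I J p))"
    by (rule integrable_distr[OF measurable_merge D])
  then show ?thesis by (rule AE_integrable_fst')
qed

text \<open>\<open>D w\<close> stands for the mixed derivative with index \<open>w\<close> times the density in the coordinates outside \<open>u\<close>;
\<open>\<kappa> j\<close> is the kernel against which coordinate \<open>j\<close> is integrated. For \<open>j \<in> u - v\<close> it is estimated by its
supremum, for \<open>j \<in> v\<close> it is, up to \<open>R j\<close>, the derivative of \<open>G j\<close>.\<close>

locale kernel_family =
  fixes u v :: "'s::finite set" and D :: "'s set \<Rightarrow> ('s \<Rightarrow> real) \<Rightarrow> real"
    and \<kappa> G R :: "'s \<Rightarrow> real \<Rightarrow> real" and r :: real and c :: "'s \<Rightarrow> real" and \<psi> \<omega> :: "real \<Rightarrow> real"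
  assumes vu: "v \<subseteq> u"
    and measD[measurable]: "\<And>w. w \<subseteq> v \<Longrightarrow> D w \<in> borel_measurable (leb UNIV)"
    and integrableD: "\<And>w n. w \<subseteq> v \<Longrightarrow>
      integrable (leb UNIV) (\<lambda>x. (\<Prod>i\<in>u. indicator {-real n..real n} (x i)) * D w x)"
    and derivD: "\<And>w j x t. w \<subseteq> v \<Longrightarrow> j \<in> v - w \<Longrightarrow>
      ((\<lambda>t. D w (x(j := t))) has_real_derivative D (insert j w) (x(j := t))) (at t)"
    and contD: "\<And>w j x. w \<subseteq> v \<Longrightarrow> j \<in> u \<Longrightarrow> continuous_on UNIV (\<lambda>t. D w (x(j := t)))"
    and \<kappa>_cont: "\<And>j. j \<in> u \<Longrightarrow> continuous_on UNIV (\<kappa> j)"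
    and \<kappa>_supp: "\<And>j x. j \<in> u \<Longrightarrow> r \<le> \<bar>x\<bar> \<Longrightarrow> \<kappa> j x = 0"
    and c_pos: "\<And>j. j \<in> u \<Longrightarrow> 0 < c j"
    and \<kappa>_bound: "\<And>j x. j \<in> u - v \<Longrightarrow> \<bar>\<kappa> j x\<bar> \<le> c j"
    and G_deriv: "\<And>j x. j \<in> v \<Longrightarrow> (G j has_real_derivative (\<kappa> j x - R j x)) (at x)"
    and GR_supp: "\<And>j x. j \<in> v \<Longrightarrow> r \<le> \<bar>x\<bar> \<Longrightarrow> G j x = 0" "\<And>j x. j \<in> v \<Longrightarrow> r \<le> \<bar>x\<bar> \<Longrightarrow> R j x = 0"
    and measR: "\<And>j. j \<in> v \<Longrightarrow> R j \<in> borel_measurable borel"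
    and meas_weights[measurable]: "\<psi> \<in> borel_measurable borel" "\<omega> \<in> borel_measurable borel"
    and weights_nonneg: "\<And>x. 0 \<le> \<psi> x" "\<And>x. 0 \<le> \<omega> x"
    and GR_bound: "\<And>j x. j \<in> v \<Longrightarrow> \<bar>G j x\<bar> \<le> c j * \<psi> x" "\<And>j x. j \<in> v \<Longrightarrow> \<bar>R j x\<bar> \<le> c j * \<omega> x"
begin

text \<open>The coordinates outside \<open>I\<close> have been integrated out. For \<open>I = u\<close> this is the inner integral of the norm,
for \<open>I = {}\<close> the integral that is to be estimated.\<close>

definition marginal :: "'s set \<Rightarrow> 's set \<Rightarrow> ('s \<Rightarrow> real) \<Rightarrow> real" where
  "marginal I w x = (\<integral>z. D w (merge I (-I) (x, z)) * (\<Prod>i\<in>u - I. \<kappa> i (z i)) \<partial>leb (-I))"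

definition weight :: "'s set \<Rightarrow> 's set \<Rightarrow> ('s \<Rightarrow> real) \<Rightarrow> real" where
  "weight I w x = (\<Prod>i\<in>w. \<psi> (x i)) * (\<Prod>i\<in>v \<inter> I - w. \<omega> (x i))"

text \<open>This quantity interpolates between the absolute value of the integral (\<open>I = {}\<close>) and the norm of \<open>F\<close>
(\<open>I = u\<close>).\<close>

definition mixed_norm :: "'s set \<Rightarrow> ennreal" where
  "mixed_norm I = (\<Sum>w\<in>Pow (v \<inter> I). \<integral>\<^sup>+x. ennreal (\<bar>marginal I w x\<bar> * weight I w x) \<partial>leb I)"

lemma \<kappa>_meas: "j \<in> u \<Longrightarrow> \<kappa> j \<in> borel_measurable borel"
  using \<kappa>_cont borel_measurable_continuous_onI by blast

lemma measurable_prod_\<kappa>: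
  "J \<subseteq> u \<Longrightarrow> J \<subseteq> K \<Longrightarrow> (\<lambda>z. \<Prod>i\<in>J. \<kappa> i (z i)) \<in> borel_measurable (leb K)"
  using \<kappa>_meas by (intro borel_measurable_prod measurable_compose[OF measurable_component_singleton]) auto

lemma \<kappa>_bdd: obtains B where "B \<ge> 0" "\<And>j x. j \<in> u \<Longrightarrow> \<bar>\<kappa> j x\<bar> \<le> B"
proof -
  have "\<exists>B. \<forall>x. \<bar>\<kappa> j x\<bar> \<le> B" if "j \<in> u" for j
    using compact_support_bounded[OF \<kappa>_cont[OF that] \<kappa>_supp[OF that]] by metis
  then obtain b where b: "\<And>j x. j \<in> u \<Longrightarrow> \<bar>\<kappa> j x\<bar> \<le> b j" by metis
  have bj: "\<bar>b j\<bar> \<le> (\<Sum>j\<in>u. \<bar>b j\<bar>)" if "j \<in> u" for j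
    using that by (intro member_le_sum) auto
  have "\<bar>\<kappa> j x\<bar> \<le> (\<Sum>j\<in>u. \<bar>b j\<bar>)" if "j \<in> u" for j x
    using b[OF that, of x] bj[OF that] by linarith
  then show ?thesis by (intro that[of "\<Sum>j\<in>u. \<bar>b j\<bar>"]) (auto intro: sum_nonneg)
qed

lemma merge_UNIV_measurable: "merge K (-K) \<in> measurable (leb K \<Otimes>\<^sub>M leb (-K)) (PiM (UNIV::'s set) (\<lambda>_. lborel::real measure))"
  using measurable_merge[of K "-K" "\<lambda>_. lborel :: real measure"] by simp

lemma marginal_measurable:
  assumes "w \<subseteq> v"
  shows "marginal I w \<in> borel_measurable (leb I)"
proof -
  interpret finite_product_sigma_finite "\<lambda>_::'s. lborel :: real measure" "-I" by standard simp
  have [measurable]: "D w \<in> borel_measurable (leb UNIV)" using assms by (rule measD)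
  have [measurable]: "(\<lambda>z. \<Prod>i\<in>u-I. \<kappa> i (z i)) \<in> borel_measurable (leb (-I))"
    by (rule measurable_prod_\<kappa>) auto
  note merge_UNIV_measurable[of I, measurable]
  show ?thesis unfolding marginal_def[abs_def] by measurable
qed

lemma weight_measurable:
  assumes "w \<subseteq> v \<inter> I"
  shows "weight I w \<in> borel_measurable (leb I)"
  unfolding weight_def[abs_def] using assms
  by (intro borel_measurable_times borel_measurable_prod measurable_compose[OF measurable_component_singleton])
     auto

lemma weight_nonneg: "0 \<le> weight I w x"
  unfolding weight_def by (intro mult_nonneg_nonneg prod_nonneg) (auto simp: weights_nonneg)

text \<open>A kernel is bounded with compact support, so it localizes its coordinate as well as a box does.\<close>

lemma integrable_box_kernel:
  assumes "w \<subseteq> v"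
  shows "integrable (leb UNIV) (\<lambda>x. (\<Prod>i\<in>u \<inter> K. indicator {-real (\<rho> i)..real (\<rho> i)} (x i)) * D w x * (\<Prod>i\<in>u - K. \<kappa> i (x i)))"
proof -
  obtain B where B: "B \<ge> 0" "\<And>j x. j \<in> u \<Longrightarrow> \<bar>\<kappa> j x\<bar> \<le> B" by (rule \<kappa>_bdd) blast
  obtain m :: nat where "max \<bar>r\<bar> (\<Sum>i\<in>u. real (\<rho> i)) \<le> real m" using real_arch_simple by blast
  moreover have "real (\<rho> i) \<le> (\<Sum>i\<in>u. real (\<rho> i))" if "i \<in> u" for i
    using that by (intro member_le_sum) auto
  ultimately have m: "\<bar>r\<bar> \<le> real m" "i \<in> u \<Longrightarrow> real (\<rho> i) \<le> real m" for i by force+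
  have [measurable]: "D w \<in> borel_measurable (leb UNIV)" using assms by (rule measD)
  have [measurable]: "(\<lambda>z. \<Prod>i\<in>u-K. \<kappa> i (z i)) \<in> borel_measurable (leb UNIV)"
    by (rule measurable_prod_\<kappa>) auto
  show ?thesis
  proof (rule Bochner_Integration.integrable_bound[OF integrable_mult_right[OF integrableD[OF assms, of m], of "B ^ card (u - K)"]])
    show "AE x in leb UNIV. norm ((\<Prod>i\<in>u \<inter> K. indicator {-real (\<rho> i)..real (\<rho> i)} (x i)) * D w x * (\<Prod>i\<in>u - K. \<kappa> i (x i)))
      \<le> norm (B ^ card (u - K) * ((\<Prod>i\<in>u. indicator {- real m..real m} (x i)) * D w x))"
    proof (rule AE_I2)
      fix x :: "'s \<Rightarrow> real"
      show "norm ((\<Prod>i\<in>u \<inter> K. indicator {-real (\<rho> i)..real (\<rho> i)} (x i)) * D w x * (\<Prod>i\<in>u - K. \<kappa> i (x i)))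
      \<le> norm (B ^ card (u - K) * ((\<Prod>i\<in>u. indicator {- real m..real m} (x i)) * D w x))"
      proof (cases "(\<exists>i\<in>u\<inter>K. x i \<notin> {-real (\<rho> i)..real (\<rho> i)}) \<or> (\<exists>i\<in>u-K. \<kappa> i (x i) = 0)")
        case True
        then have "(\<Prod>i\<in>u \<inter> K. indicator {-real (\<rho> i)..real (\<rho> i)} (x i)) = (0::real) \<or> (\<Prod>i\<in>u - K. \<kappa> i (x i)) = 0"
        proof (elim disjE bexE)
          fix i assume "i \<in> u \<inter> K" "x i \<notin> {-real (\<rho> i)..real (\<rho> i)}"
          then show ?thesis by (intro disjI1 prod_zero) (auto intro!: bexI[of _ i] indicator_simps(2))
        next
          fix i assume "i \<in> u - K" "\<kappa> i (x i) = 0"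
          then show ?thesis by (intro disjI2 prod_zero) (auto intro!: bexI[of _ i])
        qed
        then have "norm ((\<Prod>i\<in>u \<inter> K. indicator {-real (\<rho> i)..real (\<rho> i)} (x i)) * D w x * (\<Prod>i\<in>u - K. \<kappa> i (x i))) = 0"
          by (elim disjE) simp_all
        then show ?thesis by (simp only: norm_ge_zero)
      next
        case False
        have "x i \<in> {-real m..real m}" if "i \<in> u" for i
        proof (cases "i \<in> K")
          case True
          then have "x i \<in> {-real (\<rho> i)..real (\<rho> i)}" using False that by blast
          then show ?thesis using m(2)[OF that] by auto
        next
          case f: False
          then have "\<not> r \<le> \<bar>x i\<bar>" using False that \<kappa>_supp by blast
          then show ?thesis using m(1) by auto
        qed
        then have 1: "(\<Prod>i\<in>u. indicator {- real m..real m} (x i)) = (1::real)" by (intro prod.neutral) auto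
        have 2: "(\<Prod>i\<in>u \<inter> K. indicator {- real (\<rho> i)..real (\<rho> i)} (x i)) = (1::real)"
          using False by (intro prod.neutral ballI indicator_simps(1)) blast
        have "\<bar>\<Prod>i\<in>u - K. \<kappa> i (x i)\<bar> \<le> B ^ card (u - K)"
          unfolding abs_prod prod_constant[symmetric] by (intro prod_mono) (auto simp: B)
        then have "\<bar>D w x\<bar> * \<bar>\<Prod>i\<in>u - K. \<kappa> i (x i)\<bar> \<le> \<bar>D w x\<bar> * B ^ card (u - K)"
          by (rule mult_left_mono) simp
        then show ?thesis unfolding 1 2 using B(1) by (simp add: abs_mult mult.commute)
      qed
    qed
  qed measurable
qed

lemma AE_section_integrable:
  assumes "w \<subseteq> v" "I \<subseteq> K"
  shows "AE x in leb I. \<forall>k::nat. integrable (leb (-I))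
    (\<lambda>z. (\<Prod>i\<in>u \<inter> K - I. indicator {-real k..real k} (z i)) * D w (merge I (-I) (x, z)) * (\<Prod>i\<in>u - K. \<kappa> i (z i)))"
proof -
  define h where "h n k x = (\<Prod>i\<in>u \<inter> K. indicator {-real (if i \<in> I then n else k)..real (if i \<in> I then n else k)} (x i))
    * D w x * (\<Prod>i\<in>u - K. \<kappa> i (x i))" for n k :: nat and x
  have "AE x in leb I. integrable (leb (-I)) (\<lambda>z. h n k (merge I (-I) (x, z)))" for n k
    using integrable_box_kernel[OF assms(1), where K=K and \<rho>="\<lambda>i. if i \<in> I then n else k"]
    by (intro lebesgue_product.AE_integrable_merge) (auto simp: h_def[abs_def])
  then have "AE x in leb I. \<forall>n k. integrable (leb (-I)) (\<lambda>z. h n k (merge I (-I) (x, z)))"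
    by (simp add: AE_all_countable)
  then show ?thesis
  proof (eventually_elim, intro allI)
    fix x and k :: nat
    assume x: "\<forall>n k. integrable (leb (-I)) (\<lambda>z. h n k (merge I (-I) (x, z)))"
    \<comment> \<open>for a fixed \<open>x\<close> the cutoff in the coordinates \<open>I\<close> disappears once the radius is large\<close>
    obtain m :: nat where m: "(\<Sum>i\<in>I. \<bar>x i\<bar>) \<le> real m" using real_arch_simple by blast
    have mi: "x i \<in> {-real m..real m}" if "i \<in> I" for i
      using member_le_sum[of i I "\<lambda>i. \<bar>x i\<bar>"] that m by (auto simp: abs_le_iff)
    have "h m k (merge I (-I) (x, z))
      = (\<Prod>i\<in>u \<inter> K - I. indicator {-real k..real k} (z i)) * D w (merge I (-I) (x, z)) * (\<Prod>i\<in>u - K. \<kappa> i (z i))" for z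
    proof -
      let ?f = "\<lambda>i. indicator {-real (if i \<in> I then m else k)..real (if i \<in> I then m else k)} (merge I (- I) (x, z) i) :: real"
      have "(\<Prod>i\<in>u \<inter> K. ?f i) = (\<Prod>i\<in>u \<inter> K - u \<inter> I. ?f i) * (\<Prod>i\<in>u \<inter> I. ?f i)"
        using assms(2) by (intro prod.subset_diff) auto
      also have "(\<Prod>i\<in>u \<inter> I. ?f i) = 1" using mi by (intro prod.neutral) auto
      also have "(\<Prod>i\<in>u \<inter> K - u \<inter> I. ?f i) = (\<Prod>i\<in>u \<inter> K - I. indicator {-real k..real k} (z i))"
        by (intro prod.cong) auto
      finally have 1: "(\<Prod>i\<in>u \<inter> K. ?f i) = (\<Prod>i\<in>u \<inter> K - I. indicator {-real k..real k} (z i))" by simp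
      have 2: "(\<Prod>i\<in>u - K. \<kappa> i (merge I (- I) (x, z) i)) = (\<Prod>i\<in>u - K. \<kappa> i (z i))"
        using assms(2) by (intro prod.cong) (auto simp: merge_def dest: subsetD)
      show ?thesis unfolding h_def 1 2 ..
    qed
    then show "integrable (leb (-I)) (\<lambda>z. (\<Prod>i\<in>u \<inter> K - I. indicator {-real k..real k} (z i))
        * D w (merge I (-I) (x, z)) * (\<Prod>i\<in>u - K. \<kappa> i (z i)))"
      using x[rule_format, of m k] by simp
  qed
qed

text \<open>The integrand of the marginal for \<open>insert j I\<close>, with the value \<open>t\<close> of coordinate \<open>j\<close> singled out.\<close>

definition slice :: "'s set \<Rightarrow> 's \<Rightarrow> 's set \<Rightarrow> ('s \<Rightarrow> real) \<Rightarrow> real \<Rightarrow> ('s \<Rightarrow> real) \<Rightarrow> real" where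
  "slice I j w x t z = D w (merge (insert j I) (- insert j I) (x(j := t), z)) * (\<Prod>i\<in>u - insert j I. \<kappa> i (z i))"

lemma slice_measurable:
  assumes "w \<subseteq> v" "x \<in> space (leb I)"
  shows "case_prod (slice I j w x) \<in> borel_measurable (lborel \<Otimes>\<^sub>M leb (- insert j I))"
proof -
  have [measurable]: "D w \<in> borel_measurable (leb UNIV)" using assms(1) by (rule measD)
  have [measurable]: "(\<lambda>z. \<Prod>i\<in>u- insert j I. \<kappa> i (z i)) \<in> borel_measurable (leb (-insert j I))"
    by (rule measurable_prod_\<kappa>) auto
  note merge_UNIV_measurable[of "insert j I", measurable]
  have [measurable]: "(\<lambda>t. x(j := t)) \<in> measurable lborel (leb (insert j I))"
    using assms(2) by (intro measurable_fun_upd[where J=I]) auto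
  show ?thesis unfolding slice_def[abs_def] by measurable
qed

lemma marginal_slice: "marginal (insert j I) w (x(j := t)) = (\<integral>z. slice I j w x t z \<partial>leb (- insert j I))"
  unfolding marginal_def slice_def ..

lemma merge_upd:
  assumes "j \<notin> I"
  shows "merge I (- I) (x, z(j := t)) = merge (insert j I) (- insert j I) (x(j := t), z)"
  using assms by (auto simp: merge_def fun_eq_iff)

lemma AE_slice_integrable:
  assumes "w \<subseteq> v" "j \<in> u - I"
  shows "AE x in leb I. \<forall>n::nat. integrable (lborel \<Otimes>\<^sub>M leb (- insert j I))
     (\<lambda>(t, z). indicator {-real n..real n} t * slice I j w x t z)"
proof -
  let ?K = "insert j I"
  have eqI: "- I = insert j (- ?K)" and uj: "u \<inter> ?K - I = {j}" using assms(2) by auto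
  have "AE x in leb I. \<forall>k::nat. integrable (leb (-I))
    (\<lambda>z. indicator {-real k..real k} (z j) * D w (merge I (-I) (x, z)) * (\<Prod>i\<in>u - ?K. \<kappa> i (z i)))"
    using AE_section_integrable[OF assms(1) subset_insertI, of I j] unfolding uj by simp
  then show ?thesis
  proof (eventually_elim, intro allI)
    fix x and n :: nat
    let ?f = "\<lambda>z. indicator {-real n..real n} (z j) * D w (merge I (-I) (x, z)) * (\<Prod>i\<in>u - ?K. \<kappa> i (z i))"
    assume "\<forall>k::nat. integrable (leb (-I))
      (\<lambda>z. indicator {-real k..real k} (z j) * D w (merge I (-I) (x, z)) * (\<Prod>i\<in>u - ?K. \<kappa> i (z i)))"
    then have "integrable (leb (insert j (- ?K))) ?f"
      unfolding eqI[symmetric] by (rule spec)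
    then have A: "integrable (lborel \<Otimes>\<^sub>M leb (- ?K)) (\<lambda>(t, z). ?f (z(j := t)))"
      by (intro lebesgue_product.integrable_fun_upd) auto
    have fj: "?f (z(j := t)) = indicator {-real n..real n} t * slice I j w x t z" for t z
    proof -
      have "merge I (- I) (x, z(j := t)) = merge ?K (- ?K) (x(j := t), z)"
        by (rule merge_upd) (use assms(2) in auto)
      moreover have "(\<Prod>i\<in>u - ?K. \<kappa> i ((z(j := t)) i)) = (\<Prod>i\<in>u - ?K. \<kappa> i (z i))" by (intro prod.cong) auto
      ultimately show ?thesis unfolding slice_def by (simp add: mult.assoc)
    qed
    show "integrable (lborel \<Otimes>\<^sub>M leb (- ?K)) (\<lambda>(t, z). indicator {-real n..real n} t * slice I j w x t z)"
      using A unfolding fj .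
  qed
qed

lemma AE_marginal_unfold:
  assumes "w \<subseteq> v" "j \<in> u - I"
  shows "AE x in leb I. 
    integrable (lborel \<Otimes>\<^sub>M leb (- insert j I)) (\<lambda>(t, z). slice I j w x t z * \<kappa> j t) \<and>
    marginal I w x = (\<integral>z. (LBINT t. slice I j w x t z * \<kappa> j t) \<partial>leb (- insert j I))"
proof -
  let ?K = "insert j I"
  have eqI: "- I = insert j (- ?K)" using assms(2) by auto
  have "AE x in leb I. integrable (leb (-I)) (\<lambda>z. D w (merge I (-I) (x, z)) * (\<Prod>i\<in>u - I. \<kappa> i (z i)))"
  proof -
    have empty: "u \<inter> I - I = {}" by auto
    show ?thesis using AE_section_integrable[OF assms(1) order_refl, of I] unfolding empty by simp
  qed
  then show ?thesis
  proof eventually_elim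
    fix x
    let ?f = "\<lambda>z. D w (merge I (- I) (x, z)) * (\<Prod>i\<in>u - I. \<kappa> i (z i))"
    assume "integrable (leb (-I)) ?f"
    then have f: "integrable (leb (insert j (- ?K))) ?f" unfolding eqI[symmetric] .
    have fj: "?f (z(j := t)) = slice I j w x t z * \<kappa> j t" for z t
    proof -
      have "(\<Prod>i\<in>u - I. \<kappa> i ((z(j := t)) i)) = (\<Prod>i\<in>insert j (u - ?K). \<kappa> i ((z(j := t)) i))"
        using assms(2) by (intro prod.cong) auto
      also have "\<dots> = \<kappa> j t * (\<Prod>i\<in>u - ?K. \<kappa> i ((z(j := t)) i))" by (subst prod.insert) auto
      also have "(\<Prod>i\<in>u - ?K. \<kappa> i ((z(j := t)) i)) = (\<Prod>i\<in>u - ?K. \<kappa> i (z i))" by (intro prod.cong) auto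
      finally have 1: "(\<Prod>i\<in>u - I. \<kappa> i ((z(j := t)) i)) = \<kappa> j t * (\<Prod>i\<in>u - ?K. \<kappa> i (z i))" .
      have 2: "merge I (- I) (x, z(j := t)) = merge ?K (- ?K) (x(j := t), z)"
        by (rule merge_upd) (use assms(2) in auto)
      show ?thesis unfolding slice_def 1 2 by (simp only: ac_simps)
    qed
    have "marginal I w x = integral\<^sup>L (leb (insert j (- ?K))) ?f"
      unfolding marginal_def eqI[symmetric] ..
    also have "\<dots> = (\<integral>z. (LBINT t. ?f (z(j := t))) \<partial>leb (- insert j I))"
      by (rule lebesgue_product.product_integral_insert[OF _ _ f]) auto
    finally have "marginal I w x = (\<integral>z. (LBINT t. slice I j w x t z * \<kappa> j t) \<partial>leb (- insert j I))"
      unfolding fj .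
    moreover have "integrable (lborel \<Otimes>\<^sub>M leb (- ?K)) (\<lambda>(t, z). ?f (z(j := t)))"
      by (intro lebesgue_product.integrable_fun_upd f) auto
    ultimately show "integrable (lborel \<Otimes>\<^sub>M leb (- insert j I)) (\<lambda>(t, z). slice I j w x t z * \<kappa> j t) \<and>
    marginal I w x = (\<integral>z. (LBINT t. slice I j w x t z * \<kappa> j t) \<partial>leb (- insert j I))"
      unfolding fj by blast
  qed
qed

lemma AE_marginal_bound_once:
  assumes "w \<subseteq> v" "j \<in> u - v" "j \<notin> I"
  shows "AE x in leb I. ennreal \<bar>marginal I w x\<bar> 
    \<le> ennreal (c j) * (\<integral>\<^sup>+t. ennreal \<bar>marginal (insert j I) w (x(j := t))\<bar> \<partial>lborel)"
proof -
  interpret J: finite_product_sigma_finite "\<lambda>_::'s. lborel :: real measure" "- insert j I" by standard simp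
  interpret pair_sigma_finite "lborel :: real measure" "leb (- insert j I)" by standard
  have ju: "j \<in> u - I" "j \<in> u" using assms by auto
  from AE_marginal_unfold[OF assms(1) ju(1)] AE_space show ?thesis
  proof eventually_elim
    case (elim x)
    have [measurable]: "(\<lambda>t. marginal (insert j I) w (x(j := t))) \<in> borel_measurable lborel"
      using elim(2) by (intro measurable_compose[OF _ marginal_measurable[OF assms(1)]] measurable_fun_upd[where J=I]) auto
    note [measurable] = \<kappa>_meas[OF ju(2)]
    have "marginal I w x = (LBINT t. (\<integral>z. slice I j w x t z * \<kappa> j t \<partial>leb (- insert j I)))"
      using elim(1) Fubini_integral[of "\<lambda>t z. slice I j w x t z * \<kappa> j t"] by simp
    also have "\<dots> = (LBINT t. marginal (insert j I) w (x(j := t)) * \<kappa> j t)"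
      by (simp add: marginal_slice)
    finally have "ennreal \<bar>marginal I w x\<bar> = ennreal (norm (LBINT t. marginal (insert j I) w (x(j := t)) * \<kappa> j t))" by simp
    also have "\<dots> \<le> (\<integral>\<^sup>+t. ennreal (norm (marginal (insert j I) w (x(j := t)) * \<kappa> j t)) \<partial>lborel)"
    proof (cases "integrable lborel (\<lambda>t. marginal (insert j I) w (x(j := t)) * \<kappa> j t)")
      case True then show ?thesis by (rule integral_norm_bound_ennreal)
    qed (simp add: not_integrable_integral_eq)
    also have "\<dots> \<le> (\<integral>\<^sup>+t. ennreal (c j) * ennreal \<bar>marginal (insert j I) w (x(j := t))\<bar> \<partial>lborel)"
    proof (rule nn_integral_mono)
      fix t
      have "\<bar>marginal (insert j I) w (x(j := t))\<bar> * \<bar>\<kappa> j t\<bar> \<le> \<bar>marginal (insert j I) w (x(j := t))\<bar> * c j"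
        using \<kappa>_bound[OF assms(2)] by (intro mult_left_mono) auto
      then have "norm (marginal (insert j I) w (x(j := t)) * \<kappa> j t) \<le> c j * \<bar>marginal (insert j I) w (x(j := t))\<bar>"
        by (simp add: abs_mult mult.commute)
      then show "ennreal (norm (marginal (insert j I) w (x(j := t)) * \<kappa> j t)) \<le> ennreal (c j) * ennreal \<bar>marginal (insert j I) w (x(j := t))\<bar>"
        using c_pos[OF ju(2)] by (subst ennreal_mult[symmetric]) (auto intro: ennreal_leI)
    qed
    also have "\<dots> = ennreal (c j) * (\<integral>\<^sup>+t. ennreal \<bar>marginal (insert j I) w (x(j := t))\<bar> \<partial>lborel)"
      by (rule nn_integral_cmult) simp
    finally show ?case .
  qed
qed

text \<open>The derivative of \<open>D w\<close> in direction \<open>j\<close> is \<open>D (insert j w)\<close>, so integrating out \<open>j\<close> by parts splits the term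
for \<open>w\<close> into the terms for \<open>w\<close> and for \<open>insert j w\<close>.\<close>

lemma AE_marginal_bound_twice:
  assumes "w \<subseteq> v" "j \<in> v - w" "j \<notin> I"
  shows "AE x in leb I. ennreal \<bar>marginal I w x\<bar> 
    \<le> ennreal (c j) * (\<integral>\<^sup>+t. ennreal (\<bar>marginal (insert j I) w (x(j := t))\<bar> * \<omega> t
         + \<bar>marginal (insert j I) (insert j w) (x(j := t))\<bar> * \<psi> t) \<partial>lborel)"
proof -
  interpret J: finite_product_sigma_finite "\<lambda>_::'s. lborel :: real measure" "- insert j I" by standard simp
  have jv: "j \<in> u - I" "j \<in> u" "j \<in> v" "insert j w \<subseteq> v" using assms vu by auto
  have upd: "merge (insert j I) (- insert j I) (x(j := t), z) = (merge (insert j I) (- insert j I) (x, z))(j := t)" for x z t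
    by (auto simp: merge_def fun_eq_iff)
  from AE_marginal_unfold[OF assms(1) jv(1)] AE_space AE_slice_integrable[OF assms(1) jv(1)] AE_slice_integrable[OF jv(4,1)]
  show ?thesis
  proof eventually_elim
    case (elim x)
    show ?case
      unfolding conjunct2[OF elim(1)] marginal_slice
    proof (rule parametrized_weighted_derivative_bound[where G="G j" and R="R j" and r=r])
      show "sigma_finite_measure (leb (- insert j I))" ..
      show "integrable (lborel \<Otimes>\<^sub>M leb (- insert j I))
          (\<lambda>(t, z). indicator {-real n..real n} t * slice I j w x t z)" for n :: nat
        using elim(3) by blast
      show "integrable (lborel \<Otimes>\<^sub>M leb (- insert j I))
          (\<lambda>(t, z). indicator {-real n..real n} t * slice I j (insert j w) x t z)" for n :: nat
        using elim(4) by blast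
      fix t z
      show "((\<lambda>t. slice I j w x t z) has_real_derivative slice I j (insert j w) x t z) (at t)"
        unfolding slice_def upd by (intro DERIV_cmult_right derivD assms)
      show "continuous_on UNIV (\<lambda>t. slice I j (insert j w) x t z)"
        unfolding slice_def upd by (intro continuous_intros contD jv)
    next
      show "\<bar>G j t\<bar> \<le> c j * \<psi> t" "\<bar>R j t\<bar> \<le> c j * \<omega> t" for t using GR_bound jv by auto
      show "0 < c j" using c_pos jv by auto
      show "R j \<in> borel_measurable borel" using measR jv by auto
      show "continuous_on UNIV (\<kappa> j)" using \<kappa>_cont jv by auto
      show "(G j has_real_derivative (\<kappa> j t - R j t)) (at t)" for t using G_deriv jv by auto
      show "G j t = 0" "\<kappa> j t = 0" "R j t = 0" if "r \<le> \<bar>t\<bar>" for t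
        using GR_supp \<kappa>_supp jv that by auto
      show "case_prod (slice I j w x) \<in> borel_measurable (lborel \<Otimes>\<^sub>M leb (- insert j I))"
        using slice_measurable[OF assms(1) elim(2)] .
      show "case_prod (slice I j (insert j w) x) \<in> borel_measurable (lborel \<Otimes>\<^sub>M leb (- insert j I))"
        using slice_measurable[OF jv(4) elim(2)] .
    qed (fact meas_weights weights_nonneg)+
  qed
qed

text \<open>For \<open>j \<in> v\<close> the two terms of \<open>AE_marginal_bound_twice\<close>, summed over \<open>w \<subseteq> v \<inter> I\<close>, run through all subsets of
\<open>v \<inter> insert j I\<close> exactly once.\<close>

lemma mixed_norm_step:
  assumes j: "j \<in> u - I"
  shows "mixed_norm I \<le> ennreal (c j) * mixed_norm (insert j I)"
proof -
  let ?K = "insert j I"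
  define T where "T w = (\<integral>\<^sup>+x. ennreal (\<bar>marginal ?K w x\<bar> * weight ?K w x) \<partial>leb ?K)" for w
  have ju: "j \<in> u" "j \<notin> I" using j by auto
  have T: "T w = (\<integral>\<^sup>+x. \<integral>\<^sup>+t. ennreal (\<bar>marginal ?K w (x(j := t))\<bar> * weight ?K w (x(j := t))) \<partial>lborel \<partial>leb I)"
    if "w \<subseteq> v \<inter> ?K" for w
  proof -
    have [measurable]: "marginal ?K w \<in> borel_measurable (leb ?K)" using that by (intro marginal_measurable) auto
    have [measurable]: "weight ?K w \<in> borel_measurable (leb ?K)" using that by (intro weight_measurable) auto
    show ?thesis unfolding T_def by (rule lebesgue_product.product_nn_integral_insert) (use ju in auto)
  qed
  have secupd: "(\<lambda>t. marginal ?K w (x(j := t))) \<in> borel_measurable lborel" if "w \<subseteq> v" "x \<in> space (leb I)" for w x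
    using that by (intro measurable_compose[OF _ marginal_measurable[OF that(1)]] measurable_fun_upd[where J=I]) auto
  show ?thesis
  proof (cases "j \<in> v")
    case False
    then have vK: "v \<inter> ?K = v \<inter> I" by auto
    have "(\<integral>\<^sup>+x. ennreal (\<bar>marginal I w x\<bar> * weight I w x) \<partial>leb I) \<le> ennreal (c j) * T w" if w: "w \<subseteq> v \<inter> I" for w
    proof -
      have wv: "w \<subseteq> v" using w by auto
      have wt: "weight ?K w (x(j := t)) = weight I w x" for x t
        unfolding weight_def vK using False w by (intro arg_cong2[of _ _ _ _ "(*)"] prod.cong) auto
      have "(\<integral>\<^sup>+x. ennreal (\<bar>marginal I w x\<bar> * weight I w x) \<partial>leb I)
        \<le> (\<integral>\<^sup>+x. ennreal (c j) * (\<integral>\<^sup>+t. ennreal (\<bar>marginal ?K w (x(j := t))\<bar> * weight ?K w (x(j := t))) \<partial>lborel) \<partial>leb I)"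
      proof (intro nn_integral_mono_AE)
        have "AE x in leb I. ennreal \<bar>marginal I w x\<bar> 
            \<le> ennreal (c j) * (\<integral>\<^sup>+t. ennreal \<bar>marginal (insert j I) w (x(j := t))\<bar> \<partial>lborel)"
          using False ju by (intro AE_marginal_bound_once[OF wv _ ju(2)]) auto
        then show "AE x in leb I. ennreal (\<bar>marginal I w x\<bar> * weight I w x) 
          \<le> ennreal (c j) * (\<integral>\<^sup>+t. ennreal (\<bar>marginal ?K w (x(j := t))\<bar> * weight ?K w (x(j := t))) \<partial>lborel)"
          using AE_space
        proof eventually_elim
          case (elim x)
          note secupd[OF wv elim(2), measurable]
          have "ennreal (\<bar>marginal I w x\<bar> * weight I w x) = ennreal \<bar>marginal I w x\<bar> * ennreal (weight I w x)"
            using weight_nonneg by (simp add: ennreal_mult)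
          also have "\<dots> \<le> (ennreal (c j) * (\<integral>\<^sup>+t. ennreal \<bar>marginal (insert j I) w (x(j := t))\<bar> \<partial>lborel)) * ennreal (weight I w x)"
            by (intro mult_right_mono elim) auto
          also have "\<dots> = ennreal (c j) * (\<integral>\<^sup>+t. ennreal \<bar>marginal (insert j I) w (x(j := t))\<bar> * ennreal (weight I w x) \<partial>lborel)"
            by (subst nn_integral_multc) (auto simp: mult.assoc)
          finally show ?case using weight_nonneg by (simp add: wt ennreal_mult)
        qed
      qed
      also have "\<dots> = ennreal (c j) * T w"
        unfolding T[OF order_trans[OF w eq_refl[OF vK[symmetric]]]]
      proof (rule nn_integral_cmult)
        interpret L: sigma_finite_measure "lborel :: real measure" by standard
        have [measurable]: "marginal ?K w \<in> borel_measurable (leb ?K)" using wv by (rule marginal_measurable)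
        have [measurable]: "weight ?K w \<in> borel_measurable (leb ?K)" using w by (intro weight_measurable) auto
        have [measurable]: "(\<lambda>(x, t). x(j := t)) \<in> measurable (leb I \<Otimes>\<^sub>M lborel) (leb ?K)"
          by (auto intro!: measurable_fun_upd[where J=I] simp: split_beta')
        show "(\<lambda>x. \<integral>\<^sup>+ t. ennreal (\<bar>marginal ?K w (x(j := t))\<bar> * weight ?K w (x(j := t))) \<partial>lborel) \<in> borel_measurable (leb I)"
          by measurable
      qed
      finally show ?thesis .
    qed
    then have "mixed_norm I \<le> (\<Sum>w\<in>Pow (v \<inter> I). ennreal (c j) * T w)"
      unfolding mixed_norm_def by (intro sum_mono) auto
    also have "\<dots> = ennreal (c j) * mixed_norm ?K"
      unfolding mixed_norm_def T_def vK by (simp add: sum_distrib_left)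
    finally show ?thesis .
  next
    case True
    then have vK: "v \<inter> ?K = insert j (v \<inter> I)" by auto
    have "(\<integral>\<^sup>+x. ennreal (\<bar>marginal I w x\<bar> * weight I w x) \<partial>leb I) \<le> ennreal (c j) * (T w + T (insert j w))" if w: "w \<subseteq> v \<inter> I" for w
    proof -
      have wv: "w \<subseteq> v" "insert j w \<subseteq> v" "j \<in> v - w" using w ju True by auto
      have wK: "w \<subseteq> v \<inter> ?K" "insert j w \<subseteq> v \<inter> ?K" using w True by auto
      have wt1: "weight ?K w (x(j := t)) = weight I w x * \<omega> t" for x t
      proof -
        have "v \<inter> ?K - w = insert j (v \<inter> I - w)" using True w ju by auto
        then have "(\<Prod>i\<in>v \<inter> ?K - w. \<omega> ((x(j := t)) i)) = \<omega> t * (\<Prod>i\<in>v \<inter> I - w. \<omega> ((x(j := t)) i))"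
          using ju by simp
        also have "(\<Prod>i\<in>v \<inter> I - w. \<omega> ((x(j := t)) i)) = (\<Prod>i\<in>v \<inter> I - w. \<omega> (x i))"
          using ju by (intro prod.cong) auto
        moreover have "(\<Prod>i\<in>w. \<psi> ((x(j := t)) i)) = (\<Prod>i\<in>w. \<psi> (x i))"
          using wv by (intro prod.cong) auto
        ultimately show ?thesis unfolding weight_def by simp
      qed
      have wt2: "weight ?K (insert j w) (x(j := t)) = weight I w x * \<psi> t" for x t
      proof -
        have 1: "v \<inter> ?K - insert j w = v \<inter> I - w" using True w ju by auto
        have "(\<Prod>i\<in>insert j w. \<psi> ((x(j := t)) i)) = \<psi> t * (\<Prod>i\<in>w. \<psi> ((x(j := t)) i))"
          using wv by (subst prod.insert) auto
        also have "(\<Prod>i\<in>w. \<psi> ((x(j := t)) i)) = (\<Prod>i\<in>w. \<psi> (x i))"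
          using wv by (intro prod.cong) auto
        moreover have "(\<Prod>i\<in>v \<inter> I - w. \<omega> ((x(j := t)) i)) = (\<Prod>i\<in>v \<inter> I - w. \<omega> (x i))"
          using ju by (intro prod.cong) auto
        ultimately show ?thesis unfolding weight_def 1 by simp
      qed
      interpret L: sigma_finite_measure "lborel :: real measure" by standard
      have [measurable]: "marginal ?K w \<in> borel_measurable (leb ?K)" "marginal ?K (insert j w) \<in> borel_measurable (leb ?K)"
        using wv by (auto intro: marginal_measurable)
      have [measurable]: "weight ?K w \<in> borel_measurable (leb ?K)" "weight ?K (insert j w) \<in> borel_measurable (leb ?K)"
        using wK by (auto intro: weight_measurable)
      have [measurable]: "(\<lambda>(x, t). x(j := t)) \<in> measurable (leb I \<Otimes>\<^sub>M lborel) (leb ?K)"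
        by (auto intro!: measurable_fun_upd[where J=I] simp: split_beta')
      define A where "A w x = (\<integral>\<^sup>+t. ennreal (\<bar>marginal ?K w (x(j := t))\<bar> * weight ?K w (x(j := t))) \<partial>lborel)" for w x
      have [measurable]: "A w \<in> borel_measurable (leb I)" "A (insert j w) \<in> borel_measurable (leb I)"
        unfolding A_def[abs_def] by measurable
      have "(\<integral>\<^sup>+x. ennreal (\<bar>marginal I w x\<bar> * weight I w x) \<partial>leb I)
        \<le> (\<integral>\<^sup>+x. ennreal (c j) * (A w x + A (insert j w) x) \<partial>leb I)"
      proof (intro nn_integral_mono_AE)
        show "AE x in leb I. ennreal (\<bar>marginal I w x\<bar> * weight I w x) \<le> ennreal (c j) * (A w x + A (insert j w) x)"
          using AE_marginal_bound_twice[OF wv(1,3) ju(2)] AE_space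
        proof eventually_elim
          case (elim x)
          note secupd[OF wv(1) elim(2), measurable] secupd[OF wv(2) elim(2), measurable]
          let ?W = "weight I w x" let ?s1 = "\<lambda>t. \<bar>marginal ?K w (x(j := t))\<bar>" let ?s2 = "\<lambda>t. \<bar>marginal ?K (insert j w) (x(j := t))\<bar>"
          have "ennreal (\<bar>marginal I w x\<bar> * ?W) = ennreal \<bar>marginal I w x\<bar> * ennreal ?W"
            using weight_nonneg by (simp add: ennreal_mult)
          also have "\<dots> \<le> (ennreal (c j) * (\<integral>\<^sup>+t. ennreal (?s1 t * \<omega> t + ?s2 t * \<psi> t) \<partial>lborel)) * ennreal ?W"
            by (intro mult_right_mono elim) auto
          also have "\<dots> = ennreal (c j) * (\<integral>\<^sup>+t. ennreal (?s1 t * \<omega> t + ?s2 t * \<psi> t) * ennreal ?W \<partial>lborel)"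
            by (subst nn_integral_multc) (auto simp: mult.assoc)
          also have "(\<integral>\<^sup>+t. ennreal (?s1 t * \<omega> t + ?s2 t * \<psi> t) * ennreal ?W \<partial>lborel)
            = (\<integral>\<^sup>+t. ennreal (?s1 t * (?W * \<omega> t)) + ennreal (?s2 t * (?W * \<psi> t)) \<partial>lborel)"
          proof (rule nn_integral_cong)
            fix t
            have "ennreal (?s1 t * \<omega> t + ?s2 t * \<psi> t) * ennreal ?W = ennreal ((?s1 t * \<omega> t + ?s2 t * \<psi> t) * ?W)"
              using weight_nonneg weights_nonneg by (intro ennreal_mult[symmetric]) auto
            also have "(?s1 t * \<omega> t + ?s2 t * \<psi> t) * ?W = ?s1 t * (?W * \<omega> t) + ?s2 t * (?W * \<psi> t)" by (simp add: algebra_simps)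
            also have "ennreal \<dots> = ennreal (?s1 t * (?W * \<omega> t)) + ennreal (?s2 t * (?W * \<psi> t))"
              using weight_nonneg weights_nonneg by (intro ennreal_plus) auto
            finally show "ennreal (?s1 t * \<omega> t + ?s2 t * \<psi> t) * ennreal ?W = ennreal (?s1 t * (?W * \<omega> t)) + ennreal (?s2 t * (?W * \<psi> t))" .
          qed
          also have "\<dots> = A w x + A (insert j w) x"
            unfolding A_def wt1 wt2 by (rule nn_integral_add) auto
          finally show ?case .
        qed
      qed
      also have "\<dots> = ennreal (c j) * (T w + T (insert j w))"
        unfolding T[OF wK(1)] T[OF wK(2)] A_def[symmetric]
        by (simp add: nn_integral_cmult nn_integral_add)
      finally show ?thesis .
    qed
    then have "mixed_norm I \<le> (\<Sum>w\<in>Pow (v \<inter> I). ennreal (c j) * (T w + T (insert j w)))"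
      unfolding mixed_norm_def by (intro sum_mono) auto
    also have "\<dots> = ennreal (c j) * ((\<Sum>w\<in>Pow (v \<inter> I). T w) + (\<Sum>w\<in>Pow (v \<inter> I). T (insert j w)))"
      unfolding sum_distrib_left[symmetric] sum.distrib ..
    also have "(\<Sum>w\<in>Pow (v \<inter> I). T (insert j w)) = (\<Sum>w\<in>insert j ` Pow (v \<inter> I). T w)"
      using ju by (subst sum.reindex) (auto simp: inj_on_def)
    also have "(\<Sum>w\<in>Pow (v \<inter> I). T w) + (\<Sum>w\<in>insert j ` Pow (v \<inter> I). T w) = (\<Sum>w\<in>Pow (v \<inter> ?K). T w)"
      unfolding vK Pow_insert using ju by (subst sum.union_disjoint) auto
    finally show ?thesis unfolding mixed_norm_def T_def .
  qed
qed

lemma mixed_norm_le: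
  assumes "I \<subseteq> u"
  shows "mixed_norm {} \<le> ennreal (\<Prod>j\<in>I. c j) * mixed_norm I"
  using finite[of I] assms
proof (induction I rule: finite_induct)
  case empty then show ?case by simp
next
  case (insert j I)
  have "mixed_norm {} \<le> ennreal (\<Prod>j\<in>I. c j) * mixed_norm I" using insert by auto
  also have "\<dots> \<le> ennreal (\<Prod>j\<in>I. c j) * (ennreal (c j) * mixed_norm (insert j I))"
    using insert by (intro mult_left_mono mixed_norm_step) auto
  also have "\<dots> = ennreal ((\<Prod>j\<in>I. c j) * c j) * mixed_norm (insert j I)"
    using insert by (subst ennreal_mult) (auto simp: mult.assoc intro!: prod_nonneg less_imp_le[OF c_pos])
  also have "(\<Prod>j\<in>I. c j) * c j = (\<Prod>j\<in>insert j I. c j)" using insert by (simp add: mult.commute)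
  finally show ?case .
qed

lemma iterated_bound:
  "ennreal \<bar>\<integral>x. D {} x * (\<Prod>j\<in>u. \<kappa> j (x j)) \<partial>leb UNIV\<bar>
   \<le> ennreal (\<Prod>j\<in>u. c j) * (\<Sum>w\<in>Pow v. \<integral>\<^sup>+x. ennreal (\<bar>\<integral>z. D w (merge u (-u) (x, z)) \<partial>leb (-u)\<bar>
        * ((\<Prod>j\<in>w. \<psi> (x j)) * (\<Prod>j\<in>v - w. \<omega> (x j)))) \<partial>leb u)"
proof -
  have "merge {} UNIV (x, z) = z" for x z :: "'s \<Rightarrow> real" by (auto simp: merge_def)
  then have "mixed_norm {} = ennreal \<bar>\<integral>x. D {} x * (\<Prod>j\<in>u. \<kappa> j (x j)) \<partial>leb UNIV\<bar>"
    unfolding mixed_norm_def by (simp add: marginal_def weight_def PiM_empty)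
  moreover have "v \<inter> u = v" using vu by auto
  then have "mixed_norm u = (\<Sum>w\<in>Pow v. \<integral>\<^sup>+x. ennreal (\<bar>\<integral>z. D w (merge u (-u) (x, z)) \<partial>leb (-u)\<bar>
        * ((\<Prod>j\<in>w. \<psi> (x j)) * (\<Prod>j\<in>v - w. \<omega> (x j)))) \<partial>leb u)"
    unfolding mixed_norm_def marginal_def weight_def by simp
  ultimately show ?thesis using mixed_norm_le[OF order_refl] by simp
qed

end

section \<open>Integration by parts in several variables\<close>

lemma measurable_vec_lambda [measurable]:
  "vec_lambda \<in> measurable (leb UNIV) (borel :: (real ^ 's) measure)"
proof (subst borel_measurable_euclidean_space, intro ballI)
  fix b :: "real ^ 's" assume "b \<in> Basis"
  then obtain i where b: "b = axis i 1" by (auto simp: Basis_vec_def)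
  have "(\<lambda>x :: 's \<Rightarrow> real. x i) \<in> borel_measurable (leb UNIV)"
    by measurable
  then show "(\<lambda>x. vec_lambda x \<bullet> b) \<in> borel_measurable (leb UNIV)"
    by (simp add: b inner_axis)
qed

text \<open>Lebesgue measure on \<open>\<real>\<^sup>s\<close> as a product measure, which makes Fubini's theorem available for arbitrary
sets of coordinates.\<close>

lemma distr_vec_lambda:
  "distr (leb UNIV) borel vec_lambda = (lborel :: (real ^ 's) measure)"
proof (rule lborel_eqI[symmetric])
  fix l h :: "real ^ 's"
  assume le: "\<And>b. b \<in> Basis \<Longrightarrow> l \<bullet> b \<le> h \<bullet> b"
  have lei: "l $ i \<le> h $ i" for i
    using le[of "axis i 1"] by (simp add: inner_axis axis_in_Basis_iff)
  have "vec_lambda -` box l h \<inter> space (leb UNIV) = PiE UNIV (\<lambda>i. {l $ i <..< h $ i})"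
    by (auto simp: space_PiM PiE_def Pi_iff mem_box_cart)
  then have "emeasure (distr (leb UNIV) borel vec_lambda) (box l h)
    = (\<Prod>i\<in>UNIV. emeasure lborel {l $ i <..< h $ i})"
    by (simp add: emeasure_distr lebesgue_product.emeasure_PiM)
  also have "\<dots> = (\<Prod>i\<in>UNIV. ennreal (h $ i - l $ i))" using lei by simp
  also have "\<dots> = ennreal (\<Prod>i\<in>UNIV. h $ i - l $ i)" using lei by (intro prod_ennreal) auto
  also have "(\<Prod>i\<in>UNIV. h $ i - l $ i) = (\<Prod>b\<in>Basis. (h - l) \<bullet> b)"
  proof -
    have "(\<Prod>b\<in>Basis. (h - l) \<bullet> b) = (\<Prod>b\<in>range (\<lambda>i. axis i (1::real)). (h - l) \<bullet> b)"
      by (rule prod.cong) (auto simp: Basis_vec_def)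
    also have "\<dots> = (\<Prod>i\<in>UNIV. (h - l) \<bullet> axis i 1)"
      by (subst prod.reindex) (auto simp: inj_on_def axis_eq_axis)
    finally show ?thesis by (simp add: inner_axis)
  qed
  finally show "emeasure (distr (leb UNIV) borel vec_lambda) (box l h)
    = ennreal (\<Prod>b\<in>Basis. (h - l) \<bullet> b)" .
qed simp

lemma integral_vec_lambda:
  fixes f :: "real ^ 's::finite \<Rightarrow> real"
  assumes "f \<in> borel_measurable borel"
  shows "(LBINT x. f x) = (\<integral>x. f (vec_lambda x) \<partial>leb UNIV)"
  unfolding distr_vec_lambda[symmetric] by (rule integral_distr) (use assms in auto)

lemma integrable_vec_lambda:
  fixes f :: "real ^ 's::finite \<Rightarrow> real"
  assumes "integrable lborel f"
  shows "integrable (leb UNIV) (\<lambda>x. f (vec_lambda x))"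
  using assms unfolding distr_vec_lambda[symmetric] by (rule integrable_distr[rotated]) simp

text \<open>The kernels built from Walsh functions are differentiable only off a finite set.\<close>

lemma parts_compact_support:
  fixes h h' k k' :: "real \<Rightarrow> real"
  assumes h: "\<And>t. (h has_real_derivative h' t) (at t)" and h': "continuous_on UNIV h'"
    and k: "continuous_on UNIV k" and S: "finite S" and dk: "\<And>t. t \<notin> S \<Longrightarrow> (k has_real_derivative k' t) (at t)"
    and supp: "\<And>t. r \<le> \<bar>t\<bar> \<Longrightarrow> k t = 0" "\<And>t. r \<le> \<bar>t\<bar> \<Longrightarrow> k' t = 0"
    and k'[measurable]: "k' \<in> borel_measurable borel" and B: "\<And>t. \<bar>k' t\<bar> \<le> B"
  shows "(LBINT t. h' t * k t) = - (LBINT t. h t * k' t)"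
proof -
  define s where "s = \<bar>r\<bar>"
  have out: "k t = 0" "k' t = 0" if "t \<notin> {-s<..<s}" for t
    using supp[of t] that by (auto simp: s_def)
  have out': "k t = 0" "k' t = 0" if "t \<notin> {-s..s}" for t
    using that out[of t] by auto
  have ks: "k s = 0" "k (-s) = 0" using out by auto
  have contin: "continuous_on UNIV h"
    using h DERIV_isCont continuous_at_imp_continuous_on by blast
  have A: "((\<lambda>t. h' t * k t + h t * k' t) has_integral (h s * k s - h (-s) * k (-s))) {-s..s}"
  proof (rule fundamental_theorem_of_calculus_interior_strong[OF S])
    show "-s \<le> s" by (simp add: s_def)
    show "continuous_on {-s..s} (\<lambda>t. h t * k t)"
      using contin k by (intro continuous_intros) (auto intro: continuous_on_subset)
    fix t assume "t \<in> {-s<..<s} - S"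
    then have "((\<lambda>t. h t * k t) has_real_derivative (h' t * k t + k' t * h t)) (at t)"
      by (intro DERIV_mult h dk) auto
    then show "((\<lambda>t. h t * k t) has_vector_derivative (h' t * k t + h t * k' t)) (at t)"
      by (simp add: has_real_derivative_iff_has_vector_derivative mult.commute)
  qed
  have i1: "set_integrable lborel {-s..s} (\<lambda>t. h' t * k t)"
    using h' k by (intro borel_integrable_atLeastAtMost' continuous_intros) (auto intro: continuous_on_subset)
  have ih: "integrable lborel (\<lambda>t. indicator {-s..s} t *\<^sub>R h t)"
    unfolding set_integrable_def[symmetric]
    using contin by (intro borel_integrable_atLeastAtMost') (auto intro: continuous_on_subset)
  have [measurable]: "h \<in> borel_measurable borel" using contin by (rule borel_measurable_continuous_onI)
  have i2: "set_integrable lborel {-s..s} (\<lambda>t. h t * k' t)"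
    unfolding set_integrable_def
  proof (rule Bochner_Integration.integrable_bound[OF integrable_mult_right[OF ih, of B]])
    have "\<bar>h t * k' t\<bar> \<le> \<bar>B * h t\<bar>" for t
    proof -
      have "\<bar>k' t\<bar> \<le> \<bar>B\<bar>" using B[of t] by linarith
      then show ?thesis
        using mult_left_mono[of "\<bar>k' t\<bar>" "\<bar>B\<bar>" "\<bar>h t\<bar>"] by (simp add: abs_mult mult.commute)
    qed
    then show "AE x in lborel. norm (indicator {-s..s} x *\<^sub>R (h x * k' x)) \<le> norm (B * (indicator {-s..s} x *\<^sub>R h x))"
      by (intro AE_I2) (auto simp: indicator_def)
  qed measurable
  have e1: "(\<lambda>t. indicator {-s..s} t *\<^sub>R (h' t * k t)) = (\<lambda>t. h' t * k t)"
   and e2: "(\<lambda>t. indicator {-s..s} t *\<^sub>R (h t * k' t)) = (\<lambda>t. h t * k' t)"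
    using out' by (auto simp: fun_eq_iff indicator_def)
  have "((\<lambda>t. h' t * k t + h t * k' t) has_integral ((LBINT t:{-s..s}. h' t * k t) + (LBINT t:{-s..s}. h t * k' t))) {-s..s}"
    using set_borel_integral_eq_integral[OF i1] set_borel_integral_eq_integral[OF i2]
    by (intro has_integral_add) (simp_all add: has_integral_integral)
  from has_integral_unique[OF this A] have "(LBINT t:{-s..s}. h' t * k t) + (LBINT t:{-s..s}. h t * k' t) = 0"
    using ks by simp
  then show ?thesis unfolding set_lebesgue_integral_def e1 e2 by simp
qed

lemma integrable_bounded_box:
  fixes f :: "('s::finite \<Rightarrow> real) \<Rightarrow> real"
  assumes [measurable]: "f \<in> borel_measurable (leb UNIV)"
    and B: "\<And>x. (\<And>i. \<bar>x i\<bar> \<le> r) \<Longrightarrow> \<bar>f x\<bar> \<le> B" and out: "\<And>x i. \<bar>x i\<bar> > r \<Longrightarrow> f x = 0"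
  shows "integrable (leb UNIV) f"
proof -
  let ?A = "PiE UNIV (\<lambda>_::'s. {-r..r})"
  have A: "?A \<in> sets (leb UNIV)" by (intro sets_PiM_I_finite) auto
  have "emeasure (leb UNIV) ?A = (\<Prod>i\<in>(UNIV::'s set). emeasure lborel {-r..r})"
    by (rule lebesgue_product.emeasure_PiM) auto
  also have "\<dots> < \<infinity>" by (simp add: emeasure_lborel_Icc_eq power_less_top_ennreal)
  finally have "integrable (leb UNIV) (\<lambda>x. B * indicator ?A x)"
    using A by (intro integrable_mult_right integrable_real_indicator)
  then show ?thesis
  proof (rule Bochner_Integration.integrable_bound)
    show "AE x in leb UNIV. norm (f x) \<le> norm (B * indicator ?A x)"
    proof (rule AE_I2)
      fix x :: "'s \<Rightarrow> real"
      show "norm (f x) \<le> norm (B * indicator ?A x)"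
      proof (cases "\<forall>i. \<bar>x i\<bar> \<le> r")
        case True
        then have "x \<in> ?A" by (auto simp: PiE_def abs_le_iff minus_le_iff)
        then have "norm (B * indicator ?A x) = \<bar>B\<bar>" by simp
        moreover have "\<bar>f x\<bar> \<le> B" using True B by blast
        ultimately show ?thesis by (metis abs_ge_self order_trans real_norm_def)
      next
        case False
        then obtain i where "\<bar>x i\<bar> > r" by (auto simp: not_le)
        then have "f x = 0" by (rule out)
        then show ?thesis by (simp only: norm_zero norm_ge_zero)
      qed
    qed
  qed simp
qed

lemma continuous_bounded_box:
  fixes H :: "real ^ 's::finite \<Rightarrow> real"
  assumes "continuous_on UNIV H"
  obtains B where "\<And>x. (\<And>i. \<bar>x i\<bar> \<le> r) \<Longrightarrow> \<bar>H (vec_lambda x)\<bar> \<le> B"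
proof -
  let ?C = "cbox (\<chi> i. -r) (\<chi> i. r) :: (real ^ 's) set"
  have "bounded (H ` ?C)"
    using assms by (intro compact_imp_bounded compact_continuous_image compact_cbox) (auto intro: continuous_on_subset)
  then obtain B where B: "\<forall>y\<in>H ` ?C. norm y \<le> B" unfolding bounded_iff by blast
  have "\<bar>H (vec_lambda x)\<bar> \<le> B" if x: "\<And>i. \<bar>x i\<bar> \<le> r" for x
  proof -
    have "-r \<le> x i \<and> x i \<le> r" for i using x[of i] by linarith
    then have "vec_lambda x \<in> ?C" by (simp add: mem_box_cart)
    then show ?thesis using B by auto
  qed
  then show ?thesis by (rule that)
qed

lemma vec_lambda_fun_upd: "vec_lambda (x(j := t)) = vec_lambda (x(j := 0)) + t *\<^sub>R axis j (1::real)"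
  by (vector axis_def)

lemma integrable_continuous_times_kernels:
  fixes H :: "real ^ 's::finite \<Rightarrow> real" and b :: "'s \<Rightarrow> real \<Rightarrow> real"
  assumes H: "continuous_on UNIV H" and b: "\<And>i. b i \<in> borel_measurable borel"
    "\<And>i t. \<bar>b i t\<bar> \<le> B" "\<And>i t. r < \<bar>t\<bar> \<Longrightarrow> b i t = 0"
  shows "integrable (leb UNIV) (\<lambda>x. H (vec_lambda x) * (\<Prod>i\<in>UNIV. b i (x i)))"
proof -
  obtain M where M: "\<And>x. (\<And>i. \<bar>x i\<bar> \<le> r) \<Longrightarrow> \<bar>H (vec_lambda x)\<bar> \<le> M"
    using continuous_bounded_box[OF H] by blast
  have [measurable]: "H \<in> borel_measurable borel" using H by (rule borel_measurable_continuous_onI)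
  note b(1)[measurable]
  have B0: "0 \<le> B" using b(2)[of undefined 0] by linarith
  show ?thesis
  proof (rule integrable_bounded_box)
    show "(\<lambda>x. H (vec_lambda x) * (\<Prod>i\<in>UNIV. b i (x i))) \<in> borel_measurable (leb UNIV)"
      by measurable
    fix x :: "'s \<Rightarrow> real"
    show "\<bar>H (vec_lambda x) * (\<Prod>i\<in>UNIV. b i (x i))\<bar> \<le> M * B ^ CARD('s)" if "\<And>i. \<bar>x i\<bar> \<le> r"
    proof -
      have 1: "\<bar>\<Prod>i\<in>UNIV. b i (x i)\<bar> \<le> B ^ CARD('s)"
        unfolding abs_prod prod_constant[symmetric] by (intro prod_mono) (auto simp: b)
      have 2: "\<bar>H (vec_lambda x)\<bar> \<le> M" using M that by blast
      show ?thesis unfolding abs_mult by (rule mult_mono[OF 2 1]) (use 2 in linarith, simp)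
    qed
    show "H (vec_lambda x) * (\<Prod>i\<in>UNIV. b i (x i)) = 0" if "r < \<bar>x i\<bar>" for i
    proof -
      have "(\<Prod>i\<in>UNIV. b i (x i)) = 0" using b(3)[OF that] by (intro prod_zero) auto
      then show ?thesis by simp
    qed
  qed
qed

text \<open>All integrands have compact support here, so the derivatives can be moved to the kernels one at a time,
beginning with the one that was taken last.\<close>

lemma partials_by_parts:
  fixes F :: "real ^ 's::finite \<Rightarrow> real" and b k :: "'s \<Rightarrow> real \<Rightarrow> real"
  assumes F: "sufficiently_smooth F"
    and b: "\<And>i. b i \<in> borel_measurable borel" "\<And>i t. \<bar>b i t\<bar> \<le> B" "\<And>i t. r \<le> \<bar>t\<bar> \<Longrightarrow> i \<in> u \<Longrightarrow> b i t = 0" "\<And>i t. r < \<bar>t\<bar> \<Longrightarrow> b i t = 0"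
    and k: "\<And>i. i \<in> u \<Longrightarrow> continuous_on UNIV (k i)" "\<And>i t. i \<in> u \<Longrightarrow> \<bar>k i t\<bar> \<le> B" "\<And>i t. i \<in> u \<Longrightarrow> r \<le> \<bar>t\<bar> \<Longrightarrow> k i t = 0"
    and dk: "\<And>i. i \<in> u \<Longrightarrow> finite (S i)" "\<And>i t. i \<in> u \<Longrightarrow> t \<notin> S i \<Longrightarrow> (k i has_real_derivative b i t) (at t)"
  shows "distinct js \<Longrightarrow> set js \<subseteq> u \<Longrightarrow>
    (\<integral>x. partials js F (vec_lambda x) * (\<Prod>i\<in>UNIV. (if i \<in> set js then k i else b i) (x i)) \<partial>leb UNIV)
     = (-1) ^ length js * (\<integral>x. F (vec_lambda x) * (\<Prod>i\<in>UNIV. b i (x i)) \<partial>leb UNIV)"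
proof (induction js)
  case Nil then show ?case by simp
next
  case (Cons j js)
  have j: "j \<in> u" "j \<notin> set js" "distinct js" "set js \<subseteq> u" using Cons.prems by auto
  define c where "c i = (if i \<in> set js then k i else b i)" for i
  define d where "d i = (if i \<in> set (j # js) then k i else b i)" for i
  have cd: "c i = d i" if "i \<noteq> j" for i using that by (auto simp: c_def d_def)
  have cj: "c j = b j" "d j = k j" using j by (auto simp: c_def d_def)
  let ?H = "partials js F" and ?H' = "partials (j # js) F"
  have so: "smooth_order (j # js)" unfolding smooth_order_def
  proof
    fix i show "count (mset (j # js)) i \<le> 2"
      using distinct_count_atmost_1[of "j # js"] Cons.prems(1) by (auto split: if_splits)
  qed
  note so' = smooth_order_Cons[OF so]
  have ex: "partial_exists j ?H" using sufficiently_smoothD(1)[OF F so] by simp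
  have cH: "continuous_on UNIV ?H" "continuous_on UNIV ?H'"
    using sufficiently_smoothD(2)[OF F so'] sufficiently_smoothD(2)[OF F so] .
  have mk: "k i \<in> borel_measurable borel" if "i \<in> u" for i using k(1)[OF that] by (rule borel_measurable_continuous_onI)
  have mc: "c i \<in> borel_measurable borel" "d i \<in> borel_measurable borel" for i
    using b(1) mk j by (auto simp: c_def d_def subset_iff)
  have bc: "\<bar>c i t\<bar> \<le> B" "\<bar>d i t\<bar> \<le> B" for i t
    using b(2) k(2) j by (auto simp: c_def d_def subset_iff)
  have sc: "c i t = 0" "d i t = 0" if "r < \<bar>t\<bar>" for i t
    using b(4) k(3) j that by (auto simp: c_def d_def subset_iff)
  have I1: "integrable (leb UNIV) (\<lambda>x. ?H (vec_lambda x) * (\<Prod>i\<in>UNIV. c i (x i)))"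
    by (rule integrable_continuous_times_kernels[OF cH(1) mc(1) bc(1) sc(1)])
  have I2: "integrable (leb UNIV) (\<lambda>x. ?H' (vec_lambda x) * (\<Prod>i\<in>UNIV. d i (x i)))"
    by (rule integrable_continuous_times_kernels[OF cH(2) mc(2) bc(2) sc(2)])
  let ?J = "- {j}"
  have U: "insert j ?J = UNIV" by auto
  have fub: "(\<integral>x. f x \<partial>leb UNIV) = (\<integral>x. (LBINT t. f (x(j := t))) \<partial>leb ?J)"
    if "integrable (leb UNIV) f" for f :: "('s \<Rightarrow> real) \<Rightarrow> real"
    using lebesgue_product.product_integral_insert[of ?J j f] that unfolding U by simp
  define A where "A x = (\<Prod>i\<in>?J. d i (x i))" for x :: "'s \<Rightarrow> real"
  have prodc: "(\<Prod>i\<in>UNIV. c i ((x(j := t)) i)) = b j t * A x" for x t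
  proof -
    have "(\<Prod>i\<in>UNIV. c i ((x(j := t)) i)) = c j t * (\<Prod>i\<in>?J. c i ((x(j := t)) i))"
      unfolding U[symmetric] by (subst prod.insert) auto
    also have "(\<Prod>i\<in>?J. c i ((x(j := t)) i)) = A x" unfolding A_def by (intro prod.cong) (auto simp: cd)
    finally show ?thesis by (simp add: cj)
  qed
  have prodd: "(\<Prod>i\<in>UNIV. d i ((x(j := t)) i)) = k j t * A x" for x t
  proof -
    have "(\<Prod>i\<in>UNIV. d i ((x(j := t)) i)) = d j t * (\<Prod>i\<in>?J. d i ((x(j := t)) i))"
      unfolding U[symmetric] by (subst prod.insert) auto
    also have "(\<Prod>i\<in>?J. d i ((x(j := t)) i)) = A x" unfolding A_def by (intro prod.cong) auto
    finally show ?thesis by (simp add: cj)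
  qed
  have inner: "(LBINT t. ?H' (vec_lambda (x(j := t))) * k j t) = - (LBINT t. ?H (vec_lambda (x(j := t))) * b j t)" for x
  proof (rule parts_compact_support[where S = "S j" and r = r and B = B])
    define y where "y = vec_lambda (x(j := 0))"
    have v: "vec_lambda (x(j := t)) = y + t *\<^sub>R axis j 1" for t
      unfolding y_def by (rule vec_lambda_fun_upd)
    show "((\<lambda>t. ?H (vec_lambda (x(j := t)))) has_real_derivative ?H' (vec_lambda (x(j := t)))) (at t)" for t
      unfolding v partials.simps by (rule partial_has_derivative[OF ex])
    show "continuous_on UNIV (\<lambda>t. ?H' (vec_lambda (x(j := t))))"
      unfolding v by (intro continuous_on_compose2[OF cH(2)] continuous_intros) auto
  qed (use j b k dk in auto)
  have "(\<integral>x. ?H' (vec_lambda x) * (\<Prod>i\<in>UNIV. d i (x i)) \<partial>leb UNIV)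
    = (\<integral>x. (LBINT t. ?H' (vec_lambda (x(j := t))) * (\<Prod>i\<in>UNIV. d i ((x(j := t)) i))) \<partial>leb ?J)"
    by (rule fub[OF I2])
  also have "\<dots> = (\<integral>x. (LBINT t. (?H' (vec_lambda (x(j := t))) * k j t) * A x) \<partial>leb ?J)"
    unfolding prodd by (simp only: mult.assoc)
  also have "\<dots> = (\<integral>x. - (LBINT t. ?H (vec_lambda (x(j := t))) * b j t) * A x \<partial>leb ?J)"
    by (simp only: integral_mult_left_zero inner)
  also have "\<dots> = - (\<integral>x. (LBINT t. (?H (vec_lambda (x(j := t))) * b j t) * A x) \<partial>leb ?J)"
    by (simp only: integral_mult_left_zero mult_minus_left Bochner_Integration.integral_minus)
  also have "\<dots> = - (\<integral>x. (LBINT t. ?H (vec_lambda (x(j := t))) * (\<Prod>i\<in>UNIV. c i ((x(j := t)) i))) \<partial>leb ?J)"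
    unfolding prodc by (simp only: mult.assoc)
  also have "\<dots> = - (\<integral>x. ?H (vec_lambda x) * (\<Prod>i\<in>UNIV. c i (x i)) \<partial>leb UNIV)"
    by (simp only: fub[OF I1])
  also have "\<dots> = (-1) ^ length (j # js) * (\<integral>x. F (vec_lambda x) * (\<Prod>i\<in>UNIV. b i (x i)) \<partial>leb UNIV)"
    unfolding c_def using Cons.IH[OF j(3,4)] by simp
  finally show ?case unfolding d_def .
qed

section \<open>The estimate for compactly supported kernels\<close>

lemma prob_density_continuous: "prob_density \<phi> \<Longrightarrow> continuous_on UNIV \<phi>"
  unfolding prob_density_def
  by (auto intro!: continuous_at_imp_continuous_on differentiable_imp_continuous_within)

lemma prob_density_measurable: "prob_density \<phi> \<Longrightarrow> \<phi> \<in> borel_measurable borel"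
  using prob_density_continuous by (rule borel_measurable_continuous_onI)

text \<open>\<open>\<bar>F\<bar> \<le> F\<^sup>2 + 1\<close>, and the density has total mass 1.\<close>

lemma in_L2_integrable:
  fixes F :: "real ^ 's::finite \<Rightarrow> real"
  assumes \<phi>: "prob_density \<phi>" and F: "in_L2 \<phi> F"
  shows "integrable (leb UNIV) (\<lambda>x. F (vec_lambda x) * (\<Prod>j\<in>UNIV. \<phi> (x j)))"
proof -
  have [measurable]: "F \<in> borel_measurable borel" "\<phi> \<in> borel_measurable borel"
    using F prob_density_measurable[OF \<phi>] by (auto simp: in_L2_def)
  have pos: "0 \<le> (\<Prod>j\<in>UNIV. \<phi> (x j))" for x :: "'s \<Rightarrow> real"
    using \<phi> by (intro prod_nonneg) (auto simp: prob_density_def less_imp_le)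
  have 1: "integrable (leb UNIV) (\<lambda>x. (F (vec_lambda x))\<^sup>2 * (\<Prod>j\<in>UNIV. \<phi> (x j)))"
    using F integrable_vec_lambda[of "\<lambda>x. (F x)\<^sup>2 * (\<Prod>j\<in>UNIV. \<phi> (x $ j))"] by (simp add: in_L2_def)
  have 2: "integrable (leb UNIV) (\<lambda>x::'s \<Rightarrow> real. (\<Prod>j\<in>UNIV. \<phi> (x j)))"
    using \<phi> by (intro lebesgue_product.product_integrable_prod) (auto simp: prob_density_def)
  show ?thesis
  proof (rule Bochner_Integration.integrable_bound[OF Bochner_Integration.integrable_add[OF 1 2]])
    show "AE x in leb UNIV. norm (F (vec_lambda x) * (\<Prod>j\<in>UNIV. \<phi> (x j)))
      \<le> norm ((F (vec_lambda x))\<^sup>2 * (\<Prod>j\<in>UNIV. \<phi> (x j)) + (\<Prod>j\<in>UNIV. \<phi> (x j)))"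
    proof (rule AE_I2)
      fix x :: "'s \<Rightarrow> real"
      let ?p = "\<Prod>j\<in>UNIV. \<phi> (x j)" and ?f = "F (vec_lambda x)"
      have "\<bar>?f\<bar> \<le> ?f\<^sup>2 + 1"
        using zero_le_power2[of "\<bar>?f\<bar> - 1"] by (simp add: power2_diff)
      then have "\<bar>?f\<bar> * ?p \<le> (?f\<^sup>2 + 1) * ?p" using pos by (rule mult_right_mono)
      also have "\<dots> = norm (?f\<^sup>2 * ?p + ?p)" using pos[of x] by (simp add: distrib_right)
      finally show "norm (?f * ?p) \<le> norm (?f\<^sup>2 * ?p + ?p)" using pos[of x] by (simp add: abs_mult)
    qed
  qed measurable
qed

lemma prod_split:
  fixes f :: "'s::finite \<Rightarrow> real"
  shows "(\<Prod>i\<in>UNIV. f i) = (\<Prod>i\<in>u. f i) * (\<Prod>i\<in>-u. f i)"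
  using prod.union_disjoint[of u "-u" f] by simp

text \<open>The functions \<open>b j\<close> are the derivatives of the kernels \<open>\<kappa> j\<close>. The first integration by parts in each coordinate
of \<open>u\<close> is \<open>partials_by_parts\<close> on growing boxes in the remaining coordinates; all further ones are
\<open>iterated_bound\<close>.\<close>

lemma kernel_bound:
  fixes F :: "real ^ 's::finite \<Rightarrow> real" and \<kappa> b G R :: "'s \<Rightarrow> real \<Rightarrow> real" and S :: "'s \<Rightarrow> real set"
  assumes \<phi>: "prob_density \<phi>" and \<psi>: "weight_function \<psi>" and \<omega>: "weight_function \<omega>"
    and L2: "in_L2 \<phi> F" and F: "sufficiently_smooth F" and vu: "v \<subseteq> u"
    and conv: "inner_integrals_converge \<phi> F u v"
    and \<kappa>: "\<And>j. j \<in> u \<Longrightarrow> continuous_on UNIV (\<kappa> j)"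
    and supp: "\<And>j t. j \<in> u \<Longrightarrow> r \<le> \<bar>t\<bar> \<Longrightarrow> \<kappa> j t = 0" "\<And>j t. j \<in> u \<Longrightarrow> r \<le> \<bar>t\<bar> \<Longrightarrow> b j t = 0"
    and b: "\<And>j. j \<in> u \<Longrightarrow> b j \<in> borel_measurable borel" "\<And>j t. j \<in> u \<Longrightarrow> \<bar>b j t\<bar> \<le> B * \<phi> t"
    and d: "\<And>j. j \<in> u \<Longrightarrow> finite (S j)" "\<And>j t. j \<in> u \<Longrightarrow> t \<notin> S j \<Longrightarrow> (\<kappa> j has_real_derivative b j t) (at t)"
    and c: "\<And>j. j \<in> u \<Longrightarrow> 0 < c j" and c\<kappa>: "\<And>j t. j \<in> u - v \<Longrightarrow> \<bar>\<kappa> j t\<bar> \<le> c j"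
    and G: "\<And>j t. j \<in> v \<Longrightarrow> (G j has_real_derivative (\<kappa> j t - R j t)) (at t)"
    and GR: "\<And>j t. j \<in> v \<Longrightarrow> r \<le> \<bar>t\<bar> \<Longrightarrow> G j t = 0" "\<And>j t. j \<in> v \<Longrightarrow> r \<le> \<bar>t\<bar> \<Longrightarrow> R j t = 0"
    and mR: "\<And>j. j \<in> v \<Longrightarrow> R j \<in> borel_measurable borel"
    and bds: "\<And>j t. j \<in> v \<Longrightarrow> \<bar>G j t\<bar> \<le> c j * \<psi> t" "\<And>j t. j \<in> v \<Longrightarrow> \<bar>R j t\<bar> \<le> c j * \<omega> t"
  shows "ennreal \<bar>\<integral>x. F (vec_lambda x) * ((\<Prod>j\<in>u. b j (x j)) * (\<Prod>j\<in>-u. \<phi> (x j))) \<partial>leb UNIV\<bar>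
    \<le> ennreal (\<Prod>j\<in>u. c j) * norm_uv \<phi> \<psi> \<omega> F u v"
proof -
  define L where "L = leb (UNIV :: 's set)"
  define D where "D w x = mixed_partial F u w (vec_lambda x) * (\<Prod>j\<in>-u. \<phi> (x j))" for w x
  have contmp: "continuous_on UNIV (mixed_partial F u w)" if "w \<subseteq> v" for w
    using mixed_partial_continuous[OF F] that vu by auto
  have [measurable]: "\<phi> \<in> borel_measurable borel" by (rule prob_density_measurable[OF \<phi>])
  have [measurable]: "F \<in> borel_measurable borel" using L2 by (simp add: in_L2_def)
  have pos: "0 < \<phi> t" for t using \<phi> by (simp add: prob_density_def)
  have prod_upd: "(\<Prod>i\<in>-u. \<phi> ((x(j := t)) i)) = (\<Prod>i\<in>-u. \<phi> (x i))" if "j \<in> u" for x j t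
    using that by (intro prod.cong) auto
  interpret kernel_family u v D \<kappa> G R r c \<psi> \<omega>
  proof
    show "v \<subseteq> u" by fact
  next
    fix w assume w: "w \<subseteq> v"
    have [measurable]: "mixed_partial F u w \<in> borel_measurable borel"
      using contmp[OF w] by (rule borel_measurable_continuous_onI)
    show "D w \<in> borel_measurable (leb UNIV)" unfolding D_def[abs_def] by measurable
    fix n :: nat
    have "integrable lborel (\<lambda>x. indicator {x. \<forall>j\<in>u. \<bar>x $ j\<bar> \<le> real n} x *\<^sub>R (mixed_partial F u w x * (\<Prod>j\<in>- u. \<phi> (x $ j))))"
      using conv w unfolding inner_integrals_converge_def set_integrable_def by blast
    from integrable_vec_lambda[OF this]
    have "integrable (leb UNIV) (\<lambda>x. indicator {x. \<forall>j\<in>u. \<bar>x $ j\<bar> \<le> real n} (vec_lambda x) *\<^sub>R D w x)"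
      unfolding D_def by simp
    moreover have "indicator {x. \<forall>j\<in>u. \<bar>x $ j\<bar> \<le> real n} (vec_lambda x) = (\<Prod>i\<in>u. indicator {-real n..real n} (x i) :: real)" for x
    proof (cases "\<forall>j\<in>u. \<bar>x j\<bar> \<le> real n")
      case True
      then have "(\<Prod>i\<in>u. indicator {-real n..real n} (x i) :: real) = 1"
        by (intro prod.neutral) (auto simp: indicator_def abs_le_iff minus_le_iff)
      with True show ?thesis by simp
    next
      case False
      then obtain j where j: "j \<in> u" "x j \<notin> {-real n..real n}" by (auto simp: abs_le_iff minus_le_iff)
      then have "(\<Prod>i\<in>u. indicator {-real n..real n} (x i) :: real) = 0"
        by (intro prod_zero bexI[of _ j]) auto
      moreover have "vec_lambda x \<notin> {x. \<forall>j\<in>u. \<bar>x $ j\<bar> \<le> real n}" using False by auto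
      ultimately show ?thesis by simp
    qed
    ultimately show "integrable (leb UNIV) (\<lambda>x. (\<Prod>i\<in>u. indicator {-real n..real n} (x i)) * D w x)"
      by simp
  next
    fix w j x and t :: real assume w: "w \<subseteq> v" "j \<in> v - w"
    define y where "y = vec_lambda (x(j := 0 :: real))"
    have y: "vec_lambda (x(j := t)) = y + t *\<^sub>R axis j 1" for t
      unfolding y_def by (rule vec_lambda_fun_upd)
    have j: "j \<in> u" "j \<notin> w" "w \<subseteq> u" using w vu by auto
    show "((\<lambda>t. D w (x(j := t))) has_real_derivative D (insert j w) (x(j := t))) (at t)"
      unfolding D_def prod_upd[OF j(1)] y by (intro DERIV_cmult_right mixed_partial_step F j)
  next
    fix w j x assume w: "w \<subseteq> v" "j \<in> u"
    define y where "y = vec_lambda (x(j := 0 :: real))"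
    have y: "vec_lambda (x(j := t)) = y + t *\<^sub>R axis j 1" for t
      unfolding y_def by (rule vec_lambda_fun_upd)
    show "continuous_on UNIV (\<lambda>t. D w (x(j := t)))"
      unfolding D_def prod_upd[OF w(2)] y
      by (intro continuous_on_mult continuous_on_const continuous_on_compose2[OF contmp[OF w(1)]] continuous_intros) auto
  qed (use \<kappa> supp c c\<kappa> G GR mR bds \<psi> \<omega> in \<open>auto simp: weight_function_def less_imp_le\<close>)
  have norm: "norm_uv \<phi> \<psi> \<omega> F u v = (\<Sum>w\<in>Pow v. \<integral>\<^sup>+x. ennreal (\<bar>\<integral>z. D w (merge u (-u) (x, z)) \<partial>leb (-u)\<bar>
        * ((\<Prod>j\<in>w. \<psi> (x j)) * (\<Prod>j\<in>v - w. \<omega> (x j)))) \<partial>leb u)"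
  proof -
    have "D w (merge u (-u) (x, z)) = mixed_partial F u w (glue u x z) * (\<Prod>j\<in>-u. \<phi> (z j))" for w x z
    proof -
      have "vec_lambda (merge u (-u) (x, z)) = glue u x z" by (simp add: glue_def merge_def vec_eq_iff)
      moreover have "(\<Prod>j\<in>-u. \<phi> (merge u (-u) (x, z) j)) = (\<Prod>j\<in>-u. \<phi> (z j))" by (intro prod.cong) auto
      ultimately show ?thesis unfolding D_def by simp
    qed
    then show ?thesis unfolding norm_uv_def inner_integral_def by (simp only: mult.assoc)
  qed
  let ?f = "\<lambda>x. F (vec_lambda x) * ((\<Prod>j\<in>u. b j (x j)) * (\<Prod>j\<in>-u. \<phi> (x j)))"
  let ?g = "\<lambda>x. D {} x * (\<Prod>j\<in>u. \<kappa> j (x j))"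
  have mb: "(\<lambda>x. \<Prod>j\<in>u. b j (x j)) \<in> borel_measurable L" unfolding L_def
    using b(1) by (intro borel_measurable_prod measurable_compose[OF measurable_component_singleton]) auto
  have m\<phi>: "(\<lambda>x. \<Prod>j\<in>-u. \<phi> (x j)) \<in> borel_measurable L" unfolding L_def by measurable
  have mF: "(\<lambda>x. F (vec_lambda x)) \<in> borel_measurable L" unfolding L_def by measurable
  have intf: "integrable L ?f"
  proof (rule Bochner_Integration.integrable_bound)
    show "integrable L (\<lambda>x. B ^ card u * (F (vec_lambda x) * (\<Prod>j\<in>UNIV. \<phi> (x j))))"
      unfolding L_def by (intro integrable_mult_right in_L2_integrable[OF \<phi> L2])
    show "?f \<in> borel_measurable L" by (intro borel_measurable_times mb m\<phi> mF)
    show "AE x in L. norm (?f x) \<le> norm (B ^ card u * (F (vec_lambda x) * (\<Prod>j\<in>UNIV. \<phi> (x j))))"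
    proof (rule AE_I2)
      fix x :: "'s \<Rightarrow> real"
      have "\<bar>\<Prod>j\<in>u. b j (x j)\<bar> \<le> (\<Prod>j\<in>u. B * \<phi> (x j))"
        unfolding abs_prod by (intro prod_mono) (auto simp: b)
      then have 1: "\<bar>\<Prod>j\<in>u. b j (x j)\<bar> \<le> B ^ card u * (\<Prod>j\<in>u. \<phi> (x j))"
        by (simp add: prod.distrib)
      have p: "0 \<le> (\<Prod>j\<in>-u. \<phi> (x j))" using pos by (intro prod_nonneg) (auto simp: less_imp_le)
      have "norm (?f x) = \<bar>F (vec_lambda x)\<bar> * (\<bar>\<Prod>j\<in>u. b j (x j)\<bar> * (\<Prod>j\<in>-u. \<phi> (x j)))"
        using p by (simp add: abs_mult)
      also have "\<dots> \<le> \<bar>F (vec_lambda x)\<bar> * ((B ^ card u * (\<Prod>j\<in>u. \<phi> (x j))) * (\<Prod>j\<in>-u. \<phi> (x j)))"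
        by (intro mult_left_mono mult_right_mono 1 p) auto
      also have "\<dots> \<le> \<bar>F (vec_lambda x)\<bar> * \<bar>(B ^ card u * (\<Prod>j\<in>u. \<phi> (x j))) * (\<Prod>j\<in>-u. \<phi> (x j))\<bar>"
        by (intro mult_left_mono abs_ge_self) auto
      also have "\<dots> = norm (B ^ card u * (F (vec_lambda x) * (\<Prod>j\<in>UNIV. \<phi> (x j))))"
        unfolding prod_split[of "\<lambda>j. \<phi> (x j)" u] real_norm_def abs_mult by (simp only: ac_simps)
      finally show "norm (?f x) \<le> norm (B ^ card u * (F (vec_lambda x) * (\<Prod>j\<in>UNIV. \<phi> (x j))))" .
    qed
  qed
  have intg: "integrable L ?g"
    using integrable_box_kernel[where w="{}" and K="{}" and \<rho>="\<lambda>_. 0"] unfolding L_def by simp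
  obtain js where js: "mset js = mset_set u" "mixed_partial F u {} = partials js F"
    using mixed_partial_order[of "{}" u] by auto
  have "set js = set_mset (mset js)" by simp
  then have set_js: "set js = u" unfolding js by simp
  have dist: "distinct js" unfolding distinct_count_atmost_1 js(1) using set_js by (auto simp: count_mset_set')
  obtain N :: nat where N: "r \<le> real N" using real_arch_simple by blast
  obtain K where K: "K \<ge> 0" "\<And>j x. j \<in> u \<Longrightarrow> \<bar>\<kappa> j x\<bar> \<le> K" by (rule \<kappa>_bdd) blast
  define bn where "bn n j t = (if j \<in> u then b j t else \<phi> t * indicator {-real (n + N)..real (n + N)} t)" for n :: nat and j t
  define In where "In n x = (\<Prod>j\<in>-u. indicator {-real (n + N)..real (n + N)} (x j) :: real)" for n :: nat and x
  have bn_out: "(\<Prod>i\<in>-u. bn n i (x i)) = (\<Prod>j\<in>-u. \<phi> (x j)) * In n x" for n x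
    unfolding In_def prod.distrib[symmetric] by (intro prod.cong) (auto simp: bn_def)
  have prodb: "F (vec_lambda x) * (\<Prod>i\<in>UNIV. bn n i (x i)) = ?f x * In n x" for n x
  proof -
    have "(\<Prod>i\<in>u. bn n i (x i)) = (\<Prod>j\<in>u. b j (x j))" by (intro prod.cong) (auto simp: bn_def)
    then show ?thesis unfolding prod_split[of _ u] bn_out by (simp only: mult.assoc)
  qed
  have prodk: "mixed_partial F u {} (vec_lambda x) * (\<Prod>i\<in>UNIV. (if i \<in> u then \<kappa> i else bn n i) (x i)) = ?g x * In n x" for n x
  proof -
    have "(\<Prod>i\<in>u. (if i \<in> u then \<kappa> i else bn n i) (x i)) = (\<Prod>j\<in>u. \<kappa> j (x j))" by (intro prod.cong) auto
    moreover have "(\<Prod>i\<in>-u. (if i \<in> u then \<kappa> i else bn n i) (x i)) = (\<Prod>i\<in>-u. bn n i (x i))" by (intro prod.cong) auto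
    ultimately show ?thesis unfolding prod_split[of _ u] bn_out D_def by (simp only: ac_simps)
  qed
  have parts: "(\<integral>x. ?g x * In n x \<partial>L) = (-1) ^ length js * (\<integral>x. ?f x * In n x \<partial>L)" for n
  proof -
    have "continuous_on {-real (n + N)..real (n + N)} \<phi>"
      using prob_density_continuous[OF \<phi>] by (rule continuous_on_subset) auto
    then have "bounded (\<phi> ` {-real (n + N)..real (n + N)})"
      by (intro compact_imp_bounded compact_continuous_image) auto
    then obtain M where "\<forall>y\<in>\<phi> ` {-real (n + N)..real (n + N)}. norm y \<le> M" unfolding bounded_iff by blast
    then have M: "\<bar>\<phi> t\<bar> \<le> M" if "\<bar>t\<bar> \<le> real (n + N)" for t
      using that by (auto simp: abs_le_iff minus_le_iff)
    have M0: "0 \<le> M" using M[of 0] by (smt (verit) abs_ge_zero of_nat_0_le_iff)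
    \<comment> \<open>one bound for all kernels at once: \<open>\<kappa>\<close>, its derivative, and \<open>\<phi>\<close> on the box\<close>
    define Q where "Q = max K (max (\<bar>B\<bar> * M) M)"
    have bQ: "\<bar>bn n j t\<bar> \<le> Q" for j t
    proof (cases "\<bar>t\<bar> \<le> real (n + N)")
      case True
      show ?thesis
      proof (cases "j \<in> u")
        case ju: True
        have "\<bar>bn n j t\<bar> \<le> \<bar>B * \<phi> t\<bar>" using b(2)[OF ju, of t] ju by (simp add: bn_def)
        also have "\<dots> \<le> \<bar>B\<bar> * M" unfolding abs_mult by (intro mult_left_mono M True) auto
        finally show ?thesis by (simp add: Q_def)
      next
        case False
        have "\<bar>bn n j t\<bar> \<le> \<bar>\<phi> t\<bar>" using False by (simp add: bn_def indicator_def)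
        also have "\<dots> \<le> M" by (rule M[OF True])
        finally show ?thesis by (simp add: Q_def)
      qed
    next
      case False
      then have "bn n j t = 0" using supp(2)[of j t] N by (auto simp: bn_def indicator_def)
      then show ?thesis using K(1) by (simp add: Q_def)
    qed
    have "(\<integral>x. partials js F (vec_lambda x) * (\<Prod>i\<in>UNIV. (if i \<in> set js then \<kappa> i else bn n i) (x i)) \<partial>leb UNIV)
     = (-1) ^ length js * (\<integral>x. F (vec_lambda x) * (\<Prod>i\<in>UNIV. bn n i (x i)) \<partial>leb UNIV)"
    proof (rule partials_by_parts[where u=u and r="real (n + N)" and B=Q and S=S])
      fix i
      show "bn n i \<in> borel_measurable borel"
        unfolding bn_def[abs_def] using b(1)[of i] by (cases "i \<in> u") simp_all
      show "\<bar>bn n i t\<bar> \<le> Q" for t by (rule bQ)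
      show "bn n i t = 0" if "real (n + N) \<le> \<bar>t\<bar>" "i \<in> u" for t
        using that supp(2)[of i t] N by (simp add: bn_def)
      show "bn n i t = 0" if "real (n + N) < \<bar>t\<bar>" for t
        using that supp(2)[of i t] N by (auto simp: bn_def indicator_def)
      show "\<bar>\<kappa> i t\<bar> \<le> Q" if "i \<in> u" for t using K(2)[OF that, of t] by (simp add: Q_def)
      show "\<kappa> i t = 0" if "i \<in> u" "real (n + N) \<le> \<bar>t\<bar>" for t
        using that supp(1)[of i t] N by simp
      show "(\<kappa> i has_real_derivative bn n i t) (at t)" if "i \<in> u" "t \<notin> S i" for t
        using d(2)[OF that] that by (simp add: bn_def)
    qed (use F \<kappa> d(1) dist set_js in auto)
    then show ?thesis unfolding set_js js(2)[symmetric] prodb prodk L_def .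
  qed
  have In01: "0 \<le> In n x" "In n x \<le> 1" for n x
    unfolding In_def by (auto intro!: prod_nonneg prod_le_1)
  have In_lim: "(\<lambda>n. In n x) \<longlonglongrightarrow> 1" for x
  proof (rule tendsto_eventually)
    have "eventually (\<lambda>n. \<forall>j\<in>-u. \<bar>x j\<bar> \<le> real (n + N)) sequentially"
    proof (rule eventually_ball_finite)
      show "\<forall>j\<in>-u. eventually (\<lambda>n. \<bar>x j\<bar> \<le> real (n + N)) sequentially"
      proof
        fix j
        obtain m :: nat where m: "\<bar>x j\<bar> \<le> real m" using real_arch_simple by blast
        show "eventually (\<lambda>n. \<bar>x j\<bar> \<le> real (n + N)) sequentially"
          using eventually_ge_at_top[of m] by eventually_elim (use m in auto)
      qed
    qed simp
    then show "eventually (\<lambda>n. In n x = 1) sequentially"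
    proof eventually_elim
      case (elim n)
      have "x j \<in> {-real (n + N)..real (n + N)}" if "j \<in> -u" for j
        using bspec[OF elim that] unfolding atLeastAtMost_iff abs_le_iff by linarith
      then show ?case unfolding In_def by (intro prod.neutral) (metis indicator_simps(1))
    qed
  qed
  have mIn: "In n \<in> borel_measurable L" for n unfolding In_def[abs_def] L_def by measurable
  have lim: "(\<lambda>n. \<integral>x. h x * In n x \<partial>L) \<longlonglongrightarrow> (\<integral>x. h x \<partial>L)" if h: "integrable L h" for h :: "('s \<Rightarrow> real) \<Rightarrow> real"
  proof (rule integral_dominated_convergence[where w = "\<lambda>x. \<bar>h x\<bar>"])
    show "h \<in> borel_measurable L" using h by simp
    then show "(\<lambda>x. h x * In n x) \<in> borel_measurable L" for n by (intro borel_measurable_times mIn)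
    show "integrable L (\<lambda>x. \<bar>h x\<bar>)" using h by simp
    show "AE x in L. (\<lambda>n. h x * In n x) \<longlonglongrightarrow> h x"
      using tendsto_mult[OF tendsto_const In_lim] by (intro AE_I2) fastforce
    show "AE x in L. norm (h x * In n x) \<le> \<bar>h x\<bar>" for n
    proof (rule AE_I2)
      fix x
      have "\<bar>h x\<bar> * In n x \<le> \<bar>h x\<bar> * 1" by (intro mult_left_mono In01) auto
      then show "norm (h x * In n x) \<le> \<bar>h x\<bar>" using In01[of n x] by (simp add: abs_mult)
    qed
  qed
  have "(\<integral>x. ?g x \<partial>L) = (-1) ^ length js * (\<integral>x. ?f x \<partial>L)"
    using LIMSEQ_unique[OF lim[OF intg, unfolded parts] tendsto_mult[OF tendsto_const lim[OF intf]]] .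
  then have "\<bar>\<integral>x. ?f x \<partial>L\<bar> = \<bar>\<integral>x. ?g x \<partial>L\<bar>" by (simp add: abs_mult power_abs)
  then show ?thesis using iterated_bound unfolding norm L_def by simp
qed

section \<open>A smooth cutoff\<close>

text \<open>A twice differentiable function on \<open>[0, \<infinity>)\<close> that vanishes on \<open>[0, 1]\<close>, does not exceed the identity and
satisfies \<open>cutoff (n t) / n \<rightarrow> t\<close>. Division by zero at \<open>s = 0\<close> gives the correct value 0.\<close>

definition cutoff :: "real \<Rightarrow> real" where "cutoff s = max 0 (s - 1) ^ 3 / s ^ 2"
definition cutoff1 :: "real \<Rightarrow> real" where "cutoff1 s = 3 * max 0 (s - 1) ^ 2 / s ^ 2 - 2 * max 0 (s - 1) ^ 3 / s ^ 3"
definition cutoff2 :: "real \<Rightarrow> real" where "cutoff2 s = 6 * max 0 (s - 1) / s ^ 4"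

lemma quadratic_imp_deriv_zero:
  fixes f :: "real \<Rightarrow> real"
  assumes "\<And>z. \<bar>f z - f y\<bar> \<le> K * \<bar>z - y\<bar>\<^sup>2"
  shows "(f has_real_derivative 0) (at y)"
proof -
  have "((\<lambda>h. (f (y + h) - f y) / h) \<longlongrightarrow> 0) (at 0)"
  proof (rule Lim_null_comparison)
    show "\<forall>\<^sub>F h in at 0. norm ((f (y + h) - f y) / h) \<le> K * \<bar>h\<bar>"
    proof (rule eventually_at_filter[THEN iffD2], intro always_eventually allI impI)
      fix h :: real assume "h \<noteq> 0"
      then show "norm ((f (y + h) - f y) / h) \<le> K * \<bar>h\<bar>"
        using assms[of "y + h"] by (simp add: divide_le_eq power2_eq_square mult.assoc)
    qed
    show "((\<lambda>h. K * \<bar>h\<bar>) \<longlongrightarrow> 0) (at (0::real))"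
      by (auto intro!: tendsto_eq_intros)
  qed
  then show ?thesis by (simp add: DERIV_def)
qed

lemma max_power_deriv: "((\<lambda>s::real. max 0 s ^ Suc (Suc k)) has_real_derivative real (Suc (Suc k)) * max 0 s ^ Suc k) (at s)"
proof -
  consider "s < 0" | "s = 0" | "s > 0" by linarith
  then show ?thesis
  proof cases
    case 1
    have "((\<lambda>s::real. 0) has_real_derivative 0) (at s)" by simp
    then have "((\<lambda>s::real. max 0 s ^ Suc (Suc k)) has_real_derivative 0) (at s)"
      by (rule has_field_derivative_transform_within_open[of _ _ _ "{..<0}"]) (use 1 in auto)
    then show ?thesis using 1 by simp
  next
    case 3
    have "((\<lambda>s::real. s ^ Suc (Suc k)) has_real_derivative real (Suc (Suc k)) * s ^ Suc k) (at s)"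
      using DERIV_pow[of "Suc (Suc k)" s UNIV] by simp
    then have "((\<lambda>s::real. max 0 s ^ Suc (Suc k)) has_real_derivative real (Suc (Suc k)) * s ^ Suc k) (at s)"
      by (rule has_field_derivative_transform_within_open[of _ _ _ "{0<..}"]) (use 3 in auto)
    then show ?thesis using 3 by simp
  next
    case 2
    have "((\<lambda>h::real. max 0 h ^ Suc (Suc k) / h) \<longlongrightarrow> 0) (at 0)"
    proof (rule Lim_null_comparison)
      show "\<forall>\<^sub>F h::real in at 0. norm (max 0 h ^ Suc (Suc k) / h) \<le> \<bar>h\<bar> ^ Suc k"
      proof (rule eventually_at_filter[THEN iffD2], intro always_eventually allI impI)
        fix h :: real assume "h \<noteq> 0"
        show "norm (max 0 h ^ Suc (Suc k) / h) \<le> \<bar>h\<bar> ^ Suc k"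
        proof (cases "h > 0")
          case False
          then have "norm (max 0 h ^ Suc (Suc k) / h) = 0" by simp
          moreover have "0 \<le> \<bar>h\<bar> ^ Suc k" by (rule zero_le_power[OF abs_ge_zero])
          ultimately show ?thesis by linarith
        qed simp
      qed
      show "((\<lambda>h. \<bar>h\<bar> ^ Suc k) \<longlongrightarrow> 0) (at (0::real))"
        by (auto intro!: tendsto_eq_intros)
    qed
    then show ?thesis using 2 by (simp add: DERIV_def)
  qed
qed

lemma max_shift_deriv: "((\<lambda>s::real. max 0 (s - 1) ^ Suc (Suc k)) has_real_derivative real (Suc (Suc k)) * max 0 (s - 1) ^ Suc k) (at s)"
proof -
  have "((\<lambda>s::real. s - 1) has_real_derivative 1) (at s)" by (auto intro!: derivative_eq_intros)
  from DERIV_chain2[where f = "\<lambda>s. max 0 s ^ Suc (Suc k)" and g = "\<lambda>s. s - 1" and x = s, OF max_power_deriv this]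
  show ?thesis by (simp del: power_Suc)
qed

lemma cutoff_le1: "s \<le> 1 \<Longrightarrow> cutoff s = 0" "s \<le> 1 \<Longrightarrow> cutoff1 s = 0" "s \<le> 1 \<Longrightarrow> cutoff2 s = 0"
  by (simp_all add: cutoff_def cutoff1_def cutoff2_def)

lemma cutoff1_ge1: "1 \<le> s \<Longrightarrow> cutoff1 s = (1 - 1 / s)\<^sup>2 * (1 + 2 / s)"
  by (simp add: cutoff1_def field_simps power2_eq_square power3_eq_cube)

lemma cutoff_deriv: "(cutoff has_real_derivative cutoff1 s) (at s)"
proof (cases "s < 1")
  case True
  have "((\<lambda>s::real. 0) has_real_derivative 0) (at s)" by simp
  then have "(cutoff has_real_derivative 0) (at s)"
    by (rule has_field_derivative_transform_within_open[of _ _ _ "{..<1}"]) (use True in \<open>auto simp: cutoff_le1\<close>)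
  then show ?thesis using True by (simp add: cutoff_le1)
next
  case False
  have "(cutoff has_real_derivative (3 * max 0 (s - 1) ^ 2 * s ^ 2 - max 0 (s - 1) ^ 3 * (2 * s)) / (s ^ 2 * s ^ 2)) (at s)"
    unfolding cutoff_def[abs_def] using False max_shift_deriv[of 1 s] 
    by (intro DERIV_divide) (auto intro!: derivative_eq_intros simp: numeral_eq_Suc)
  moreover have "(3 * max 0 (s - 1) ^ 2 * s ^ 2 - max 0 (s - 1) ^ 3 * (2 * s)) / (s ^ 2 * s ^ 2) = cutoff1 s"
    unfolding cutoff1_def using False by (simp add: field_simps power2_eq_square power3_eq_cube)
  ultimately show ?thesis by simp
qed

lemma cutoff1_deriv: "(cutoff1 has_real_derivative cutoff2 s) (at s)"
proof (cases "s < 1")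
  case True
  have "((\<lambda>s::real. 0) has_real_derivative 0) (at s)" by simp
  then have "(cutoff1 has_real_derivative 0) (at s)"
    by (rule has_field_derivative_transform_within_open[of _ _ _ "{..<1}"]) (use True in \<open>auto simp: cutoff_le1\<close>)
  then show ?thesis using True by (simp add: cutoff_le1)
next
  case False
  let ?m = "max 0 (s - 1)"
  have d2: "((\<lambda>s::real. max 0 (s - 1) ^ 2) has_real_derivative 2 * ?m) (at s)"
    using max_shift_deriv[of 0 s] by (simp add: numeral_eq_Suc)
  have d3: "((\<lambda>s::real. max 0 (s - 1) ^ 3) has_real_derivative 3 * ?m ^ 2) (at s)"
    using max_shift_deriv[of 1 s] by (simp add: numeral_eq_Suc)
  have p2: "((\<lambda>s::real. s ^ 2) has_real_derivative 2 * s) (at s)" and p3: "((\<lambda>s::real. s ^ 3) has_real_derivative 3 * s ^ 2) (at s)"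
    by (auto intro!: derivative_eq_intros)
  have "(cutoff1 has_real_derivative ((3 * (2 * ?m)) * s ^ 2 - (3 * ?m ^ 2) * (2 * s)) / (s ^ 2 * s ^ 2)
      - ((2 * (3 * ?m ^ 2)) * s ^ 3 - (2 * ?m ^ 3) * (3 * s ^ 2)) / (s ^ 3 * s ^ 3)) (at s)"
    unfolding cutoff1_def[abs_def] using False
    by (intro DERIV_diff DERIV_divide DERIV_cmult d2 d3 p2 p3) auto
  moreover have "((3 * (2 * ?m)) * s ^ 2 - (3 * ?m ^ 2) * (2 * s)) / (s ^ 2 * s ^ 2)
      - ((2 * (3 * ?m ^ 2)) * s ^ 3 - (2 * ?m ^ 3) * (3 * s ^ 2)) / (s ^ 3 * s ^ 3) = cutoff2 s"
  proof -
    have m: "?m = s - 1" using False by simp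
    have s: "s \<noteq> 0" using False by auto
    have "((3 * (2 * ?m)) * s ^ 2 - (3 * ?m ^ 2) * (2 * s)) / (s ^ 2 * s ^ 2) = (6 * ?m * s - 6 * ?m ^ 2) / s ^ 3"
      using s by (simp add: field_simps power2_eq_square power3_eq_cube)
    moreover have "((2 * (3 * ?m ^ 2)) * s ^ 3 - (2 * ?m ^ 3) * (3 * s ^ 2)) / (s ^ 3 * s ^ 3) = (6 * ?m ^ 2 * s - 6 * ?m ^ 3) / s ^ 4"
      using s by (simp add: field_simps power2_eq_square power3_eq_cube power4_eq_xxxx)
    moreover have "(6 * ?m * s - 6 * ?m ^ 2) / s ^ 3 - (6 * ?m ^ 2 * s - 6 * ?m ^ 3) / s ^ 4 = 6 * ?m / s ^ 4"
      unfolding m using s by (simp add: field_simps power2_eq_square power3_eq_cube power4_eq_xxxx)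
    ultimately show ?thesis by (simp add: cutoff2_def)
  qed
  ultimately show ?thesis by simp
qed

lemma cutoff_bounds: "0 \<le> s \<Longrightarrow> 0 \<le> cutoff s" "0 \<le> s \<Longrightarrow> cutoff s \<le> s"
proof -
  assume s: "0 \<le> s"
  then show "0 \<le> cutoff s" by (simp add: cutoff_def)
  show "cutoff s \<le> s"
  proof (cases "s \<le> 1")
    case True then show ?thesis using s by (simp add: cutoff_le1)
  next
    case False
    then have "(s - 1) ^ 3 \<le> s ^ 3" by (intro power_mono) auto
    then show ?thesis using False by (simp add: cutoff_def divide_le_eq power2_eq_square power3_eq_cube mult.assoc)
  qed
qed

lemma cutoff1_bounds: "0 \<le> cutoff1 s" "cutoff1 s \<le> 1"
proof -
  have "0 \<le> cutoff1 s \<and> cutoff1 s \<le> 1"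
  proof (cases "s \<le> 1")
    case True then show ?thesis by (simp add: cutoff_le1)
  next
    case False
    define q where "q = 1 / s"
    have q: "0 \<le> q" "q \<le> 1" using False by (auto simp: q_def)
    have e: "cutoff1 s = (1 - q)\<^sup>2 * (1 + 2 * q)" using False by (simp add: cutoff1_ge1 q_def)
    have "1 - (1 - q)\<^sup>2 * (1 + 2 * q) = q\<^sup>2 * (3 - 2 * q)" by (simp add: algebra_simps power2_eq_square)
    moreover have "0 \<le> q\<^sup>2 * (3 - 2 * q)" using q by simp
    ultimately have "(1 - q)\<^sup>2 * (1 + 2 * q) \<le> 1" by linarith
    then show ?thesis unfolding e using q by simp
  qed
  then show "0 \<le> cutoff1 s" "cutoff1 s \<le> 1" by auto
qed

text \<open>The second derivative decays like \<open>1 / s\<close>, which compensates the factor \<open>n\<close> that rescaling brings.\<close>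

lemma cutoff2_bounds: "0 \<le> cutoff2 s" "s * cutoff2 s \<le> 6"
proof -
  show "0 \<le> cutoff2 s" by (simp add: cutoff2_def)
  show "s * cutoff2 s \<le> 6"
  proof (cases "s \<le> 1")
    case True then show ?thesis by (simp add: cutoff_le1)
  next
    case False
    then have "s * cutoff2 s = 6 * ((s - 1) / s ^ 3)" by (simp add: cutoff2_def power4_eq_xxxx power3_eq_cube)
    moreover have "s \<le> s ^ 3" using False power_increasing[of 1 3 s] by simp
    then have "(s - 1) / s ^ 3 \<le> 1" using False by (simp add: divide_le_eq)
    ultimately show ?thesis by linarith
  qed
qed

lemma cutoff1_lim: assumes "0 < t" shows "(\<lambda>n. cutoff1 (real (Suc n) * t)) \<longlonglongrightarrow> 1"
proof -
  have inf: "filterlim (\<lambda>n. real (Suc n) * t) at_top sequentially"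
    using filterlim_tendsto_pos_mult_at_top[OF tendsto_const assms filterlim_compose[OF filterlim_real_sequentially filterlim_Suc]]
    by (simp only: mult.commute)
  have "((\<lambda>s::real. (1 - 1 / s)\<^sup>2 * (1 + 2 / s)) \<longlongrightarrow> (1 - 0)\<^sup>2 * (1 + 0)) at_top"
    by (intro tendsto_intros tendsto_divide_0[OF tendsto_const] filterlim_at_top_imp_at_infinity filterlim_ident)
  moreover have "\<forall>\<^sub>F s in at_top. (1 - 1 / s)\<^sup>2 * (1 + 2 / s) = cutoff1 s"
    using eventually_ge_at_top[of 1] by eventually_elim (simp add: cutoff1_ge1)
  ultimately have "(cutoff1 \<longlongrightarrow> 1) at_top" by (simp add: tendsto_cong)
  from filterlim_compose[OF this inf] show ?thesis .
qed

lemma cutoff2_lim: assumes "0 < t" shows "(\<lambda>n. real (Suc n) * cutoff2 (real (Suc n) * t)) \<longlonglongrightarrow> 0"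
proof -
  have inf: "filterlim (\<lambda>n. real (Suc n) * t) at_top sequentially"
    using filterlim_tendsto_pos_mult_at_top[OF tendsto_const assms filterlim_compose[OF filterlim_real_sequentially filterlim_Suc]]
    by (simp only: mult.commute)
  have "((\<lambda>s::real. (1 - 1 / s) * (6 / s) * (1 / s)) \<longlongrightarrow> (1 - 0) * 0 * 0) at_top"
    by (intro tendsto_intros tendsto_divide_0[OF tendsto_const] filterlim_at_top_imp_at_infinity filterlim_ident)
  moreover have "\<forall>\<^sub>F s in at_top. (1 - 1 / s) * (6 / s) * (1 / s) = s * cutoff2 s"
    using eventually_ge_at_top[of 1] by eventually_elim (simp add: cutoff2_def field_simps power4_eq_xxxx)
  ultimately have "((\<lambda>s. s * cutoff2 s) \<longlongrightarrow> 0) at_top" by (simp add: tendsto_cong)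
  from tendsto_mult[OF tendsto_const[of "1/t"] filterlim_compose[OF this inf]]
  have "(\<lambda>n. 1 / t * (real (Suc n) * t * cutoff2 (real (Suc n) * t))) \<longlonglongrightarrow> 1 / t * 0" .
  moreover have "1 / t * (real (Suc n) * t * cutoff2 (real (Suc n) * t)) = real (Suc n) * cutoff2 (real (Suc n) * t)" for n
    using assms by (simp del: of_nat_Suc)
  ultimately show ?thesis by (simp only: mult_zero_right)
qed

section \<open>Dyadic grids and Walsh functions\<close>

text \<open>The distance to the grid \<open>2\<^sup>-\<^sup>a \<int>\<close>; on \<open>[0, 1]\<close> it is the antiderivative of the Rademacher function \<open>rad a\<close>.\<close>

definition grid_dist :: "nat \<Rightarrow> real \<Rightarrow> real" where "grid_dist a y = \<bar>2 ^ a * y - of_int (round (2 ^ a * y))\<bar> / 2 ^ a"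

definition rad :: "nat \<Rightarrow> real \<Rightarrow> real" where "rad i y = (-1) ^ bin_digit y (Suc i)"

lemma grid_dist_le: "grid_dist a y \<le> \<bar>y - of_int m / 2 ^ a\<bar>"
proof -
  have "grid_dist a y \<le> \<bar>2 ^ a * y - of_int m\<bar> / 2 ^ a"
    unfolding grid_dist_def by (intro divide_right_mono round_diff_minimal) auto
  also have "\<dots> = \<bar>(2 ^ a * y - of_int m) / 2 ^ a\<bar>" by (simp add: abs_divide)
  also have "(2 ^ a * y - of_int m) / 2 ^ a = y - of_int m / 2 ^ a" by (simp add: field_simps)
  finally show ?thesis .
qed

lemma grid_dist_attained: "\<exists>m. grid_dist a y = \<bar>y - of_int m / 2 ^ a\<bar>"
proof
  have "grid_dist a y = \<bar>(2 ^ a * y - of_int (round (2 ^ a * y))) / 2 ^ a\<bar>" by (simp add: grid_dist_def abs_divide)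
  also have "(2 ^ a * y - of_int (round (2 ^ a * y))) / 2 ^ a = y - of_int (round (2 ^ a * y)) / 2 ^ a" by (simp add: field_simps)
  finally show "grid_dist a y = \<bar>y - of_int (round (2 ^ a * y)) / 2 ^ a\<bar>" .
qed

lemma grid_dist_nonneg: "0 \<le> grid_dist a y" by (simp add: grid_dist_def)

lemma grid_dist_half: "grid_dist a y \<le> 1 / 2 ^ Suc a"
proof -
  have "\<bar>2 ^ a * y - of_int (round (2 ^ a * y))\<bar> \<le> 1 / 2"
    using of_int_round_abs_le[of "2 ^ a * y"] by (simp add: abs_minus_commute)
  then have "grid_dist a y \<le> (1 / 2) / 2 ^ a" unfolding grid_dist_def by (intro divide_right_mono) auto
  then show ?thesis by simp
qed

lemma grid_dist_le_half: "grid_dist a y \<le> 1 / 2"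
  using grid_dist_half[of a y] by (rule order_trans) (simp add: field_simps)

lemma grid_dist_lipschitz: "\<bar>grid_dist a y - grid_dist a z\<bar> \<le> \<bar>y - z\<bar>"
proof -
  have *: "grid_dist a y \<le> grid_dist a z + \<bar>y - z\<bar>" for y z
  proof -
    obtain m where m: "grid_dist a z = \<bar>z - of_int m / 2 ^ a\<bar>" using grid_dist_attained by blast
    show ?thesis using grid_dist_le[of a y m] unfolding m by linarith
  qed
  show ?thesis using *[of y z] *[of z y] by linarith
qed

lemma grid_dist_continuous: "continuous_on A (grid_dist a)"
proof (rule continuous_on_subset[OF _ subset_UNIV], unfold continuous_on_iff, intro ballI allI impI)
  fix x e :: real assume "0 < e"
  then show "\<exists>d>0. \<forall>x'\<in>UNIV. dist x' x < d \<longrightarrow> dist (grid_dist a x') (grid_dist a x) < e"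
    using grid_dist_lipschitz by (intro exI[of _ e]) (auto simp: dist_real_def intro: le_less_trans)
qed

lemma grid_dist_measurable [measurable]: "grid_dist a \<in> borel_measurable borel"
  by (rule borel_measurable_continuous_onI[OF grid_dist_continuous])

lemma grid_dist_le_left: "0 \<le> y \<Longrightarrow> grid_dist a y \<le> y" using grid_dist_le[of a y 0] by simp
lemma grid_dist_le_right: "y \<le> 1 \<Longrightarrow> grid_dist a y \<le> 1 - y" using grid_dist_le[of a y "2 ^ a"] by simp

lemma grid_dist_zero_iff: "grid_dist a y = 0 \<longleftrightarrow> 2 ^ a * y \<in> \<int>"
proof
  assume "grid_dist a y = 0"
  then have "2 ^ a * y = of_int (round (2 ^ a * y))" by (simp add: grid_dist_def)
  then show "2 ^ a * y \<in> \<int>" by (metis Ints_of_int)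
next
  assume "2 ^ a * y \<in> \<int>"
  then obtain m where "2 ^ a * y = of_int m" by (auto elim: Ints_cases)
  then show "grid_dist a y = 0" by (simp add: grid_dist_def)
qed

lemma grid_mono: "i \<le> j \<Longrightarrow> 2 ^ i * y \<in> \<int> \<Longrightarrow> 2 ^ j * y \<in> (\<int> :: real set)"
proof -
  assume "i \<le> j" and y: "2 ^ i * y \<in> \<int>"
  have "2 ^ (j - i) * (2 ^ i * y) \<in> \<int>" by (rule Ints_mult[OF Ints_power[OF Ints_numeral] y])
  moreover have "2 ^ (j - i) * (2 ^ i * y) = 2 ^ j * y"
    using \<open>i \<le> j\<close> by (metis mult.assoc power_add le_add_diff_inverse2)
  ultimately show "2 ^ j * y \<in> (\<int> :: real set)" by simp
qed

text \<open>The distance to the finer grid is invariant under reflections and translations that preserve the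
coarser one.\<close>

lemma grid_dist_grid_dist: assumes "a2 \<le> a1" shows "grid_dist a1 (grid_dist a2 y) = grid_dist a1 y"
proof -
  obtain m where "grid_dist a2 y = \<bar>y - of_int m / 2 ^ a2\<bar>" using grid_dist_attained by blast
  then obtain e :: int where e: "e = 1 \<or> e = -1" "grid_dist a2 y = of_int e * (y - of_int m / 2 ^ a2)"
    by (cases "y - of_int m / 2 ^ a2 \<ge> 0") (force simp: abs_if)+
  have ee: "of_int e * of_int e = (1::real)" using e(1) by auto
  have abse: "\<bar>of_int e * t\<bar> = \<bar>t\<bar>" for t :: real using e(1) by auto
  have p: "(of_int m :: real) / 2 ^ a2 = of_int (m * 2 ^ (a1 - a2)) / 2 ^ a1"
    using assms by (simp add: field_simps power_add[symmetric])
  have A: "grid_dist a1 (grid_dist a2 y) \<le> grid_dist a1 y"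
  proof -
    obtain q where q: "grid_dist a1 y = \<bar>y - of_int q / 2 ^ a1\<bar>" using grid_dist_attained by blast
    have "grid_dist a1 (grid_dist a2 y) \<le> \<bar>grid_dist a2 y - of_int (e * (q - m * 2 ^ (a1 - a2))) / 2 ^ a1\<bar>" by (rule grid_dist_le)
    also have "grid_dist a2 y - of_int (e * (q - m * 2 ^ (a1 - a2))) / 2 ^ a1 = of_int e * (y - of_int q / 2 ^ a1)"
      unfolding e(2) p by (simp add: field_simps)
    finally show ?thesis unfolding abse q .
  qed
  have B: "grid_dist a1 y \<le> grid_dist a1 (grid_dist a2 y)"
  proof -
    obtain q where q: "grid_dist a1 (grid_dist a2 y) = \<bar>grid_dist a2 y - of_int q / 2 ^ a1\<bar>" using grid_dist_attained by blast
    have "grid_dist a1 y \<le> \<bar>y - of_int (e * q + m * 2 ^ (a1 - a2)) / 2 ^ a1\<bar>" by (rule grid_dist_le)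
    also have "y - of_int (e * q + m * 2 ^ (a1 - a2)) / 2 ^ a1 = of_int e * (grid_dist a2 y - of_int q / 2 ^ a1)"
    proof -
      have "of_int e * (of_int e * (y - of_int (m * 2 ^ (a1 - a2)) / 2 ^ a1) - of_int q / 2 ^ a1)
        = (of_int e * of_int e) * (y - of_int (m * 2 ^ (a1 - a2)) / 2 ^ a1) - of_int e * of_int q / 2 ^ a1"
        by (simp add: algebra_simps)
      then show ?thesis unfolding e(2) p ee by (simp add: add_divide_distrib)
    qed
    finally show ?thesis unfolding abse q .
  qed
  show ?thesis using A B by simp
qed

lemma floor_locally_const:
  fixes x :: real
  assumes "2 ^ k * x \<notin> \<int>"
  shows "\<exists>d>0. \<forall>z. \<bar>z - x\<bar> < d \<longrightarrow> \<lfloor>2 ^ k * z\<rfloor> = \<lfloor>2 ^ k * x\<rfloor> \<and> 2 ^ k * z \<notin> \<int>"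
proof -
  define N where "N = \<lfloor>2 ^ k * x\<rfloor>"
  have N: "of_int N < 2 ^ k * x" "2 ^ k * x < of_int N + 1"
    using assms floor_correct[of "2 ^ k * x"] Ints_of_int[of N] unfolding N_def by (metis le_less, simp)
  define d where "d = min (2 ^ k * x - of_int N) (of_int N + 1 - 2 ^ k * x) / 2 ^ k"
  have "d > 0" using N by (simp add: d_def)
  moreover have "\<lfloor>2 ^ k * z\<rfloor> = N \<and> 2 ^ k * z \<notin> \<int>" if "\<bar>z - x\<bar> < d" for z
  proof -
    have "2 ^ k * \<bar>z - x\<bar> < min (2 ^ k * x - of_int N) (of_int N + 1 - 2 ^ k * x)"
      using that unfolding d_def by (simp add: field_simps)
    moreover have "\<bar>2 ^ k * z - 2 ^ k * x\<bar> = 2 ^ k * \<bar>z - x\<bar>"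
      by (simp add: abs_mult flip: right_diff_distrib)
    ultimately have "\<bar>2 ^ k * z - 2 ^ k * x\<bar> < min (2 ^ k * x - of_int N) (of_int N + 1 - 2 ^ k * x)" by simp
    then have z: "of_int N < 2 ^ k * z" "2 ^ k * z < of_int N + 1" unfolding min_less_iff_conj by linarith+
    then have "\<lfloor>2 ^ k * z\<rfloor> = N" by (intro floor_unique) auto
    moreover have "2 ^ k * z \<notin> \<int>"
    proof
      assume "2 ^ k * z \<in> \<int>"
      then obtain q where "2 ^ k * z = of_int q" by (auto elim: Ints_cases)
      with z have "N < q" "q < N + 1" by linarith+
      then show False by simp
    qed
    ultimately show ?thesis by simp
  qed
  ultimately show ?thesis unfolding N_def by blast
qed

lemma rad_locally_const:
  assumes "2 ^ k * x \<notin> \<int>" "i < k"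
  shows "\<forall>\<^sub>F z in nhds x. rad i z = rad i x"
proof -
  have "2 ^ Suc i * x \<notin> \<int>" using assms grid_mono[of "Suc i" k x] by auto
  then obtain d where d: "d > 0" "\<And>z. \<bar>z - x\<bar> < d \<Longrightarrow> \<lfloor>2 ^ Suc i * z\<rfloor> = \<lfloor>2 ^ Suc i * x\<rfloor>"
    using floor_locally_const by blast
  have "rad i z = rad i x" if "dist z x < d" for z
    using d(2)[of z] that unfolding rad_def bin_digit_def dist_real_def by (simp only:)
  with d(1) show ?thesis unfolding eventually_nhds_metric by blast
qed

lemma rad_pm: "rad i y = 1 \<or> rad i y = -1"
  unfolding rad_def by (metis neg_one_even_power neg_one_odd_power)

lemma rad_sq: "rad i y * rad i y = 1" and rad_abs: "\<bar>rad i y\<bar> = 1"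
  using rad_pm[of i y] by auto

lemma rad_measurable [measurable]: "rad i \<in> borel_measurable borel"
proof -
  have "(\<lambda>y::real. \<lfloor>2 ^ Suc i * y\<rfloor>) \<in> measurable borel (count_space UNIV)" by measurable
  then have "(\<lambda>y::real. (\<lambda>N. (-1) ^ (nat N mod 2)) \<lfloor>2 ^ Suc i * y\<rfloor> :: real) \<in> borel_measurable borel"
    by (rule measurable_compose) simp
  then show ?thesis by (simp add: rad_def[abs_def] bin_digit_def)
qed

lemma grid_dist_deriv:
  assumes "0 < y" and "2 ^ Suc a * y \<notin> \<int>"
  shows "(grid_dist a has_real_derivative rad a y) (at y)"
proof -
  define N where "N = \<lfloor>2 ^ Suc a * y\<rfloor>"
  obtain d where d: "d > 0" "\<And>z. \<bar>z - y\<bar> < d \<Longrightarrow> \<lfloor>2 ^ Suc a * z\<rfloor> = N \<and> 2 ^ Suc a * z \<notin> \<int>"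
    using floor_locally_const[OF assms(2)] unfolding N_def by blast
  have N0: "0 \<le> N" using assms(1) unfolding N_def by simp
  have bd: "of_int N < 2 ^ Suc a * z \<and> 2 ^ Suc a * z < of_int N + 1" if "\<bar>z - y\<bar> < d" for z
  proof -
    have "2 ^ Suc a * z \<noteq> of_int N" using d(2)[OF that] Ints_of_int[of N] by metis
    moreover have fl: "\<lfloor>2 ^ Suc a * z\<rfloor> = N" using d(2)[OF that] by blast
    have "of_int N \<le> 2 ^ Suc a * z" using of_int_floor_le[of "2 ^ Suc a * z"] unfolding fl .
    moreover have "2 ^ Suc a * z < of_int N + 1"
      using real_of_int_floor_add_one_gt[of "2 ^ Suc a * z"] unfolding fl .
    ultimately show ?thesis by linarith
  qed
  have rad: "rad a y = (if even N then 1 else -1)"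
  proof -
    have "even (nat N) \<longleftrightarrow> even N" using N0 by (simp add: even_nat_iff)
    then show ?thesis unfolding rad_def bin_digit_def N_def[symmetric]
      by (cases "even N") (auto simp: even_iff_mod_2_eq_zero odd_iff_mod_2_eq_one)
  qed
  show ?thesis
  proof (cases "even N")
    case True
    then obtain M where M: "N = 2 * M" by (elim evenE)
    have "grid_dist a z = z - of_int M / 2 ^ a" if "z \<in> {y - d <..< y + d}" for z
    proof -
      have "\<bar>z - y\<bar> < d" using that by (auto simp: abs_if)
      from bd[OF this] have b: "of_int M < 2 ^ a * z" "2 ^ a * z < of_int M + 1 / 2"
        by (simp_all add: M)
      then have "round (2 ^ a * z) = M" by (intro round_unique') (simp add: abs_if)
      then show ?thesis using b unfolding grid_dist_def by (simp add: field_simps)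
    qed
    moreover have "((\<lambda>z. z - of_int M / 2 ^ a) has_real_derivative 1) (at y)" by (auto intro!: derivative_eq_intros)
    ultimately have "(grid_dist a has_real_derivative 1) (at y)"
      using d(1) by (intro has_field_derivative_transform_within_open[of "\<lambda>z. z - of_int M / 2 ^ a" _ _ "{y - d <..< y + d}" "grid_dist a"]) auto
    then show ?thesis using True rad by simp
  next
    case False
    then obtain M where M: "N = 2 * M + 1" by (elim oddE)
    have "grid_dist a z = of_int (M + 1) / 2 ^ a - z" if "z \<in> {y - d <..< y + d}" for z
    proof -
      have "\<bar>z - y\<bar> < d" using that by (auto simp: abs_if)
      from bd[OF this] have b: "of_int M + 1 / 2 < 2 ^ a * z" "2 ^ a * z < of_int M + 1"
        by (simp_all add: M)
      then have "round (2 ^ a * z) = M + 1" by (intro round_unique') (simp add: abs_if)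
      then show ?thesis using b unfolding grid_dist_def by (simp add: field_simps)
    qed
    moreover have "((\<lambda>z. of_int (M + 1) / 2 ^ a - z) has_real_derivative -1) (at y)" by (auto intro!: derivative_eq_intros)
    ultimately have "(grid_dist a has_real_derivative -1) (at y)"
      using d(1) by (intro has_field_derivative_transform_within_open[of "\<lambda>z. of_int (M + 1) / 2 ^ a - z" _ _ "{y - d <..< y + d}" "grid_dist a"]) auto
    then show ?thesis using False rad by simp
  qed
qed

text \<open>The jumps of the Rademacher function lie on the grid, where the distance vanishes.\<close>

lemma rad_grid_dist_continuous:
  assumes "i < a"
  shows "continuous_on UNIV (\<lambda>y. rad i y * grid_dist a y)"
proof -
  have "isCont (\<lambda>y. rad i y * grid_dist a y) y" for y
  proof (cases "2 ^ Suc i * y \<in> \<int>")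
    case True
    then have "2 ^ a * y \<in> \<int>" using grid_mono[of "Suc i" a y] assms by auto
    then have z: "grid_dist a y = 0" by (simp add: grid_dist_zero_iff)
    have "isCont (grid_dist a) y"
      using continuous_on_eq_continuous_at[THEN iffD1, OF open_UNIV grid_dist_continuous, of a] by blast
    then have "(grid_dist a \<longlongrightarrow> 0) (at y)" unfolding isCont_def z .
    then have "((\<lambda>z. rad i z * grid_dist a z) \<longlongrightarrow> 0) (at y)"
      by (rule Lim_null_comparison[rotated]) (auto simp: abs_mult rad_abs grid_dist_nonneg)
    then show ?thesis using z by (simp add: isCont_def)
  next
    case False
    have "isCont (\<lambda>z. rad i y * grid_dist a z) y"
      using continuous_on_eq_continuous_at[THEN iffD1, OF open_UNIV grid_dist_continuous, of a] by (intro continuous_intros) auto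
    moreover have "\<forall>\<^sub>F z in nhds y. rad i z * grid_dist a z = rad i y * grid_dist a z"
      using rad_locally_const[OF False lessI] by eventually_elim simp
    ultimately show ?thesis by (simp only: isCont_cong)
  qed
  then show ?thesis by (simp add: continuous_at_imp_continuous_on)
qed

lemma finite_grid: "finite {y::real. 0 < y \<and> y < 1 \<and> 2 ^ k * y \<in> \<int>}"
proof (rule finite_subset)
  show "{y::real. 0 < y \<and> y < 1 \<and> 2 ^ k * y \<in> \<int>} \<subseteq> (\<lambda>m. of_int m / 2 ^ k) ` {0..2 ^ k}"
  proof safe
    fix y :: real assume y: "0 < y" "y < 1" "2 ^ k * y \<in> \<int>"
    then obtain m where m: "2 ^ k * y = of_int m" by (auto elim: Ints_cases)
    then have "0 \<le> (of_int m :: real)" "(of_int m :: real) \<le> 2 ^ k" using y by (auto simp flip: m)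
    then have "m \<in> {0..2 ^ k}" using of_int_le_iff[of m "2 ^ k", where ?'a = real] by auto
    moreover have "y = of_int m / 2 ^ k" using m by (simp add: field_simps)
    ultimately show "y \<in> (\<lambda>m. of_int m / 2 ^ k) ` {0..2 ^ k}" by blast
  qed
qed simp

text \<open>Normalized to vanish at 0; the base point \<open>-1\<close> makes the derivative two-sided at 0.\<close>

definition grid_dist_int :: "nat \<Rightarrow> real \<Rightarrow> real" where
  "grid_dist_int a x = integral {-1..x} (grid_dist a) - integral {-1..0} (grid_dist a)"

text \<open>For \<open>a2 < a1\<close> this is, on \<open>[0, 1]\<close>, the antiderivative of \<open>rad a2 * grid_dist a1\<close>; it vanishes on the grid \<open>2\<^sup>-\<^sup>a\<^sup>2 \<int>\<close>. On the left half of each interval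
of that grid it increases like \<open>grid_dist_int a1\<close>, and the right half is the mirror image; this is the same as
composing with the distance to the grid.\<close>

definition hat :: "nat \<Rightarrow> nat \<Rightarrow> real \<Rightarrow> real" where "hat a1 a2 y = grid_dist_int a1 (grid_dist a2 y)"

lemma grid_dist_int_deriv: assumes "-1 < x" shows "(grid_dist_int a has_real_derivative grid_dist a x) (at x)"
proof -
  have "((\<lambda>x. integral {-1..x} (grid_dist a)) has_real_derivative grid_dist a x) (at x within {-1..x + 1})"
    using assms by (intro integral_has_real_derivative grid_dist_continuous) auto
  then have "((\<lambda>x. integral {-1..x} (grid_dist a)) has_real_derivative grid_dist a x) (at x)"
    using assms by (simp add: at_within_Icc_at)
  from DERIV_diff[OF this DERIV_const] show ?thesis unfolding grid_dist_int_def[abs_def] by simp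
qed

lemma grid_dist_int_0: "grid_dist_int a 0 = 0" by (simp add: grid_dist_int_def)

lemma grid_dist_int_mono: assumes "0 \<le> x" "x \<le> y" shows "grid_dist_int a x \<le> grid_dist_int a y"
  using assms by (intro DERIV_nonneg_imp_nondecreasing[OF assms(2)]) (auto intro!: exI[of _ "grid_dist a _"] grid_dist_int_deriv grid_dist_nonneg)

lemma grid_dist_int_nonneg: "0 \<le> x \<Longrightarrow> 0 \<le> grid_dist_int a x"
  using grid_dist_int_mono[of 0 x a] by (simp add: grid_dist_int_0)

lemma grid_dist_int_lipschitz: assumes "0 \<le> x" "0 \<le> y" shows "\<bar>grid_dist_int a y - grid_dist_int a x\<bar> \<le> \<bar>y - x\<bar> * (grid_dist a x + \<bar>y - x\<bar>)"
proof -
  have *: "\<exists>z. \<bar>z - x\<bar> \<le> \<bar>y - x\<bar> \<and> grid_dist_int a y - grid_dist_int a x = (y - x) * grid_dist a z"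
  proof -
    consider "x < y" | "x = y" | "y < x" by linarith
    then show ?thesis
    proof cases
      case 1
      then obtain z where "x < z" "z < y" "grid_dist_int a y - grid_dist_int a x = (y - x) * grid_dist a z"
        using MVT2[OF 1, of "grid_dist_int a" "grid_dist a"] assms grid_dist_int_deriv by (metis less_le_trans neg_less_0_iff_less zero_less_one)
      then show ?thesis by (intro exI[of _ z]) auto
    next
      case 3
      then obtain z where "y < z" "z < x" "grid_dist_int a x - grid_dist_int a y = (x - y) * grid_dist a z"
        using MVT2[OF 3, of "grid_dist_int a" "grid_dist a"] assms grid_dist_int_deriv by (metis less_le_trans neg_less_0_iff_less zero_less_one)
      then show ?thesis by (intro exI[of _ z]) (auto simp: algebra_simps)
    qed auto
  qed
  then obtain z where z: "\<bar>z - x\<bar> \<le> \<bar>y - x\<bar>" "grid_dist_int a y - grid_dist_int a x = (y - x) * grid_dist a z" by blast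
  have "grid_dist a z \<le> grid_dist a x + \<bar>y - x\<bar>" using grid_dist_lipschitz[of a z x] z(1) by linarith
  then show ?thesis unfolding z(2) abs_mult using grid_dist_nonneg[of a z] by (simp add: mult_left_mono)
qed

text \<open>A nonnegative function with Lipschitz constant 1 and value \<open>T\<close> at \<open>x \<ge> T\<close> has integral at least \<open>T\<^sup>2 / 2\<close> over
\<open>[x - T, x]\<close>.\<close>

lemma grid_dist_sq_le: assumes "0 \<le> x" shows "(grid_dist a x)\<^sup>2 \<le> 2 * grid_dist_int a x"
proof -
  let ?T = "grid_dist a x"
  define f where "f s = grid_dist_int a s - (?T - (x - s))\<^sup>2 / 2" for s
  have Tx: "0 \<le> x - ?T" using grid_dist_le_left[OF assms, of a] by simp
  have "f (x - ?T) \<le> f x"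
  proof (rule DERIV_nonneg_imp_nondecreasing[of "x - ?T" x f])
    show "x - ?T \<le> x" using grid_dist_nonneg[of a x] by simp
    fix s assume s: "x - ?T \<le> s" "s \<le> x"
    have "(f has_real_derivative (grid_dist a s - (?T - (x - s)))) (at s)"
      unfolding f_def[abs_def] using s Tx
      by (auto intro!: derivative_eq_intros grid_dist_int_deriv simp: field_simps)
    moreover have "0 \<le> grid_dist a s - (?T - (x - s))" using grid_dist_lipschitz[of a x s] s by simp
    ultimately show "\<exists>y. DERIV f s :> y \<and> y \<ge> 0" by blast
  qed
  moreover have "f (x - ?T) = grid_dist_int a (x - ?T)" by (simp add: f_def)
  ultimately show ?thesis using grid_dist_int_nonneg[OF Tx, of a] by (simp add: f_def)
qed

lemma hat_nonneg: "0 \<le> hat a1 a2 y"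
  unfolding hat_def by (intro grid_dist_int_nonneg grid_dist_nonneg)

lemma hat_le_grid_dist: "hat a1 a2 y \<le> grid_dist a2 y"
proof -
  have "hat a1 a2 y \<le> grid_dist a2 y * (grid_dist a1 0 + grid_dist a2 y)"
    using grid_dist_int_lipschitz[of 0 "grid_dist a2 y" a1] grid_dist_nonneg[of a2 y] unfolding hat_def by (simp add: grid_dist_int_0)
  also have "\<dots> \<le> grid_dist a2 y * 1"
    using grid_dist_le_half[of a1 0] grid_dist_le_half[of a2 y] grid_dist_nonneg[of a2 y] by (intro mult_left_mono) auto
  finally show ?thesis by simp
qed

lemma hat_sq: "a2 \<le> a1 \<Longrightarrow> (grid_dist a1 y)\<^sup>2 \<le> 2 * hat a1 a2 y"
  using grid_dist_sq_le[OF grid_dist_nonneg, of a1 a2 y] unfolding hat_def by (simp add: grid_dist_grid_dist)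

lemma hat_zero: "2 ^ a2 * y \<in> \<int> \<Longrightarrow> hat a1 a2 y = 0"
  using grid_dist_zero_iff[of a2 y] unfolding hat_def by (simp add: grid_dist_int_0)

text \<open>Off the grid of width \<open>2\<^sup>-\<^sup>a\<^sup>2 / 2\<close> this is the chain rule. On it \<open>grid_dist a1\<close> vanishes, so that \<open>hat\<close> varies only
quadratically.\<close>

lemma hat_deriv:
  assumes "a2 < a1" "0 < y"
  shows "(hat a1 a2 has_real_derivative rad a2 y * grid_dist a1 y) (at y)"
proof (cases "2 ^ Suc a2 * y \<in> \<int>")
  case False
  have "((\<lambda>y. grid_dist_int a1 (grid_dist a2 y)) has_real_derivative grid_dist a1 (grid_dist a2 y) * rad a2 y) (at y)"
    using grid_dist_nonneg[of a2 y] by (intro DERIV_chain2 grid_dist_int_deriv grid_dist_deriv assms False) auto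
  then show ?thesis using assms(1) unfolding hat_def[abs_def] by (simp add: grid_dist_grid_dist mult.commute)
next
  case True
  then have "2 ^ a1 * y \<in> \<int>" using grid_mono[of "Suc a2" a1 y] assms by auto
  then have z: "grid_dist a1 y = 0" by (simp add: grid_dist_zero_iff)
  have "(hat a1 a2 has_real_derivative 0) (at y)"
  proof (rule quadratic_imp_deriv_zero[where K = 1])
    fix s
    have "\<bar>hat a1 a2 s - hat a1 a2 y\<bar> \<le> \<bar>grid_dist a2 s - grid_dist a2 y\<bar> * (grid_dist a1 (grid_dist a2 y) + \<bar>grid_dist a2 s - grid_dist a2 y\<bar>)"
      unfolding hat_def by (intro grid_dist_int_lipschitz grid_dist_nonneg)
    also have "grid_dist a1 (grid_dist a2 y) = 0" using z assms by (simp add: grid_dist_grid_dist)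
    also have "\<bar>grid_dist a2 s - grid_dist a2 y\<bar> * (0 + \<bar>grid_dist a2 s - grid_dist a2 y\<bar>) \<le> \<bar>s - y\<bar> * \<bar>s - y\<bar>"
      unfolding add_0 by (rule mult_mono[OF grid_dist_lipschitz grid_dist_lipschitz abs_ge_zero abs_ge_zero])
    finally show "\<bar>hat a1 a2 s - hat a1 a2 y\<bar> \<le> 1 * \<bar>s - y\<bar>\<^sup>2"
      unfolding mult_1_left power2_eq_square .
  qed
  then show ?thesis using z by simp
qed

lemma hat_continuous: "continuous_on UNIV (hat a1 a2)"
proof -
  have "continuous_on {0..1} (grid_dist_int a1)"
  proof (rule DERIV_continuous_on)
    fix x :: real assume "x \<in> {0..1}"
    then have "(grid_dist_int a1 has_real_derivative grid_dist a1 x) (at x)" by (intro grid_dist_int_deriv) auto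
    then show "(grid_dist_int a1 has_real_derivative grid_dist a1 x) (at x within {0..1})"
      by (rule has_field_derivative_at_within)
  qed
  moreover have "grid_dist a2 ` UNIV \<subseteq> {0..1}"
  proof
    fix t assume "t \<in> grid_dist a2 ` UNIV"
    then obtain y where t: "t = grid_dist a2 y" by blast
    have "t \<le> 1" using grid_dist_le_half[of a2 y] unfolding t by linarith
    then show "t \<in> {0..1}" using grid_dist_nonneg[of a2 y] unfolding t by simp
  qed
  ultimately show ?thesis unfolding hat_def[abs_def]
    using continuous_on_compose2[OF _ grid_dist_continuous] by blast
qed

lemma bit_less_power: "l < 2 ^ a \<Longrightarrow> bit (l::nat) i \<Longrightarrow> i < a"
proof (rule ccontr)
  assume l: "l < 2 ^ a" "bit l i" "\<not> i < a"
  then have "(2::nat) ^ a \<le> 2 ^ i" by (intro power_increasing) auto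
  then have "l < 2 ^ i" using l by linarith
  then have "l div 2 ^ i = 0" by simp
  then show False using l by (simp add: bit_iff_odd)
qed

lemma bit_power_add: assumes "l < 2 ^ a" shows "bit (2 ^ a + l :: nat) i \<longleftrightarrow> i = a \<or> bit l i"
proof -
  consider "i < a" | "i = a" | "i > a" by linarith
  then show ?thesis
  proof cases
    case 1
    have e: "(2::nat) ^ a = 2 ^ i * 2 ^ (a - i)" using 1 by (simp flip: power_add)
    have "(2 ^ a + l) div 2 ^ i = 2 ^ (a - i) + l div 2 ^ i" unfolding e by simp
    moreover have "even ((2::nat) ^ (a - i))" using 1 by simp
    ultimately show ?thesis using 1 by (simp add: bit_iff_odd)
  next
    case 2
    have "(2 ^ a + l) div 2 ^ a = 1" using assms by simp
    then show ?thesis using 2 by (simp add: bit_iff_odd)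
  next
    case 3
    have "(2::nat) ^ Suc a \<le> 2 ^ i" using 3 by (intro power_increasing) auto
    then have "(2 ^ a + l) div 2 ^ i = 0" using assms by simp
    then have "\<not> bit (2 ^ a + l) i" by (simp add: bit_iff_odd)
    moreover have "\<not> bit l i" using bit_less_power[OF assms, of i] 3 by auto
    ultimately show ?thesis using 3 by auto
  qed
qed

lemma wal_prod: "wal k y = (\<Prod>i | bit k i. rad i y)"
  unfolding wal_def rad_def by (rule power_sum)

lemma finite_bits: "finite {i. bit (k::nat) i}"
proof (rule finite_subset)
  show "{i. bit k i} \<subseteq> {..<k}" using bit_less_power[OF less_exp] by auto
qed simp

lemma wal_0: "wal 0 y = 1" by (simp add: wal_prod)

lemma wal_power_add: assumes "l < 2 ^ a" shows "wal (2 ^ a + l) y = rad a y * wal l y"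
proof -
  have "{i. bit (2 ^ a + l) i} = insert a {i. bit l i}" using bit_power_add[OF assms] by auto
  moreover have "a \<notin> {i. bit l i}" using bit_less_power[OF assms] by auto
  ultimately show ?thesis unfolding wal_prod by (simp add: finite_bits)
qed

lemma wal_power: "wal (2 ^ a) y = rad a y"
  using wal_power_add[of 0 a y] by (simp add: wal_0)

text \<open>There are no carries, because the three summands have disjoint binary digits.\<close>

lemma wal_two_powers_add:
  assumes "a2 < a1" "l < 2 ^ a2"
  shows "wal ((2 ^ a1 + 2 ^ a2) + l) y = rad a1 y * (rad a2 y * wal l y)"
proof -
  have "2 ^ a2 + l < 2 ^ Suc a2" using assms by simp
  also have "\<dots> \<le> 2 ^ a1" using assms by (intro power_increasing) auto
  finally have "wal (2 ^ a1 + (2 ^ a2 + l)) y = rad a1 y * wal (2 ^ a2 + l) y" by (rule wal_power_add)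
  then show ?thesis using wal_power_add[OF assms(2)] by (simp add: add.assoc)
qed

lemma wal_abs: "\<bar>wal k y\<bar> = 1"
  unfolding wal_prod abs_prod by (simp add: rad_abs)

lemma wal_measurable [measurable]: "wal k \<in> borel_measurable borel"
  unfolding wal_prod[abs_def] by measurable

lemma wal_locally_const:
  assumes "l < 2 ^ a" "2 ^ a * y \<notin> \<int>"
  shows "\<forall>\<^sub>F z in nhds y. wal l z = wal l y"
proof -
  have "\<forall>\<^sub>F z in nhds y. \<forall>i\<in>{i. bit l i}. rad i z = rad i y"
    using rad_locally_const[OF assms(2)] bit_less_power[OF assms(1)]
    by (intro eventually_ball_finite finite_bits) auto
  then show ?thesis by eventually_elim (auto simp: wal_prod intro!: prod.cong)
qed

section \<open>Truncated antiderivatives of Walsh functions\<close>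

text \<open>For a coordinate in \<open>v\<close>: the truncated second antiderivative of the Walsh function of index
\<open>2 ^ a1 + 2 ^ a2 + l\<close>, followed by its first and second derivative.\<close>

definition twice0 :: "real \<Rightarrow> nat \<Rightarrow> nat \<Rightarrow> nat \<Rightarrow> real \<Rightarrow> real" where
  "twice0 n a1 a2 l y = wal l y * (cutoff (n * hat a1 a2 y) / n)"
definition twice1 :: "real \<Rightarrow> nat \<Rightarrow> nat \<Rightarrow> nat \<Rightarrow> real \<Rightarrow> real" where
  "twice1 n a1 a2 l y = wal l y * (cutoff1 (n * hat a1 a2 y) * (rad a2 y * grid_dist a1 y))"
definition twice2 :: "real \<Rightarrow> nat \<Rightarrow> nat \<Rightarrow> nat \<Rightarrow> real \<Rightarrow> real" where
  "twice2 n a1 a2 l y = wal l y * (n * cutoff2 (n * hat a1 a2 y) * (grid_dist a1 y)\<^sup>2 + cutoff1 (n * hat a1 a2 y) * (rad a2 y * rad a1 y))"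

lemma cutoff_measurable [measurable]: "cutoff \<in> borel_measurable borel" "cutoff1 \<in> borel_measurable borel" "cutoff2 \<in> borel_measurable borel"
  unfolding cutoff_def[abs_def] cutoff1_def[abs_def] cutoff2_def[abs_def] by measurable

lemma hat_measurable [measurable]: "hat a1 a2 \<in> borel_measurable borel"
  by (rule borel_measurable_continuous_onI[OF hat_continuous])

lemma twice_measurable [measurable]:
  "twice0 n a1 a2 l \<in> borel_measurable borel" "twice2 n a1 a2 l \<in> borel_measurable borel"
  unfolding twice0_def[abs_def] twice2_def[abs_def] by measurable

lemma cutoff_hat_deriv:
  assumes "a2 < a1" "0 < y" "0 < n"
  shows "((\<lambda>y. cutoff (n * hat a1 a2 y) / n) has_real_derivative cutoff1 (n * hat a1 a2 y) * (rad a2 y * grid_dist a1 y)) (at y)"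
    and "((\<lambda>y. cutoff1 (n * hat a1 a2 y)) has_real_derivative n * cutoff2 (n * hat a1 a2 y) * (rad a2 y * grid_dist a1 y)) (at y)"
proof -
  have h: "((\<lambda>y. n * hat a1 a2 y) has_real_derivative n * (rad a2 y * grid_dist a1 y)) (at y)"
    by (intro DERIV_cmult hat_deriv assms)
  have "((\<lambda>y. cutoff (n * hat a1 a2 y) / n) has_real_derivative cutoff1 (n * hat a1 a2 y) * (n * (rad a2 y * grid_dist a1 y)) / n) (at y)"
    by (intro DERIV_cdivide DERIV_chain2[OF cutoff_deriv h])
  then show "((\<lambda>y. cutoff (n * hat a1 a2 y) / n) has_real_derivative cutoff1 (n * hat a1 a2 y) * (rad a2 y * grid_dist a1 y)) (at y)"
    using assms(3) by simp
  have "((\<lambda>y. cutoff1 (n * hat a1 a2 y)) has_real_derivative cutoff2 (n * hat a1 a2 y) * (n * (rad a2 y * grid_dist a1 y))) (at y)"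
    by (rule DERIV_chain2[OF cutoff1_deriv h])
  then show "((\<lambda>y. cutoff1 (n * hat a1 a2 y)) has_real_derivative n * cutoff2 (n * hat a1 a2 y) * (rad a2 y * grid_dist a1 y)) (at y)"
    by (simp only: ac_simps)
qed

text \<open>Around the points where \<open>wal l\<close> jumps the truncated functions vanish identically.\<close>

lemma near_grid_small:
  assumes "2 ^ a2 * y \<in> \<int>" "0 < n"
  shows "\<forall>\<^sub>F z in nhds y. n * hat a1 a2 z \<le> 1"
proof -
  have "isCont (\<lambda>z. n * hat a1 a2 z) y"
    using continuous_on_eq_continuous_at[THEN iffD1, OF open_UNIV hat_continuous, of a1 a2] by (intro continuous_intros) auto
  then have lim: "((\<lambda>z. n * hat a1 a2 z) \<longlongrightarrow> n * hat a1 a2 y) (at y)"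
    by (simp add: isCont_def)
  have y: "n * hat a1 a2 y < 1" using hat_zero[OF assms(1)] by simp
  have "\<forall>\<^sub>F z in at y. n * hat a1 a2 z < 1" by (rule order_tendstoD(2)[OF lim y])
  then have "\<forall>\<^sub>F z in nhds y. n * hat a1 a2 z < 1" using y by (simp add: eventually_nhds_conv_at)
  then show ?thesis by eventually_elim simp
qed

lemma twice0_deriv:
  assumes "a2 < a1" "l < 2 ^ a2" "0 < y" "0 < n"
  shows "(twice0 n a1 a2 l has_real_derivative twice1 n a1 a2 l y) (at y)"
proof (cases "2 ^ a2 * y \<in> \<int>")
  case True
  have "\<forall>\<^sub>F z in nhds y. twice0 n a1 a2 l z = 0"
    using near_grid_small[OF True assms(4), of a1] by eventually_elim (simp add: twice0_def cutoff_le1)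
  moreover have "twice1 n a1 a2 l y = 0" using hat_zero[OF True] by (simp add: twice1_def cutoff_le1)
  ultimately show ?thesis by (simp add: DERIV_cong_ev[OF refl _ refl])
next
  case False
  have "\<forall>\<^sub>F z in nhds y. twice0 n a1 a2 l z = wal l y * (cutoff (n * hat a1 a2 z) / n)"
    using wal_locally_const[OF assms(2) False] by eventually_elim (simp add: twice0_def)
  moreover have "((\<lambda>z. wal l y * (cutoff (n * hat a1 a2 z) / n)) has_real_derivative twice1 n a1 a2 l y) (at y)"
    unfolding twice1_def by (intro DERIV_cmult cutoff_hat_deriv assms)
  ultimately show ?thesis by (subst DERIV_cong_ev[OF refl _ refl])
qed

lemma twice1_deriv:
  assumes "a2 < a1" "l < 2 ^ a2" "0 < y" "0 < n" "2 ^ Suc a1 * y \<notin> \<int>"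
  shows "(twice1 n a1 a2 l has_real_derivative twice2 n a1 a2 l y) (at y)"
proof -
  have "2 ^ a2 * y \<notin> \<int>" using assms(1,5) grid_mono[of a2 "Suc a1" y] by auto
  note w = wal_locally_const[OF assms(2) this]
  have r: "\<forall>\<^sub>F z in nhds y. rad a2 z = rad a2 y" using rad_locally_const[OF assms(5)] assms(1) by simp
  have "\<forall>\<^sub>F z in nhds y. twice1 n a1 a2 l z = wal l y * (cutoff1 (n * hat a1 a2 z) * (rad a2 y * grid_dist a1 z))"
    using w r by eventually_elim (simp add: twice1_def)
  moreover have "((\<lambda>z. wal l y * (cutoff1 (n * hat a1 a2 z) * (rad a2 y * grid_dist a1 z))) has_real_derivative
     wal l y * ((n * cutoff2 (n * hat a1 a2 y) * (rad a2 y * grid_dist a1 y)) * (rad a2 y * grid_dist a1 y) + (rad a2 y * rad a1 y) * cutoff1 (n * hat a1 a2 y))) (at y)"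
    by (intro DERIV_cmult DERIV_mult cutoff_hat_deriv(2) grid_dist_deriv assms)
  moreover have "wal l y * ((n * cutoff2 (n * hat a1 a2 y) * (rad a2 y * grid_dist a1 y)) * (rad a2 y * grid_dist a1 y) + (rad a2 y * rad a1 y) * cutoff1 (n * hat a1 a2 y))
     = twice2 n a1 a2 l y"
  proof -
    have "(n * cutoff2 (n * hat a1 a2 y) * (rad a2 y * grid_dist a1 y)) * (rad a2 y * grid_dist a1 y)
     = n * cutoff2 (n * hat a1 a2 y) * (grid_dist a1 y)\<^sup>2 * (rad a2 y * rad a2 y)" by (simp add: power2_eq_square)
    then show ?thesis unfolding twice2_def rad_sq mult_1_right by (simp only: mult.commute)
  qed
  ultimately show ?thesis by (subst DERIV_cong_ev[OF refl _ refl]) simp_all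
qed

lemma twice1_isCont:
  assumes "a2 < a1" "l < 2 ^ a2" "0 < n"
  shows "isCont (twice1 n a1 a2 l) y"
proof -
  have thr1c: "continuous_on UNIV cutoff1"
    using cutoff1_deriv DERIV_isCont continuous_at_imp_continuous_on by blast
  have c: "isCont (\<lambda>z. cutoff1 (n * hat a1 a2 z) * (rad a2 z * grid_dist a1 z)) y"
    by (intro continuous_on_interior[of UNIV] continuous_on_mult[OF continuous_on_compose2[OF thr1c]] rad_grid_dist_continuous assms
         continuous_on_mult[OF continuous_on_const hat_continuous]) auto
  show ?thesis
  proof (cases "2 ^ a2 * y \<in> \<int>")
    case True
    have "\<forall>\<^sub>F z in nhds y. twice1 n a1 a2 l z = 0"
      using near_grid_small[OF True assms(3), of a1] by eventually_elim (simp add: twice1_def cutoff_le1)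
    then show ?thesis by (simp only: isCont_cong) simp
  next
    case False
    have "\<forall>\<^sub>F z in nhds y. twice1 n a1 a2 l z = wal l y * (cutoff1 (n * hat a1 a2 z) * (rad a2 z * grid_dist a1 z))"
      using wal_locally_const[OF assms(2) False] by eventually_elim (simp add: twice1_def)
    then have "isCont (twice1 n a1 a2 l) y = isCont (\<lambda>z. wal l y * (cutoff1 (n * hat a1 a2 z) * (rad a2 z * grid_dist a1 z))) y"
      by (rule isCont_cong)
    with c show ?thesis by simp
  qed
qed

lemma twice0_le: "0 < n \<Longrightarrow> \<bar>twice0 n a1 a2 l y\<bar> \<le> hat a1 a2 y"
proof -
  assume n: "0 < n"
  then have h: "0 \<le> n * hat a1 a2 y" using hat_nonneg by simp
  have "\<bar>twice0 n a1 a2 l y\<bar> = cutoff (n * hat a1 a2 y) / n"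
    using n cutoff_bounds(1)[OF h] by (simp add: twice0_def abs_mult wal_abs)
  also have "\<dots> \<le> (n * hat a1 a2 y) / n" using n cutoff_bounds(2)[OF h] by (intro divide_right_mono) auto
  finally show ?thesis using n by simp
qed

text \<open>By \<open>(grid_dist a1 y)\<^sup>2 \<le> 2 * hat a1 a2 y\<close> the term with \<open>cutoff2\<close> is at most \<open>2 * (s * cutoff2 s) \<le> 12\<close> for
\<open>s = n * hat a1 a2 y\<close>, uniformly in \<open>n\<close>; the other term is at most 1.\<close>

lemma twice2_le: assumes "0 < n" "a2 \<le> a1" shows "\<bar>twice2 n a1 a2 l y\<bar> \<le> 13"
proof -
  let ?t = "n * hat a1 a2 y"
  have "n * cutoff2 ?t * (grid_dist a1 y)\<^sup>2 \<le> n * cutoff2 ?t * (2 * hat a1 a2 y)"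
    using assms cutoff2_bounds(1) by (intro mult_left_mono hat_sq) auto
  also have "\<dots> = 2 * (?t * cutoff2 ?t)" by simp
  also have "\<dots> \<le> 12" using cutoff2_bounds(2)[of ?t] by simp
  finally have 1: "n * cutoff2 ?t * (grid_dist a1 y)\<^sup>2 \<le> 12" .
  have 0: "0 \<le> n * cutoff2 ?t * (grid_dist a1 y)\<^sup>2" using assms cutoff2_bounds(1) by auto
  have 2: "\<bar>cutoff1 ?t * (rad a2 y * rad a1 y)\<bar> \<le> 1"
    using cutoff1_bounds[of ?t] by (simp add: abs_mult rad_abs)
  have "\<bar>n * cutoff2 ?t * (grid_dist a1 y)\<^sup>2 + cutoff1 ?t * (rad a2 y * rad a1 y)\<bar> \<le> 13"
    using 0 1 2 by linarith
  then show ?thesis unfolding twice2_def abs_mult wal_abs by simp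
qed

lemma twice_zero: "n * hat a1 a2 y \<le> 1 \<Longrightarrow> twice0 n a1 a2 l y = 0"
  "n * hat a1 a2 y \<le> 1 \<Longrightarrow> twice1 n a1 a2 l y = 0" "n * hat a1 a2 y \<le> 1 \<Longrightarrow> twice2 n a1 a2 l y = 0"
  by (simp_all add: twice0_def twice1_def twice2_def cutoff_le1)

lemma twice2_lim:
  assumes "a2 < a1" "2 ^ Suc a1 * y \<notin> \<int>"
  shows "(\<lambda>n. twice2 (real (Suc n)) a1 a2 l y) \<longlonglongrightarrow> rad a1 y * (rad a2 y * wal l y)"
proof -
  have "2 ^ a1 * y \<notin> \<int>" using assms grid_mono[of a1 "Suc a1" y] by auto
  then have "grid_dist a1 y \<noteq> 0" by (simp add: grid_dist_zero_iff)
  then have "0 < (grid_dist a1 y)\<^sup>2" by simp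
  then have h: "0 < hat a1 a2 y" using hat_sq[OF less_imp_le[OF assms(1)], of y] by linarith
  have "(\<lambda>n. wal l y * (real (Suc n) * cutoff2 (real (Suc n) * hat a1 a2 y) * (grid_dist a1 y)\<^sup>2
      + cutoff1 (real (Suc n) * hat a1 a2 y) * (rad a2 y * rad a1 y)))
    \<longlonglongrightarrow> wal l y * (0 * (grid_dist a1 y)\<^sup>2 + 1 * (rad a2 y * rad a1 y))"
    by (intro tendsto_mult tendsto_add tendsto_const cutoff1_lim cutoff2_lim h)
  then show ?thesis unfolding twice2_def by (simp only: mult_zero_left add_0 mult_1_left ac_simps)
qed

text \<open>For a coordinate in \<open>u - v\<close>: the truncated first antiderivative of \<open>rad a\<close> and its derivative.\<close>

definition once0 :: "real \<Rightarrow> nat \<Rightarrow> real \<Rightarrow> real" where "once0 n a y = cutoff (n * grid_dist a y) / n"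
definition once1 :: "real \<Rightarrow> nat \<Rightarrow> real \<Rightarrow> real" where "once1 n a y = cutoff1 (n * grid_dist a y) * rad a y"

lemma once_measurable [measurable]: "once1 n a \<in> borel_measurable borel"
  unfolding once1_def[abs_def] by measurable

lemma once0_deriv: "0 < n \<Longrightarrow> 0 < y \<Longrightarrow> 2 ^ Suc a * y \<notin> \<int> \<Longrightarrow> (once0 n a has_real_derivative once1 n a y) (at y)"
proof -
  assume a: "0 < n" "0 < y" "2 ^ Suc a * y \<notin> \<int>"
  have "((\<lambda>y. cutoff (n * grid_dist a y) / n) has_real_derivative cutoff1 (n * grid_dist a y) * (n * rad a y) / n) (at y)"
    by (intro DERIV_cdivide DERIV_chain2[OF cutoff_deriv] DERIV_cmult grid_dist_deriv a)
  then show ?thesis using a by (simp add: once0_def[abs_def] once1_def)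
qed

lemma once0_cont: "continuous_on UNIV (once0 n a)"
proof -
  have "continuous_on UNIV cutoff"
    using cutoff_deriv DERIV_isCont continuous_at_imp_continuous_on by blast
  moreover have "continuous_on UNIV (\<lambda>y. n * grid_dist a y)"
    by (intro continuous_on_mult continuous_on_const grid_dist_continuous)
  ultimately have "continuous_on UNIV (\<lambda>y. cutoff (n * grid_dist a y))"
    by (rule continuous_on_compose2) simp
  then show ?thesis unfolding once0_def[abs_def] divide_inverse
    by (rule continuous_on_mult[OF _ continuous_on_const])
qed

lemma once0_le: "0 < n \<Longrightarrow> \<bar>once0 n a y\<bar> \<le> 1 / 2 ^ Suc a"
proof -
  assume n: "0 < n"
  then have h: "0 \<le> n * grid_dist a y" using grid_dist_nonneg by simp
  have "\<bar>once0 n a y\<bar> = cutoff (n * grid_dist a y) / n" using n cutoff_bounds(1)[OF h] by (simp add: once0_def)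
  also have "\<dots> \<le> (n * grid_dist a y) / n" using n cutoff_bounds(2)[OF h] by (intro divide_right_mono) auto
  also have "\<dots> = grid_dist a y" using n by simp
  finally show ?thesis using grid_dist_half[of a y] by linarith
qed

lemma once1_le: "\<bar>once1 n a y\<bar> \<le> 1"
  using cutoff1_bounds[of "n * grid_dist a y"] by (simp add: once1_def abs_mult rad_abs)

lemma once0_zero: "n * grid_dist a y \<le> 1 \<Longrightarrow> once0 n a y = 0" "n * grid_dist a y \<le> 1 \<Longrightarrow> once1 n a y = 0"
  by (simp_all add: once0_def once1_def cutoff_le1)

lemma once1_lim:
  assumes "2 ^ Suc a * y \<notin> \<int>"
  shows "(\<lambda>n. once1 (real (Suc n)) a y) \<longlonglongrightarrow> rad a y"
proof -
  have "2 ^ a * y \<notin> \<int>" using assms grid_mono[of a "Suc a" y] by auto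
  then have "0 < grid_dist a y" using grid_dist_nonneg[of a y] grid_dist_zero_iff[of a y] by linarith
  from tendsto_mult[OF cutoff1_lim[OF this] tendsto_const[of "rad a y"]] show ?thesis
    unfolding once1_def by (simp only: mult_1_left)
qed

lemma lebesgue_FTC_finite_exceptions:
  fixes f g :: "real \<Rightarrow> real"
  assumes "finite S" "a \<le> b" "continuous_on {a..b} f"
    and d: "\<And>t. a < t \<Longrightarrow> t < b \<Longrightarrow> t \<notin> S \<Longrightarrow> (f has_real_derivative g t) (at t)"
    and [measurable]: "g \<in> borel_measurable borel" and B: "\<And>t. \<bar>g t\<bar> \<le> B"
  shows "(LBINT t:{a..b}. g t) = f b - f a"
proof -
  have "(g has_integral (f b - f a)) {a..b}"
    using d by (intro fundamental_theorem_of_calculus_interior_strong[OF assms(1,2) _ assms(3)])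
       (simp add: has_real_derivative_iff_has_vector_derivative)
  moreover have "set_integrable lborel {a..b} g"
    unfolding set_integrable_def
  proof (rule Bochner_Integration.integrable_bound)
    show "integrable lborel (\<lambda>t. B * indicator {a..b} t)" by (intro integrable_mult_right integrable_real_indicator) (auto simp: emeasure_lborel_Icc_eq)
    have "\<bar>g t\<bar> \<le> \<bar>B\<bar>" for t using B[of t] by linarith
    then show "AE t in lborel. norm (indicator {a..b} t *\<^sub>R g t) \<le> norm (B * indicator {a..b} t)"
      by (intro AE_I2) (auto simp: indicator_def)
  qed measurable
  ultimately show ?thesis
    using set_borel_integral_eq_integral(2) integral_unique by metis
qed

text \<open>To the left of the \<open>m\<close>-th interval both antiderivatives vanish, and inside it they are
\<open>rad a2 * grid_dist a1\<close> and \<open>hat a1 a2\<close> up to the normalizing factor, since these functions vanish at its left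
end point.\<close>

lemma W2_tilde_eq:
  assumes "a2 < a1" "0 < y" "y < 1"
  defines "m \<equiv> nat \<lfloor>2 ^ a2 * y\<rfloor>"
  shows "m < 2 ^ a2" and "W2_tilde a1 a2 m y = 2 powr (real a2 / 2) * hat a1 a2 y"
proof -
  define K :: real where "K = 2 powr (real a2 / 2)"
  define c where "c = real m / 2 ^ a2"
  have fl: "real m = of_int \<lfloor>2 ^ a2 * y\<rfloor>" using assms(2) by (simp add: m_def)
  have m1: "real m \<le> 2 ^ a2 * y" "2 ^ a2 * y < real m + 1" unfolding fl by (simp_all add: of_int_floor_le)
  have c: "0 \<le> c" "c \<le> y" "y < (real m + 1) / 2 ^ a2" using m1 unfolding c_def by (simp_all add: field_simps)
  have "real m < 2 ^ a2" using m1(1) assms(3) by (smt (verit) mult_less_cancel_left2 zero_less_power)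
  then show "m < 2 ^ a2" by (metis of_nat_less_iff of_nat_numeral of_nat_power)
  have gc: "2 ^ a2 * c \<in> \<int>" by (simp add: c_def)
  then have gc1: "2 ^ a1 * c \<in> \<int>" using grid_mono[of a2 a1 c] assms(1) by auto
  then have gc2: "2 ^ Suc a1 * c \<in> \<int>" using grid_mono[of a1 "Suc a1" c] by auto
  define q where "q t = rad a2 t * grid_dist a1 t" for t
  have q0: "q c = 0" using gc1 by (simp add: q_def grid_dist_zero_iff[symmetric])
  have qc: "continuous_on UNIV q" unfolding q_def[abs_def] using assms(1) by (rule rad_grid_dist_continuous)
  define f where "f t = K * (if t \<le> c then 0 else q t)" for t
  have fc: "continuous_on UNIV f"
  proof -
    have "continuous_on ({..c} \<union> {c..}) (\<lambda>t. if t \<le> c then 0 else q t)"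
      by (rule continuous_on_If) (use q0 qc in \<open>auto intro: continuous_on_subset\<close>)
    moreover have "{..c} \<union> {c..} = UNIV" by auto
    ultimately show ?thesis unfolding f_def[abs_def] by (intro continuous_intros) simp
  qed
  have mw: "w2 a1 a2 m \<in> borel_measurable borel" unfolding w2_def[abs_def] by measurable
  have w2b: "\<bar>w2 a1 a2 m t\<bar> \<le> K" for t unfolding w2_def K_def by (auto simp: abs_mult wal_abs indicator_def)
  have W2: "W2 a1 a2 m x = f x" if x: "0 \<le> x" "x \<le> y" for x
  proof -
    have "(LBINT t:{0..x}. w2 a1 a2 m t) = f x - f 0"
    proof (rule lebesgue_FTC_finite_exceptions[OF finite_grid[of "Suc a1"] x(1) _ _ mw w2b])
      show "continuous_on {0..x} f" using fc by (rule continuous_on_subset) auto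
      fix t assume t: "0 < t" "t < x" "t \<notin> {y. 0 < y \<and> y < 1 \<and> 2 ^ Suc a1 * y \<in> \<int>}"
      then have g: "2 ^ Suc a1 * t \<notin> \<int>" using x assms(3) by auto
      then have tc: "t \<noteq> c" using gc2 by auto
      show "(f has_real_derivative w2 a1 a2 m t) (at t)"
      proof (cases "t < c")
        case True
        have "((\<lambda>_. 0) has_real_derivative 0) (at t)" by simp
        then have "(f has_real_derivative 0) (at t)"
          by (rule has_field_derivative_transform_within_open[of _ _ _ "{..<c}"]) (use True in \<open>auto simp: f_def\<close>)
        moreover have "w2 a1 a2 m t = 0" using True by (simp add: w2_def c_def)
        ultimately show ?thesis by simp
      next
        case False
        then have "c < t" using tc by simp
        have "\<forall>\<^sub>F z in nhds t. z \<in> {c<..}" using \<open>c < t\<close> by (intro eventually_nhds_in_open) auto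
        moreover have "\<forall>\<^sub>F z in nhds t. rad a2 z = rad a2 t" using rad_locally_const[OF g] assms(1) by simp
        ultimately have "\<forall>\<^sub>F z in nhds t. f z = K * (rad a2 t * grid_dist a1 z)"
          by eventually_elim (simp add: f_def q_def)
        moreover have "((\<lambda>z. K * (rad a2 t * grid_dist a1 z)) has_real_derivative K * (rad a2 t * rad a1 t)) (at t)"
          by (intro DERIV_cmult grid_dist_deriv t g)
        moreover have "w2 a1 a2 m t = K * (rad a2 t * rad a1 t)"
        proof -
          have "t \<in> {real m / 2 ^ a2 ..< (real m + 1) / 2 ^ a2}" using \<open>c < t\<close> t x c by (simp add: c_def)
          moreover have "wal (2 ^ a1 + 2 ^ a2) t = rad a1 t * rad a2 t"
            using wal_two_powers_add[OF assms(1), of 0 t] by (simp add: wal_0)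
          ultimately show ?thesis by (simp add: w2_def K_def)
        qed
        ultimately show ?thesis by (simp add: DERIV_cong_ev[OF refl _ refl])
      qed
    qed
    moreover have "f 0 = 0" using c by (simp add: f_def)
    ultimately show ?thesis by (simp add: W2_def)
  qed
  define g where "g t = K * (if t \<le> c then 0 else hat a1 a2 t)" for t
  have h0: "hat a1 a2 c = 0" using gc by (rule hat_zero)
  have gcont: "continuous_on UNIV g"
  proof -
    have "continuous_on ({..c} \<union> {c..}) (\<lambda>t. if t \<le> c then 0 else hat a1 a2 t)"
      by (rule continuous_on_If) (use h0 hat_continuous in \<open>auto intro: continuous_on_subset\<close>)
    moreover have "{..c} \<union> {c..} = UNIV" by auto
    ultimately show ?thesis unfolding g_def[abs_def] by (intro continuous_intros) simp
  qed
  have "W2_tilde a1 a2 m y = (LBINT t:{0..y}. f t)"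
    unfolding W2_tilde_def by (rule set_lebesgue_integral_cong) (auto simp: W2)
  also have "\<dots> = g y - g 0"
  proof (rule lebesgue_FTC_finite_exceptions[of "{c}" _ _ _ _ "K"])
    show "continuous_on {0..y} g" using gcont by (rule continuous_on_subset) auto
    show "f \<in> borel_measurable borel" using fc by (rule borel_measurable_continuous_onI)
    show "\<bar>f t\<bar> \<le> K" for t
      using grid_dist_le_half[of a1 t] grid_dist_nonneg[of a1 t] by (simp add: f_def q_def abs_mult rad_abs K_def)
    fix t assume t: "0 < t" "t \<notin> {c}"
    show "(g has_real_derivative f t) (at t)"
    proof (cases "t < c")
      case True
      have "((\<lambda>_. 0) has_real_derivative 0) (at t)" by simp
      then have "(g has_real_derivative 0) (at t)"
        by (rule has_field_derivative_transform_within_open[of _ _ _ "{..<c}"]) (use True in \<open>auto simp: g_def\<close>)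
      then show ?thesis using True by (simp add: f_def)
    next
      case False
      then have "c < t" using t by simp
      have "((\<lambda>t. K * hat a1 a2 t) has_real_derivative K * (rad a2 t * grid_dist a1 t)) (at t)"
        by (intro DERIV_cmult hat_deriv assms t)
      then have "(g has_real_derivative K * (rad a2 t * grid_dist a1 t)) (at t)"
        by (rule has_field_derivative_transform_within_open[of _ _ _ "{c<..}"]) (use \<open>c < t\<close> in \<open>auto simp: g_def\<close>)
      then show ?thesis using \<open>c < t\<close> by (simp add: f_def q_def)
    qed
  qed (use assms in auto)
  also have "\<dots> = K * hat a1 a2 y"
    using c h0 by (cases "y = c") (auto simp: g_def)
  finally show "W2_tilde a1 a2 m y = 2 powr (real a2 / 2) * hat a1 a2 y" unfolding K_def .
qed

lemma Phi_deriv: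
  assumes "continuous_on UNIV \<phi>" "integrable lborel \<phi>"
  shows "(Phi \<phi> has_real_derivative \<phi> x) (at x)"
proof -
  have si: "set_integrable lborel A \<phi>" if "A \<in> sets borel" for A
    unfolding set_integrable_def using assms(2) that by (intro integrable_mult_indicator) auto
  have eq: "Phi \<phi> z = Phi \<phi> (x - 1) + integral {x - 1..z} \<phi>" if "x - 1 \<le> z" for z
  proof -
    have "(LBINT t:{..z}. \<phi> t) = (LBINT t:{..x - 1} \<union> {x - 1<..z}. \<phi> t)"
      using that by (intro arg_cong2[of _ _ _ _ "\<lambda>A f. set_lebesgue_integral lborel A f"]) auto
    also have "\<dots> = (LBINT t:{..x - 1}. \<phi> t) + (LBINT t:{x - 1<..z}. \<phi> t)"
      by (rule set_integral_Un) (auto intro: si)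
    also have "(LBINT t:{x - 1<..z}. \<phi> t) = (LBINT t:{x - 1..z}. \<phi> t)"
    proof (rule set_integral_null_delta)
      show "integrable lborel \<phi>" by fact
      have sub: "sym_diff {x - 1<..z} {x - 1..z} \<subseteq> {x - 1}" by auto
      show "sym_diff {x - 1<..z} {x - 1..z} \<in> null_sets lborel"
        by (rule finite_imp_null_set_lborel[OF finite_subset[OF sub]]) simp
    qed auto
    also have "\<dots> = integral {x - 1..z} \<phi>" by (rule set_borel_integral_eq_integral(2)[OF si]) auto
    finally show ?thesis unfolding Phi_def .
  qed
  have "((\<lambda>z. integral {x - 1..z} \<phi>) has_real_derivative \<phi> x) (at x within {x - 1..x + 1})"
    using assms(1) by (intro integral_has_real_derivative) (auto intro: continuous_on_subset)
  then have "((\<lambda>z. integral {x - 1..z} \<phi>) has_real_derivative \<phi> x) (at x)"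
    by (simp add: at_within_Icc_at)
  from DERIV_add[OF DERIV_const[of "Phi \<phi> (x - 1)"] this]
  have "((\<lambda>z. Phi \<phi> (x - 1) + integral {x - 1..z} \<phi>) has_real_derivative \<phi> x) (at x)" by simp
  then show ?thesis
  proof (rule has_field_derivative_transform_within_open[of _ _ _ "{x - 1<..}"])
    fix z assume "z \<in> {x - 1<..}"
    then show "Phi \<phi> (x - 1) + integral {x - 1..z} \<phi> = Phi \<phi> z" by (intro eq[symmetric]) simp
  qed simp_all
qed

section \<open>The bound on the Walsh coefficients\<close>

text \<open>A derivative is a pointwise limit of difference quotients.\<close>

lemma borel_measurable_deriv:
  fixes f :: "real \<Rightarrow> real"
  assumes [measurable]: "f \<in> borel_measurable borel" and d: "\<And>x. f differentiable (at x)"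
  shows "deriv f \<in> borel_measurable borel"
proof (rule borel_measurable_LIMSEQ_real)
  show "(\<lambda>x. (f (x + inverse (real (Suc n))) - f x) / inverse (real (Suc n))) \<in> borel_measurable borel" for n
    by measurable
  fix x
  have "DERIV f x :> deriv f x" using d[of x] by (simp add: DERIV_deriv_iff_real_differentiable)
  then have "((\<lambda>h. (f (x + h) - f x) / h) \<longlongrightarrow> deriv f x) (at 0)" by (simp add: DERIV_def)
  moreover have "filterlim (\<lambda>n. inverse (real (Suc n))) (at 0) sequentially"
    unfolding filterlim_at using LIMSEQ_inverse_real_of_nat by (auto intro!: always_eventually)
  ultimately show "(\<lambda>n. (f (x + inverse (real (Suc n))) - f x) / inverse (real (Suc n))) \<longlonglongrightarrow> deriv f x"
    by (rule filterlim_compose)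
qed

lemma AE_component_not_in_finite:
  assumes "finite S"
  shows "AE x in leb (UNIV :: 's::finite set). x j \<notin> S"
proof -
  let ?A = "PiE UNIV (\<lambda>i. if i = j then S else UNIV) :: ('s \<Rightarrow> real) set"
  have S: "S \<in> sets lborel" "emeasure lborel S = 0"
    using finite_imp_null_set_lborel[OF assms] by auto
  have "?A \<in> sets (leb UNIV)" using S by (intro sets_PiM_I_finite) auto
  moreover have "emeasure (leb UNIV) ?A = (\<Prod>i\<in>UNIV. emeasure lborel (if i = j then S else UNIV))"
    using S by (intro lebesgue_product.emeasure_PiM) auto
  moreover have "\<dots> = 0" using S by (intro prod_zero) (auto intro!: bexI[of _ j])
  ultimately have "?A \<in> null_sets (leb UNIV)" by auto
  then show ?thesis by (rule AE_I'[rotated 0]) auto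
qed

text \<open>The interval that contains \<open>Phi \<phi> t\<close> determines the index \<open>m\<close> for which Assumption A is used.\<close>

lemma assumption_A_hat:
  assumes A: "assumption_A \<phi> \<psi> \<omega> C \<beta>" and "a2 < a1" and \<Phi>: "0 < Phi \<phi> t" "Phi \<phi> t < 1"
    and pos: "0 < \<phi> t" "0 < \<psi> t" "0 < \<omega> t"
  shows "hat a1 a2 (Phi \<phi> t) \<le> C / 2 powr (real a1 + \<beta> * real a2) * (\<phi> t * \<psi> t)"
    and "hat a1 a2 (Phi \<phi> t) * \<bar>deriv \<phi> t\<bar> \<le> C / 2 powr (real a1 + \<beta> * real a2) * ((\<phi> t)\<^sup>2 * \<omega> t)"
proof -
  define m where "m = nat \<lfloor>2 ^ a2 * Phi \<phi> t\<rfloor>"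
  define K :: real where "K = 2 powr (real a2 / 2)"
  define P :: real where "P = 2 powr (real a1 + \<beta> * real a2)"
  have K: "0 < K" by (simp add: K_def)
  have m: "m < 2 ^ a2" and W: "W2_phi \<phi> a1 a2 m t = K * hat a1 a2 (Phi \<phi> t)"
    using W2_tilde_eq[OF assms(2) \<Phi>] by (simp_all add: m_def K_def W2_phi_def)
  have s: "(SUP x. ereal (\<bar>W2_phi \<phi> a1 a2 m x\<bar> / (\<phi> x * \<psi> x))) \<le> ereal (C * (K / P))"
    "(SUP x. ereal (\<bar>W2_phi \<phi> a1 a2 m x * deriv \<phi> x\<bar> / ((\<phi> x)\<^sup>2 * \<omega> x))) \<le> ereal (C * (K / P))"
    using A assms(2) m unfolding assumption_A_def K_def P_def by blast+
  have "ereal (\<bar>W2_phi \<phi> a1 a2 m t\<bar> / (\<phi> t * \<psi> t)) \<le> ereal (C * (K / P))"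
    by (rule order_trans[OF SUP_upper s(1)]) simp
  then have 1: "\<bar>K * hat a1 a2 (Phi \<phi> t)\<bar> / (\<phi> t * \<psi> t) \<le> C * (K / P)" unfolding W by simp
  have "ereal (\<bar>W2_phi \<phi> a1 a2 m t * deriv \<phi> t\<bar> / ((\<phi> t)\<^sup>2 * \<omega> t)) \<le> ereal (C * (K / P))"
    by (rule order_trans[OF SUP_upper s(2)]) simp
  then have 2: "\<bar>K * hat a1 a2 (Phi \<phi> t) * deriv \<phi> t\<bar> / ((\<phi> t)\<^sup>2 * \<omega> t) \<le> C * (K / P)" unfolding W by simp
  have h: "0 \<le> hat a1 a2 (Phi \<phi> t)" by (rule hat_nonneg)
  have p: "0 < \<phi> t * \<psi> t" "0 < (\<phi> t)\<^sup>2 * \<omega> t" using pos by auto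
  have "K * hat a1 a2 (Phi \<phi> t) \<le> C * (K / P) * (\<phi> t * \<psi> t)"
    using 1 p(1) K h by (simp add: pos_divide_le_eq abs_mult)
  then have "K * hat a1 a2 (Phi \<phi> t) \<le> K * (C / P * (\<phi> t * \<psi> t))" by (simp add: ac_simps)
  then show "hat a1 a2 (Phi \<phi> t) \<le> C / 2 powr (real a1 + \<beta> * real a2) * (\<phi> t * \<psi> t)"
    using K unfolding P_def[symmetric] by (simp only: mult_le_cancel_left_pos)
  have "K * (hat a1 a2 (Phi \<phi> t) * \<bar>deriv \<phi> t\<bar>) \<le> C * (K / P) * ((\<phi> t)\<^sup>2 * \<omega> t)"
    using 2 p(2) K h by (simp add: pos_divide_le_eq abs_mult mult.assoc)
  then have "K * (hat a1 a2 (Phi \<phi> t) * \<bar>deriv \<phi> t\<bar>) \<le> K * (C / P * ((\<phi> t)\<^sup>2 * \<omega> t))" by (simp add: ac_simps)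
  then show "hat a1 a2 (Phi \<phi> t) * \<bar>deriv \<phi> t\<bar> \<le> C / 2 powr (real a1 + \<beta> * real a2) * ((\<phi> t)\<^sup>2 * \<omega> t)"
    using K unfolding P_def[symmetric] by (simp only: mult_le_cancel_left_pos)
qed

text \<open>The last part is what gives truncated antiderivatives, composed with \<open>Phi \<phi>\<close>, compact support in \<open>\<real>\<close>.\<close>

lemma prob_density_Phi:
  assumes "prob_density \<phi>"
  shows "0 < Phi \<phi> t" "Phi \<phi> t < 1" "(Phi \<phi> has_real_derivative \<phi> t) (at t)"
    and "s \<le> t \<Longrightarrow> Phi \<phi> s \<le> Phi \<phi> t"
    and "finite {t. 2 ^ k * Phi \<phi> t \<in> \<int>}"
    and "0 < N \<Longrightarrow> \<exists>r. \<forall>t. r \<le> \<bar>t\<bar> \<longrightarrow> N * Phi \<phi> t \<le> 1 \<or> N * (1 - Phi \<phi> t) \<le> 1"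
proof -
  have bij: "bij_betw (Phi \<phi>) UNIV {0<..<1}" using assms by (simp add: prob_density_def)
  then have "Phi \<phi> t \<in> {0<..<1}" for t by (auto simp: bij_betw_def)
  then show b: "0 < Phi \<phi> t" "Phi \<phi> t < 1" for t by auto
  show d: "(Phi \<phi> has_real_derivative \<phi> t) (at t)" for t
    using assms prob_density_continuous[OF assms] by (intro Phi_deriv) (auto simp: prob_density_def)
  show mono: "Phi \<phi> s \<le> Phi \<phi> t" if "s \<le> t" for s t
  proof (rule DERIV_nonneg_imp_nondecreasing[OF that])
    fix x
    have "0 \<le> \<phi> x" using assms by (simp add: prob_density_def less_imp_le)
    then show "\<exists>y. DERIV (Phi \<phi>) x :> y \<and> 0 \<le> y" using d[of x] by blast
  qed
  have inj: "inj (Phi \<phi>)" using bij by (simp add: bij_betw_def)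
  have "finite (Phi \<phi> -` {y. 0 < y \<and> y < 1 \<and> 2 ^ k * y \<in> \<int>})"
    by (rule finite_vimageI[OF finite_grid inj])
  moreover have "Phi \<phi> -` {y. 0 < y \<and> y < 1 \<and> 2 ^ k * y \<in> \<int>} = {t. 2 ^ k * Phi \<phi> t \<in> \<int>}" using b by auto
  ultimately show "finite {t. 2 ^ k * Phi \<phi> t \<in> \<int>}" by simp
  assume N: "0 < N"
  have mem: "1 / (N + 1) \<in> {0<..<1}" "1 - 1 / (N + 1) \<in> {0<..<1}" using N by (auto simp: field_simps)
  have surj: "Phi \<phi> ` UNIV = {0<..<1}" using bij by (simp add: bij_betw_def)
  \<comment> \<open>any level in \<open>(0, 1)\<close> below \<open>1 / N\<close> serves\<close>
  obtain p where p: "Phi \<phi> p = 1 / (N + 1)" using mem(1) unfolding surj[symmetric] by (metis imageE)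
  obtain q where q: "Phi \<phi> q = 1 - 1 / (N + 1)" using mem(2) unfolding surj[symmetric] by (metis imageE)
  have N1: "N * (1 / (N + 1)) \<le> 1" using N by (simp add: field_simps)
  show "\<exists>r. \<forall>t. r \<le> \<bar>t\<bar> \<longrightarrow> N * Phi \<phi> t \<le> 1 \<or> N * (1 - Phi \<phi> t) \<le> 1"
  proof (intro exI[of _ "max \<bar>p\<bar> \<bar>q\<bar>"] allI impI)
    fix t assume t: "max \<bar>p\<bar> \<bar>q\<bar> \<le> \<bar>t\<bar>"
    show "N * Phi \<phi> t \<le> 1 \<or> N * (1 - Phi \<phi> t) \<le> 1"
    proof (cases "0 \<le> t")
      case True
      then have "Phi \<phi> q \<le> Phi \<phi> t" using t by (intro mono) linarith
      then have "N * (1 - Phi \<phi> t) \<le> N * (1 / (N + 1))" using N unfolding q by (intro mult_left_mono) auto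
      then show ?thesis using N1 by linarith
    next
      case False
      then have "Phi \<phi> t \<le> Phi \<phi> p" using t by (intro mono) linarith
      then have "N * Phi \<phi> t \<le> N * (1 / (N + 1))" using N unfolding p by (intro mult_left_mono) auto
      then show ?thesis using N1 by linarith
    qed
  qed
qed

theorem lemma5:
  fixes \<phi> \<psi> \<omega> :: "real \<Rightarrow> real" and C \<beta> :: real
    and F :: "real ^ 's::finite \<Rightarrow> real"
    and u v :: "'s set" and a1 a2 l y :: "'s \<Rightarrow> nat"
  assumes "prob_density \<phi>" and "weight_function \<psi>" and "weight_function \<omega>"
    and "C > 0" and "0 < \<beta>" and "\<beta> \<le> 1"
    and "assumption_A \<phi> \<psi> \<omega> C \<beta>"
    and "in_L2 \<phi> F"
    and "sufficiently_smooth F"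
    and "v \<subseteq> u" and "u \<noteq> {}"
    and "inner_integrals_converge \<phi> F u v"
    and "\<And>j. j \<in> v \<Longrightarrow> a2 j < a1 j \<and> l j < 2 ^ a2 j \<and> y j = (2 ^ a1 j + 2 ^ a2 j) + l j"
    and "\<And>j. j \<in> u - v \<Longrightarrow> y j = 2 ^ a1 j"
    and "\<And>j. j \<notin> u \<Longrightarrow> y j = 0"
  shows "ennreal \<bar>walsh_coeff \<phi> F y\<bar>
    \<le> ennreal (max C (1 / 2) ^ card u) * norm_uv \<phi> \<psi> \<omega> F u v
      * ennreal (\<Prod>j\<in>v. 1 / 2 powr (real (a1 j) + \<beta> * real (a2 j)))
      * ennreal (\<Prod>j\<in>u - v. 1 / 2 ^ a1 j)"
proof -
  have \<phi>: "prob_density \<phi>" by fact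
  have pos: "0 < \<phi> t" "0 < \<psi> t" "0 < \<omega> t" for t
    using assms(1-3) by (auto simp: prob_density_def weight_function_def)
  note \<Phi> = prob_density_Phi[OF \<phi>]
  have d\<phi>: "(\<phi> has_real_derivative deriv \<phi> t) (at t)" for t
    using \<phi> by (simp add: prob_density_def DERIV_deriv_iff_real_differentiable)
  have [measurable]: "\<phi> \<in> borel_measurable borel" by (rule prob_density_measurable[OF \<phi>])
  have [measurable]: "deriv \<phi> \<in> borel_measurable borel"
    using \<phi> by (intro borel_measurable_deriv) (auto simp: prob_density_def)
  have \<Phi>c: "continuous_on UNIV (Phi \<phi>)"
    using \<Phi>(3) DERIV_isCont continuous_at_imp_continuous_on by blast
  have [measurable]: "Phi \<phi> \<in> borel_measurable borel"
    by (rule borel_measurable_continuous_onI[OF \<Phi>c])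
  have [measurable]: "F \<in> borel_measurable borel" using assms(8) by (simp add: in_L2_def)
  define L where "L = leb (UNIV :: 's set)"
  define c where "c j = (if j \<in> v then C / 2 powr (real (a1 j) + \<beta> * real (a2 j)) else 1 / 2 ^ Suc (a1 j))" for j
  define b where "b n j t = (if j \<in> v then twice2 (real (Suc n)) (a1 j) (a2 j) (l j) (Phi \<phi> t)
      else once1 (real (Suc n)) (a1 j) (Phi \<phi> t)) * \<phi> t" for n :: nat and j t
  have vj: "a2 j < a1 j" "l j < 2 ^ a2 j" "y j = (2 ^ a1 j + 2 ^ a2 j) + l j" if "j \<in> v" for j
    using assms(13)[OF that] by auto
  have mb[measurable]: "b n j \<in> borel_measurable borel" for n j
    unfolding b_def[abs_def] by (cases "j \<in> v") simp_all
  have b13: "\<bar>b n j t\<bar> \<le> 13 * \<phi> t" for n j t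
  proof -
    have "\<bar>if j \<in> v then twice2 (real (Suc n)) (a1 j) (a2 j) (l j) (Phi \<phi> t) else once1 (real (Suc n)) (a1 j) (Phi \<phi> t)\<bar> \<le> 13"
      using twice2_le[of "real (Suc n)" "a2 j" "a1 j" "l j" "Phi \<phi> t"] vj(1)[of j]
        once1_le[of "real (Suc n)" "a1 j" "Phi \<phi> t"] by (auto simp del: of_nat_Suc)
    then show ?thesis unfolding b_def abs_mult using pos(1)[of t] by (simp add: mult_right_mono)
  qed
  have cpos: "0 < c j" for j using assms(4) by (simp add: c_def)
  have bound: "ennreal \<bar>\<integral>x. F (vec_lambda x) * ((\<Prod>j\<in>u. b n j (x j)) * (\<Prod>j\<in>-u. \<phi> (x j))) \<partial>L\<bar>
    \<le> ennreal (\<Prod>j\<in>u. c j) * norm_uv \<phi> \<psi> \<omega> F u v" for n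
  proof -
    define N where "N = real (Suc n)"
    have N: "0 < N" by (simp add: N_def)
    obtain r where r: "\<And>t. r \<le> \<bar>t\<bar> \<Longrightarrow> N * Phi \<phi> t \<le> 1 \<or> N * (1 - Phi \<phi> t) \<le> 1"
      using \<Phi>(6)[OF N] by blast
    have tri0: "N * grid_dist a (Phi \<phi> t) \<le> 1" if "r \<le> \<bar>t\<bar>" for a t
    proof -
      have "N * grid_dist a (Phi \<phi> t) \<le> N * Phi \<phi> t" "N * grid_dist a (Phi \<phi> t) \<le> N * (1 - Phi \<phi> t)"
        using N \<Phi>(1,2)[of t] by (auto intro!: mult_left_mono grid_dist_le_left grid_dist_le_right)
      then show ?thesis using r[OF that] by linarith
    qed
    have hat0: "N * hat a a' (Phi \<phi> t) \<le> 1" if "r \<le> \<bar>t\<bar>" for a a' t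
      using mult_left_mono[OF hat_le_grid_dist[of a a' "Phi \<phi> t"], of N] N tri0[OF that, of a'] by linarith
    \<comment> \<open>\<open>G\<close> is the antiderivative divided by the density; differentiating the quotient leaves the remainder \<open>R\<close>\<close>
    define \<kappa> where "\<kappa> j t = (if j \<in> v then twice1 N (a1 j) (a2 j) (l j) (Phi \<phi> t) else once0 N (a1 j) (Phi \<phi> t))" for j t
    define G where "G j t = twice0 N (a1 j) (a2 j) (l j) (Phi \<phi> t) / \<phi> t" for j t
    define R where "R j t = twice0 N (a1 j) (a2 j) (l j) (Phi \<phi> t) * deriv \<phi> t / (\<phi> t)\<^sup>2" for j t
    show ?thesis unfolding L_def
    proof (rule kernel_bound[where \<kappa>=\<kappa> and G=G and R=R and r=r and B=13 and S="\<lambda>j. {t. 2 ^ Suc (a1 j) * Phi \<phi> t \<in> \<int>}"])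
      fix j assume j: "j \<in> u"
      show "continuous_on UNIV (\<kappa> j)"
      proof (cases "j \<in> v")
        case True
        have "continuous_on UNIV (twice1 N (a1 j) (a2 j) (l j))"
          using twice1_isCont[OF vj(1,2)[OF True] N] by (simp add: continuous_at_imp_continuous_on)
        then have "continuous_on UNIV (\<lambda>t. twice1 N (a1 j) (a2 j) (l j) (Phi \<phi> t))"
          by (rule continuous_on_compose2[OF _ \<Phi>c]) simp
        then show ?thesis using True by (simp add: \<kappa>_def[abs_def])
      next
        case False
        have "continuous_on UNIV (\<lambda>t. once0 N (a1 j) (Phi \<phi> t))"
          by (rule continuous_on_compose2[OF once0_cont \<Phi>c]) simp
        then show ?thesis using False by (simp add: \<kappa>_def[abs_def])
      qed
      show "\<kappa> j t = 0" if "r \<le> \<bar>t\<bar>" for t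
        using twice_zero(2)[OF hat0[OF that]] once0_zero(1)[OF tri0[OF that]] by (simp add: \<kappa>_def)
      show "b n j t = 0" if "r \<le> \<bar>t\<bar>" for t
        using twice_zero(3)[OF hat0[OF that]] once0_zero(2)[OF tri0[OF that]] by (simp add: b_def N_def[symmetric] del: of_nat_Suc)
      show "b n j \<in> borel_measurable borel" by (rule mb)
      show "\<bar>b n j t\<bar> \<le> 13 * \<phi> t" for t by (rule b13)
      show "finite {t. 2 ^ Suc (a1 j) * Phi \<phi> t \<in> \<int>}" by (rule \<Phi>(5))
      show "0 < c j" by (rule cpos)
      fix t assume t: "t \<notin> {t. 2 ^ Suc (a1 j) * Phi \<phi> t \<in> \<int>}"
      then have t': "2 ^ Suc (a1 j) * Phi \<phi> t \<notin> \<int>" by simp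
      show "(\<kappa> j has_real_derivative b n j t) (at t)"
      proof (cases "j \<in> v")
        case True
        have "((\<lambda>t. twice1 N (a1 j) (a2 j) (l j) (Phi \<phi> t)) has_real_derivative twice2 N (a1 j) (a2 j) (l j) (Phi \<phi> t) * \<phi> t) (at t)"
          by (rule DERIV_chain2[OF twice1_deriv[OF vj(1,2)[OF True] \<Phi>(1) N t'] \<Phi>(3)])
        then show ?thesis using True by (simp add: \<kappa>_def[abs_def] b_def N_def[symmetric] del: of_nat_Suc)
      next
        case False
        have "((\<lambda>t. once0 N (a1 j) (Phi \<phi> t)) has_real_derivative once1 N (a1 j) (Phi \<phi> t) * \<phi> t) (at t)"
          by (rule DERIV_chain2[OF once0_deriv[OF N \<Phi>(1) t'] \<Phi>(3)])
        then show ?thesis using False by (simp add: \<kappa>_def[abs_def] b_def N_def[symmetric] del: of_nat_Suc)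
      qed
    next
      fix j t assume "j \<in> u - v"
      then show "\<bar>\<kappa> j t\<bar> \<le> c j" using once0_le[OF N, of "a1 j" "Phi \<phi> t"] by (simp add: \<kappa>_def c_def)
    next
      fix j assume j: "j \<in> v"
      show "(G j has_real_derivative (\<kappa> j t - R j t)) (at t)" for t
      proof -
        have "((\<lambda>t. twice0 N (a1 j) (a2 j) (l j) (Phi \<phi> t)) has_real_derivative twice1 N (a1 j) (a2 j) (l j) (Phi \<phi> t) * \<phi> t) (at t)"
          by (rule DERIV_chain2[OF twice0_deriv[OF vj(1,2)[OF j] \<Phi>(1) N] \<Phi>(3)])
        from DERIV_divide[OF this d\<phi>] pos(1)[of t]
        have "(G j has_real_derivative (twice1 N (a1 j) (a2 j) (l j) (Phi \<phi> t) * \<phi> t * \<phi> t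
           - twice0 N (a1 j) (a2 j) (l j) (Phi \<phi> t) * deriv \<phi> t) / (\<phi> t * \<phi> t)) (at t)"
          unfolding G_def[abs_def] by simp
        moreover have "(twice1 N (a1 j) (a2 j) (l j) (Phi \<phi> t) * \<phi> t * \<phi> t
           - twice0 N (a1 j) (a2 j) (l j) (Phi \<phi> t) * deriv \<phi> t) / (\<phi> t * \<phi> t) = \<kappa> j t - R j t"
          using pos(1)[of t] j by (simp add: \<kappa>_def R_def diff_divide_distrib power2_eq_square)
        ultimately show ?thesis by simp
      qed
      show "G j t = 0" "R j t = 0" if "r \<le> \<bar>t\<bar>" for t
        using twice_zero(1)[OF hat0[OF that]] by (simp_all add: G_def R_def)
      show "R j \<in> borel_measurable borel" unfolding R_def[abs_def] by measurable
      have cj: "c j = C / 2 powr (real (a1 j) + \<beta> * real (a2 j))" using j by (simp add: c_def)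
      note A = assumption_A_hat[OF assms(7) vj(1)[OF j] \<Phi>(1,2) pos, folded cj]
      have P: "\<bar>twice0 N (a1 j) (a2 j) (l j) (Phi \<phi> t)\<bar> \<le> hat (a1 j) (a2 j) (Phi \<phi> t)" for t
        by (rule twice0_le[OF N])
      show "\<bar>G j t\<bar> \<le> c j * \<psi> t" for t
      proof -
        have "\<bar>twice0 N (a1 j) (a2 j) (l j) (Phi \<phi> t)\<bar> \<le> (c j * \<psi> t) * \<phi> t"
          using order_trans[OF P A(1)] by (simp only: ac_simps)
        then show ?thesis using pos(1)[of t] by (simp add: G_def abs_divide pos_divide_le_eq)
      qed
      show "\<bar>R j t\<bar> \<le> c j * \<omega> t" for t
      proof -
        have "\<bar>twice0 N (a1 j) (a2 j) (l j) (Phi \<phi> t)\<bar> * \<bar>deriv \<phi> t\<bar> \<le> (c j * \<omega> t) * (\<phi> t)\<^sup>2"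
          using order_trans[OF mult_right_mono[OF P abs_ge_zero] A(2)] by (simp only: ac_simps)
        then show ?thesis using pos(1)[of t] by (simp add: R_def abs_divide abs_mult pos_divide_le_eq)
      qed
    qed (fact assms)+
  qed
  have lim: "(\<lambda>n. \<integral>x. F (vec_lambda x) * ((\<Prod>j\<in>u. b n j (x j)) * (\<Prod>j\<in>-u. \<phi> (x j))) \<partial>L)
    \<longlonglongrightarrow> (\<integral>x. F (vec_lambda x) * ((\<Prod>j\<in>u. wal (y j) (Phi \<phi> (x j)) * \<phi> (x j)) * (\<Prod>j\<in>-u. \<phi> (x j))) \<partial>L)"
  proof (rule integral_dominated_convergence[where w = "\<lambda>x. 13 ^ card u * \<bar>F (vec_lambda x) * (\<Prod>j\<in>UNIV. \<phi> (x j))\<bar>"])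
    show "(\<lambda>x. F (vec_lambda x) * ((\<Prod>j\<in>u. wal (y j) (Phi \<phi> (x j)) * \<phi> (x j)) * (\<Prod>j\<in>-u. \<phi> (x j)))) \<in> borel_measurable L"
      unfolding L_def by measurable
    show "(\<lambda>x. F (vec_lambda x) * ((\<Prod>j\<in>u. b n j (x j)) * (\<Prod>j\<in>-u. \<phi> (x j)))) \<in> borel_measurable L" for n
      unfolding L_def by measurable
    show "integrable L (\<lambda>x. 13 ^ card u * \<bar>F (vec_lambda x) * (\<Prod>j\<in>UNIV. \<phi> (x j))\<bar>)"
      unfolding L_def by (intro integrable_mult_right integrable_abs in_L2_integrable[OF \<phi> assms(8)])
    have "AE x in L. \<forall>j\<in>u. x j \<notin> {t. 2 ^ Suc (a1 j) * Phi \<phi> t \<in> \<int>}"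
      unfolding L_def by (intro AE_finite_allI AE_component_not_in_finite \<Phi>(5)) simp
    then show "AE x in L. (\<lambda>n. F (vec_lambda x) * ((\<Prod>j\<in>u. b n j (x j)) * (\<Prod>j\<in>-u. \<phi> (x j))))
      \<longlonglongrightarrow> F (vec_lambda x) * ((\<Prod>j\<in>u. wal (y j) (Phi \<phi> (x j)) * \<phi> (x j)) * (\<Prod>j\<in>-u. \<phi> (x j)))"
    proof eventually_elim
      case (elim x)
      have "(\<lambda>n. b n j (x j)) \<longlonglongrightarrow> wal (y j) (Phi \<phi> (x j)) * \<phi> (x j)" if j: "j \<in> u" for j
      proof -
        have g: "2 ^ Suc (a1 j) * Phi \<phi> (x j) \<notin> \<int>" using elim j by auto
        show ?thesis
        proof (cases "j \<in> v")
          case True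
          show ?thesis
            using tendsto_mult[OF twice2_lim[OF vj(1)[OF True] g, of "l j"] tendsto_const[of "\<phi> (x j)"]] True
            unfolding b_def vj(3)[OF True] wal_two_powers_add[OF vj(1,2)[OF True]] by simp
        next
          case False
          have "y j = 2 ^ a1 j" using assms(14) j False by auto
          then show ?thesis
            using tendsto_mult[OF once1_lim[OF g] tendsto_const[of "\<phi> (x j)"]] False
            unfolding b_def by (simp add: wal_power)
        qed
      qed
      then show ?case by (intro tendsto_mult tendsto_const tendsto_prod)
    qed
    show "AE x in L. norm (F (vec_lambda x) * ((\<Prod>j\<in>u. b n j (x j)) * (\<Prod>j\<in>-u. \<phi> (x j))))
      \<le> 13 ^ card u * \<bar>F (vec_lambda x) * (\<Prod>j\<in>UNIV. \<phi> (x j))\<bar>" for n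
    proof (rule AE_I2)
      fix x :: "'s \<Rightarrow> real"
      have "\<bar>\<Prod>j\<in>u. b n j (x j)\<bar> \<le> (\<Prod>j\<in>u. 13 * \<phi> (x j))"
        unfolding abs_prod by (intro prod_mono) (auto simp: b13)
      also have "\<dots> = 13 ^ card u * \<bar>\<Prod>j\<in>u. \<phi> (x j)\<bar>"
        using pos(1) by (simp add: prod.distrib abs_of_nonneg prod_nonneg less_imp_le)
      finally have 1: "\<bar>\<Prod>j\<in>u. b n j (x j)\<bar> \<le> 13 ^ card u * \<bar>\<Prod>j\<in>u. \<phi> (x j)\<bar>" .
      have "\<bar>F (vec_lambda x)\<bar> * (\<bar>\<Prod>j\<in>u. b n j (x j)\<bar> * \<bar>\<Prod>j\<in>-u. \<phi> (x j)\<bar>)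
        \<le> \<bar>F (vec_lambda x)\<bar> * ((13 ^ card u * \<bar>\<Prod>j\<in>u. \<phi> (x j)\<bar>) * \<bar>\<Prod>j\<in>-u. \<phi> (x j)\<bar>)"
        by (intro mult_left_mono mult_right_mono 1) auto
      then show "norm (F (vec_lambda x) * ((\<Prod>j\<in>u. b n j (x j)) * (\<Prod>j\<in>-u. \<phi> (x j))))
        \<le> 13 ^ card u * \<bar>F (vec_lambda x) * (\<Prod>j\<in>UNIV. \<phi> (x j))\<bar>"
        unfolding prod_split[of "\<lambda>j. \<phi> (x j)" u] real_norm_def abs_mult by (simp only: ac_simps)
    qed
  qed
  have walsh: "walsh_coeff \<phi> F y = (\<integral>x. F (vec_lambda x) * ((\<Prod>j\<in>u. wal (y j) (Phi \<phi> (x j)) * \<phi> (x j)) * (\<Prod>j\<in>-u. \<phi> (x j))) \<partial>L)"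
  proof -
    have "walsh_coeff \<phi> F y = (\<integral>x. F (vec_lambda x) * (\<Prod>j\<in>UNIV. wal (y j) (Phi \<phi> (vec_lambda x $ j))) * (\<Prod>j\<in>UNIV. \<phi> (vec_lambda x $ j)) \<partial>L)"
      unfolding walsh_coeff_def L_def by (rule integral_vec_lambda) measurable
    also have "\<dots> = (\<integral>x. F (vec_lambda x) * ((\<Prod>j\<in>u. wal (y j) (Phi \<phi> (x j)) * \<phi> (x j)) * (\<Prod>j\<in>-u. \<phi> (x j))) \<partial>L)"
    proof (rule Bochner_Integration.integral_cong[OF refl])
      fix x :: "'s \<Rightarrow> real"
      have "(\<Prod>j\<in>-u. wal (y j) (Phi \<phi> (x j))) = 1" using assms(15) by (intro prod.neutral) (auto simp: wal_0)
      then show "F (vec_lambda x) * (\<Prod>j\<in>UNIV. wal (y j) (Phi \<phi> (vec_lambda x $ j))) * (\<Prod>j\<in>UNIV. \<phi> (vec_lambda x $ j))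
        = F (vec_lambda x) * ((\<Prod>j\<in>u. wal (y j) (Phi \<phi> (x j)) * \<phi> (x j)) * (\<Prod>j\<in>-u. \<phi> (x j)))"
        unfolding prod_split[of _ u] prod.distrib by simp
    qed
    finally show ?thesis .
  qed
  have "ennreal \<bar>walsh_coeff \<phi> F y\<bar> \<le> ennreal (\<Prod>j\<in>u. c j) * norm_uv \<phi> \<psi> \<omega> F u v"
    unfolding walsh
    by (rule tendsto_upperbound[OF tendsto_ennrealI[OF tendsto_rabs[OF lim]] always_eventually]) (simp_all add: bound)
  also have "(\<Prod>j\<in>u. c j) \<le> max C (1 / 2) ^ card u * (\<Prod>j\<in>v. 1 / 2 powr (real (a1 j) + \<beta> * real (a2 j))) * (\<Prod>j\<in>u - v. 1 / 2 ^ a1 j)"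
  proof -
    define e where "e j = (if j \<in> v then 1 / 2 powr (real (a1 j) + \<beta> * real (a2 j)) else 1 / 2 ^ a1 j)" for j
    have "(\<Prod>j\<in>u. c j) \<le> (\<Prod>j\<in>u. max C (1 / 2) * e j)"
    proof (rule prod_mono)
      fix j
      have "c j = (if j \<in> v then C else 1 / 2) * e j" by (simp add: c_def e_def)
      also have "\<dots> \<le> max C (1 / 2) * e j" by (intro mult_right_mono) (auto simp: e_def)
      finally show "0 \<le> c j \<and> c j \<le> max C (1 / 2) * e j" using cpos[of j] by simp
    qed
    also have "\<dots> = max C (1 / 2) ^ card u * (\<Prod>j\<in>u. e j)" by (simp add: prod.distrib)
    also have "(\<Prod>j\<in>u. e j) = (\<Prod>j\<in>u - v. e j) * (\<Prod>j\<in>v. e j)"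
      using assms(10) by (intro prod.subset_diff) auto
    also have "(\<Prod>j\<in>u - v. e j) = (\<Prod>j\<in>u - v. 1 / 2 ^ a1 j)" by (intro prod.cong) (auto simp: e_def)
    also have "(\<Prod>j\<in>v. e j) = (\<Prod>j\<in>v. 1 / 2 powr (real (a1 j) + \<beta> * real (a2 j)))" by (intro prod.cong) (auto simp: e_def)
    finally show ?thesis by (simp only: ac_simps)
  qed
  also have "ennreal (max C (1 / 2) ^ card u * (\<Prod>j\<in>v. 1 / 2 powr (real (a1 j) + \<beta> * real (a2 j))) * (\<Prod>j\<in>u - v. 1 / 2 ^ a1 j)) * norm_uv \<phi> \<psi> \<omega> F u v
    = ennreal (max C (1 / 2) ^ card u) * norm_uv \<phi> \<psi> \<omega> F u v
      * ennreal (\<Prod>j\<in>v. 1 / 2 powr (real (a1 j) + \<beta> * real (a2 j)))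
      * ennreal (\<Prod>j\<in>u - v. 1 / 2 ^ a1 j)"
    by (simp add: ennreal_mult prod_nonneg ac_simps)
  finally show ?thesis by (simp add: mult_right_mono ennreal_leI)
qed

end
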